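(* Let $(A,\Gamma,\alpha,\beta)$ be an object crossed system with $\Gamma$ a connected groupoid, let $R := A\rtimes^\alpha_\beta\Gamma$ be the corresponding object crossed product, let $\Delta$ be a wide subgroupoid of $\Gamma$, and let $R_\Delta := A\rtimes^{\alpha_\Delta}_{\beta_\Delta}\Delta$, where $\alpha_\Delta = (\alpha_\sigma)_{\sigma\in\Delta}$ and $\beta_\Delta = (\beta_{\sigma,\tau})_{(\sigma,\tau)\in\Delta_2}$. (a) $R/R_\Delta$ is separable if and only if, for each $e\in\Gamma_0$, there exist a finite subset $F_e$ of $\Gamma_0^{\mathrm{fin}}$ and elements $a_f^e\in Z(A_f)^{\Delta(f)}$, for $f\in F_e$, with $\sum_{f\in F_e}\mathrm{tr}_{\Gamma/\Delta}^{f,e}(a_f^e) = 1_{A_e}$. (b) Suppose that there are $f\in\Gamma_0$ and $a\in Z(A_f)^{\Delta(f)}$ such that $[\Gamma(f):\Delta(f)]<\infty$ and $\mathrm{tr}_{\Gamma/\Delta}^{f,f}(a) = 1_{A_f}$. Then $R/R_\Delta$ is separable. (c) If $\Delta$ is a normal subgroupoid of $\Gamma$, then $R/R_\Delta$ is separable if and only if, for each $e\in\Gamma_0$, $[\Gamma(e):\Delta(e)]<\infty$ and there is $a\in Z(A_e)^{\Delta(e)}$ with $\mathrm{tr}_{\Gamma/\Delta}^{e,e}(a) = 1_{A_e}$. (d) If $R = B\rtimes_\beta\Gamma$ is an object twisted groupoid ring, then $R/R_\Delta$ is separable if and only if, for each $e\in\Gamma_0$, there exist a finite subset $F_e$ of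 $\Gamma_0^{\mathrm{fin}}$ and elements $b_f^e\in Z(B)$, for $f\in F_e$, such that $\sum_{f\in F_e}[\Gamma(f):\Delta(f)]\, b_f^e = 1_B$. (e) If $\Delta$ is a normal subgroupoid of $\Gamma$ and $R = B\rtimes_\beta\Gamma$ is an object twisted groupoid ring, then $R/R_\Delta$ is separable if and only if, for each $e\in\Gamma_0$, $[\Gamma(e):\Delta(e)]$ is finite and invertible in $B$. (f) If $R = B\rtimes_\beta\Gamma$ is an object twisted groupoid ring and there is $f\in\Gamma_0$ such that $[\Gamma(f):\Delta(f)]$ is finite and invertible in $B$, then $R/R_\Delta$ is separable.
   Context: Rings are associative but not necessarily unital; a unital ring has $1\neq0$. If $S$ is a subring of $R$, the extension $R/S$ is separable if there is an $R$-bimodule map $\delta: R\to R\otimes_S R$ with $\mu\circ\delta=\mathrm{id}_R$, where $\mu: R\otimes_S R\to R$ is the multiplication map. A groupoid $\Gamma$ is a small category in which every morphism is an isomorphism. $\Gamma_0$ is its set of objects, identified with the identity morphisms; $\sigma\in\Gamma$ means $\sigma$ is a morphism; $d(\sigma), r(\sigma)$ are its domain and range; $\Gamma(e,f)$ is the set of morphisms $e\to f$; $\Gamma(e):=\Gamma(e,e)$; $\Gamma_2 := \{(\sigma,\tau)\mid d(\sigma)=r(\tau)\}$. $\Gamma$ is connected if $\Gamma(e,f)\ne\emptyset$ for all $e,f\in\Gamma_0$. A subgroupoid $\Delta$ of $\Gamma$ (a subcategory that is a groupoid) is wide if $\Delta_0=\Gamma_0$, and normal if it is wide and $\sigma\Delta(e)\sigma^{-1}\subseteq\Delta(f)$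 for all $e,f\in\Gamma_0$, $\sigma\in\Gamma(e,f)$. $\Gamma_0^{\mathrm{fin}} := \{f\in\Gamma_0\mid[\Gamma(f):\Delta(f)]<\infty\}$. An object crossed system $(A,\Gamma,\alpha,\beta)$ consists of a groupoid $\Gamma$, a family $A=(A_e)_{e\in\Gamma_0}$ of unital rings, a family $\alpha=(\alpha_\sigma: A_{d(\sigma)}\to A_{r(\sigma)})_{\sigma\in\Gamma}$ of unital ring isomorphisms, and a family $\beta=(\beta_{\sigma,\tau})_{(\sigma,\tau)\in\Gamma_2}$ of units $\beta_{\sigma,\tau}$ of $A_{r(\sigma)}$, such that: (O1) $\alpha_e=\mathrm{id}_{A_e}$ for $e\in\Gamma_0$; (O2) $\beta_{\sigma,d(\sigma)}=\beta_{r(\sigma),\sigma}=1_{A_{r(\sigma)}}$ for $\sigma\in\Gamma$; (O3) $\alpha_\sigma(\alpha_\tau(a))=\beta_{\sigma,\tau}\alpha_{\sigma\tau}(a)\beta_{\sigma,\tau}^{-1}$ for $(\sigma,\tau)\in\Gamma_2$, $a\in A_{d(\tau)}$; (O4) $\beta_{\sigma,\tau}\beta_{\sigma\tau,\rho}=\alpha_\sigma(\beta_{\tau,\rho})\beta_{\sigma,\tau\rho}$ for $(\sigma,\tau),(\tau,\rho)\in\Gamma_2$. The object crossed product $A\rtimes^\alpha_\beta\Gamma$ is the set of formal sums $\sum_{\sigma\in\Gamma}a_\sigma u_\sigma$ with $a_\sigma\in A_{r(\sigma)}$, almost all zero, where $u_\sigma$ are formal symbols, with componentwise addition and multiplication extending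 additively $(a_\sigma u_\sigma)(a'_\tau u_\tau)=a_\sigma\alpha_\sigma(a'_\tau)\beta_{\sigma,\tau}u_{\sigma\tau}$ if $(\sigma,\tau)\in\Gamma_2$, and $0$ otherwise. $R_\Delta$ is regarded as the subring of $R$ of sums supported on $\Delta$. If all $A_e$ equal the same ring $B$ and every $\alpha_\sigma$ is $\mathrm{id}_B$, the object crossed product is called an object twisted groupoid ring and denoted $B\rtimes_\beta\Gamma$. For $X\subseteq A_e$, $X^{\Delta(e)}:=\{x\in X\mid\alpha_\sigma(x)=x\text{ for all }\sigma\in\Delta(e)\}$. $Z(\cdot)$ denotes the center. Put $\Lambda:=\bigcup_{e\in\Gamma_0}\Delta(e)$. Call $\sigma,\tau\in\Gamma$ right $\Lambda$-equivalent if $\sigma\Lambda=\tau\Lambda$ (with $\sigma\Lambda$ the set of composites $\sigma\lambda$, $\lambda\in\Lambda$, $(\sigma,\lambda)\in\Gamma_2$); let $T\supseteq\Gamma_0$ be a set of representatives of the classes and $T_{f,e}:=\{\tau\in T\mid d(\tau)=f, r(\tau)=e\}$. For $e\in\Gamma_0$ and $f\in\Gamma_0^{\mathrm{fin}}$ (in which case $T_{f,e}$ is finite), $\mathrm{tr}_{\Gamma/\Delta}^{f,e}: Z(A_f)^{\Delta(f)}\to Z(A_e)^{\Delta(e)}$ is defined by $\mathrm{tr}_{\Gamma/\Delta}^{f,e}(a)=\sum_{\tau\in T_{f,e}}\alpha_\tau(a)$. *)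

theory Defs
  imports "HOL-Algebra.Algebra"
begin

section \<open>Separable extensions of not necessarily unital rings\<close>

text \<open>
  A ring need not be unital. It is represented by a ring record whose field \<open>one\<close> is ignored:
  none of the definitions in this section refers to it.
\<close>

locale nonunital_ring = abelian_group R for R (structure) +
  assumes m_closed: "\<lbrakk>x \<in> carrier R; y \<in> carrier R\<rbrakk> \<Longrightarrow> x \<otimes> y \<in> carrier R"
    and m_assoc: "\<lbrakk>x \<in> carrier R; y \<in> carrier R; z \<in> carrier R\<rbrakk> \<Longrightarrow> (x \<otimes> y) \<otimes> z = x \<otimes> (y \<otimes> z)"
    and l_distr: "\<lbrakk>x \<in> carrier R; y \<in> carrier R; z \<in> carrier R\<rbrakk> \<Longrightarrow> (x \<oplus> y) \<otimes> z = x \<otimes> z \<oplus> y \<otimes> z"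
    and r_distr: "\<lbrakk>x \<in> carrier R; y \<in> carrier R; z \<in> carrier R\<rbrakk> \<Longrightarrow> z \<otimes> (x \<oplus> y) = z \<otimes> x \<oplus> z \<otimes> y"

definition nonunital_subring :: "'r set \<Rightarrow> ('r, 'm) ring_scheme \<Rightarrow> bool" where
  "nonunital_subring S R \<longleftrightarrow>
     subgroup S (add_monoid R) \<and> (\<forall>x\<in>S. \<forall>y\<in>S. x \<otimes>\<^bsub>R\<^esub> y \<in> S)"

text \<open>
  The tensor product of \<open>R\<close> with itself over \<open>S\<close>: the free abelian group on pairs
  modulo biadditivity and \<open>S\<close>-balancedness. Its elements are cosets.
\<close>

abbreviation tensor_free :: "('r, 'm) ring_scheme \<Rightarrow> ('r \<times> 'r \<Rightarrow>\<^sub>0 int) monoid" where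
  "tensor_free R \<equiv> free_Abelian_group (carrier R \<times> carrier R)"

definition tensor_relations :: "('r, 'm) ring_scheme \<Rightarrow> 'r set \<Rightarrow> ('r \<times> 'r \<Rightarrow>\<^sub>0 int) set" where
  "tensor_relations R S =
     {frag_of (x \<oplus>\<^bsub>R\<^esub> x', y) - frag_of (x, y) - frag_of (x', y) | x x' y.
        x \<in> carrier R \<and> x' \<in> carrier R \<and> y \<in> carrier R} \<union>
     {frag_of (x, y \<oplus>\<^bsub>R\<^esub> y') - frag_of (x, y) - frag_of (x, y') | x y y'.
        x \<in> carrier R \<and> y \<in> carrier R \<and> y' \<in> carrier R} \<union>
     {frag_of (x \<otimes>\<^bsub>R\<^esub> s, y) - frag_of (x, s \<otimes>\<^bsub>R\<^esub> y) | x s y.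
        x \<in> carrier R \<and> s \<in> S \<and> y \<in> carrier R}"

definition tensor_kernel :: "('r, 'm) ring_scheme \<Rightarrow> 'r set \<Rightarrow> ('r \<times> 'r \<Rightarrow>\<^sub>0 int) set" where
  "tensor_kernel R S = generate (tensor_free R) (tensor_relations R S)"

definition tensor_square :: "('r, 'm) ring_scheme \<Rightarrow> 'r set \<Rightarrow> ('r \<times> 'r \<Rightarrow>\<^sub>0 int) set monoid" where
  "tensor_square R S = tensor_free R Mod tensor_kernel R S"

text \<open>
  The bimodule structure and the multiplication map are induced by
  \<open>r (x \<otimes> y) = (r x) \<otimes> y\<close>, \<open>(x \<otimes> y) r = x \<otimes> (y r)\<close> and \<open>x \<otimes> y \<mapsto> x y\<close>.
  Adding the kernel to the image of a coset under the lifted map gives the coset of the image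
  of any representative.
\<close>

definition tensor_left_act ::
    "('r, 'm) ring_scheme \<Rightarrow> 'r set \<Rightarrow> 'r \<Rightarrow> ('r \<times> 'r \<Rightarrow>\<^sub>0 int) set \<Rightarrow> ('r \<times> 'r \<Rightarrow>\<^sub>0 int) set" where
  "tensor_left_act R S r C =
     tensor_kernel R S <#>\<^bsub>tensor_free R\<^esub> frag_extend (\<lambda>(x, y). frag_of (r \<otimes>\<^bsub>R\<^esub> x, y)) ` C"

definition tensor_right_act ::
    "('r, 'm) ring_scheme \<Rightarrow> 'r set \<Rightarrow> ('r \<times> 'r \<Rightarrow>\<^sub>0 int) set \<Rightarrow> 'r \<Rightarrow> ('r \<times> 'r \<Rightarrow>\<^sub>0 int) set" where
  "tensor_right_act R S C r =
     tensor_kernel R S <#>\<^bsub>tensor_free R\<^esub> frag_extend (\<lambda>(x, y). frag_of (x, y \<otimes>\<^bsub>R\<^esub> r)) ` C"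

definition tensor_mult :: "('r, 'm) ring_scheme \<Rightarrow> ('r \<times> 'r \<Rightarrow>\<^sub>0 int) set \<Rightarrow> 'r" where
  "tensor_mult R C =
     the_elem ((\<lambda>c. \<Oplus>\<^bsub>R\<^esub>p\<in>Poly_Mapping.keys c.
                      [Poly_Mapping.lookup c p] \<cdot>\<^bsub>R\<^esub> (fst p \<otimes>\<^bsub>R\<^esub> snd p)) ` C)"

definition separable_extension :: "('r, 'm) ring_scheme \<Rightarrow> 'r set \<Rightarrow> bool" where
  "separable_extension R S \<longleftrightarrow>
     nonunital_ring R \<and> nonunital_subring S R \<and>
     (\<exists>\<delta> \<in> hom (add_monoid R) (tensor_square R S).
        (\<forall>r\<in>carrier R. \<forall>x\<in>carrier R.
           \<delta> (r \<otimes>\<^bsub>R\<^esub> x) = tensor_left_act R S r (\<delta> x) \<and>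
           \<delta> (x \<otimes>\<^bsub>R\<^esub> r) = tensor_right_act R S (\<delta> x) r) \<and>
        (\<forall>x\<in>carrier R. tensor_mult R (\<delta> x) = x))"


section \<open>Groupoids\<close>

text \<open>
  Objects are identified with their identity morphisms, so \<open>Obj G\<close> is a subset of \<open>Arr G\<close>.
  The composite \<open>cmp G \<sigma> \<tau>\<close> (first \<open>\<tau>\<close>, then \<open>\<sigma>\<close>) is meaningful when \<open>src G \<sigma> = trg G \<tau>\<close>.
\<close>

record 'g groupoid_struct =
  Arr :: "'g set"
  Obj :: "'g set"
  src :: "'g \<Rightarrow> 'g"
  trg :: "'g \<Rightarrow> 'g"
  cmp :: "'g \<Rightarrow> 'g \<Rightarrow> 'g"

locale groupoid =
  fixes G :: "'g groupoid_struct"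
  assumes Obj_subset: "Obj G \<subseteq> Arr G"
    and src_Obj: "\<sigma> \<in> Arr G \<Longrightarrow> src G \<sigma> \<in> Obj G"
    and trg_Obj: "\<sigma> \<in> Arr G \<Longrightarrow> trg G \<sigma> \<in> Obj G"
    and src_id: "e \<in> Obj G \<Longrightarrow> src G e = e"
    and trg_id: "e \<in> Obj G \<Longrightarrow> trg G e = e"
    and cmp_closed: "\<lbrakk>\<sigma> \<in> Arr G; \<tau> \<in> Arr G; src G \<sigma> = trg G \<tau>\<rbrakk> \<Longrightarrow> cmp G \<sigma> \<tau> \<in> Arr G"
    and src_cmp: "\<lbrakk>\<sigma> \<in> Arr G; \<tau> \<in> Arr G; src G \<sigma> = trg G \<tau>\<rbrakk> \<Longrightarrow> src G (cmp G \<sigma> \<tau>) = src G \<tau>"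
    and trg_cmp: "\<lbrakk>\<sigma> \<in> Arr G; \<tau> \<in> Arr G; src G \<sigma> = trg G \<tau>\<rbrakk> \<Longrightarrow> trg G (cmp G \<sigma> \<tau>) = trg G \<sigma>"
    and cmp_assoc: "\<lbrakk>\<sigma> \<in> Arr G; \<tau> \<in> Arr G; \<rho> \<in> Arr G; src G \<sigma> = trg G \<tau>; src G \<tau> = trg G \<rho>\<rbrakk>
      \<Longrightarrow> cmp G (cmp G \<sigma> \<tau>) \<rho> = cmp G \<sigma> (cmp G \<tau> \<rho>)"
    and cmp_src: "\<sigma> \<in> Arr G \<Longrightarrow> cmp G \<sigma> (src G \<sigma>) = \<sigma>"
    and cmp_trg: "\<sigma> \<in> Arr G \<Longrightarrow> cmp G (trg G \<sigma>) \<sigma> = \<sigma>"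
    and invertible: "\<sigma> \<in> Arr G \<Longrightarrow>
      \<exists>\<tau>\<in>Arr G. src G \<tau> = trg G \<sigma> \<and> trg G \<tau> = src G \<sigma> \<and>
               cmp G \<sigma> \<tau> = trg G \<sigma> \<and> cmp G \<tau> \<sigma> = src G \<sigma>"

definition ginv :: "'g groupoid_struct \<Rightarrow> 'g \<Rightarrow> 'g" where
  "ginv G \<sigma> = (THE \<tau>. \<tau> \<in> Arr G \<and> src G \<tau> = trg G \<sigma> \<and> trg G \<tau> = src G \<sigma> \<and>
                     cmp G \<sigma> \<tau> = trg G \<sigma> \<and> cmp G \<tau> \<sigma> = src G \<sigma>)"

text \<open>
  For a set \<open>D\<close> of morphisms, \<open>hom_in G D e f\<close> consists of the members of \<open>D\<close> from \<open>e\<close> to \<open>f\<close>.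
\<close>

definition hom_in :: "'g groupoid_struct \<Rightarrow> 'g set \<Rightarrow> 'g \<Rightarrow> 'g \<Rightarrow> 'g set" where
  "hom_in G D e f = {\<sigma> \<in> D. src G \<sigma> = e \<and> trg G \<sigma> = f}"

definition connected_groupoid :: "'g groupoid_struct \<Rightarrow> bool" where
  "connected_groupoid G \<longleftrightarrow> (\<forall>e\<in>Obj G. \<forall>f\<in>Obj G. hom_in G (Arr G) e f \<noteq> {})"

text \<open>A subgroupoid is given by its set of morphisms, which contains its objects.\<close>

definition subgroupoid :: "'g set \<Rightarrow> 'g groupoid_struct \<Rightarrow> bool" where
  "subgroupoid D G \<longleftrightarrow>
     D \<subseteq> Arr G \<and>
     (\<forall>\<sigma>\<in>D. src G \<sigma> \<in> D \<and> trg G \<sigma> \<in> D \<and> ginv G \<sigma> \<in> D) \<and>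
     (\<forall>\<sigma>\<in>D. \<forall>\<tau>\<in>D. src G \<sigma> = trg G \<tau> \<longrightarrow> cmp G \<sigma> \<tau> \<in> D)"

definition wide_subgroupoid :: "'g set \<Rightarrow> 'g groupoid_struct \<Rightarrow> bool" where
  "wide_subgroupoid D G \<longleftrightarrow> subgroupoid D G \<and> Obj G \<subseteq> D"

definition normal_subgroupoid :: "'g set \<Rightarrow> 'g groupoid_struct \<Rightarrow> bool" where
  "normal_subgroupoid D G \<longleftrightarrow>
     wide_subgroupoid D G \<and>
     (\<forall>e\<in>Obj G. \<forall>f\<in>Obj G. \<forall>\<sigma>\<in>hom_in G (Arr G) e f. \<forall>\<delta>\<in>hom_in G D e e.
        cmp G (cmp G \<sigma> \<delta>) (ginv G \<sigma>) \<in> hom_in G D f f)"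

definition isotropy_group :: "'g groupoid_struct \<Rightarrow> 'g \<Rightarrow> 'g monoid" where
  "isotropy_group G e = \<lparr>carrier = hom_in G (Arr G) e e, monoid.mult = cmp G, one = e\<rparr>"

abbreviation isotropy_cosets :: "'g groupoid_struct \<Rightarrow> 'g set \<Rightarrow> 'g \<Rightarrow> 'g set set" where
  "isotropy_cosets G D e \<equiv> rcosets\<^bsub>isotropy_group G e\<^esub> (hom_in G D e e)"

definition finite_index :: "'g groupoid_struct \<Rightarrow> 'g set \<Rightarrow> 'g \<Rightarrow> bool" where
  "finite_index G D e \<longleftrightarrow> finite (isotropy_cosets G D e)"

definition index :: "'g groupoid_struct \<Rightarrow> 'g set \<Rightarrow> 'g \<Rightarrow> nat" where
  "index G D e = card (isotropy_cosets G D e)"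

definition Obj_fin :: "'g groupoid_struct \<Rightarrow> 'g set \<Rightarrow> 'g set" where
  "Obj_fin G D = {f \<in> Obj G. finite_index G D f}"

definition isotropy_union :: "'g groupoid_struct \<Rightarrow> 'g set \<Rightarrow> 'g set" where
  "isotropy_union G D = (\<Union>e\<in>Obj G. hom_in G D e e)"

definition isotropy_class :: "'g groupoid_struct \<Rightarrow> 'g set \<Rightarrow> 'g \<Rightarrow> 'g set" where
  "isotropy_class G D \<sigma> = {cmp G \<sigma> \<delta> | \<delta>. \<delta> \<in> isotropy_union G D \<and> src G \<sigma> = trg G \<delta>}"

definition isotropy_transversal :: "'g groupoid_struct \<Rightarrow> 'g set \<Rightarrow> 'g set \<Rightarrow> bool" where
  "isotropy_transversal G D T \<longleftrightarrow>
     Obj G \<subseteq> T \<and> T \<subseteq> Arr G \<and>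
     (\<forall>\<sigma>\<in>Arr G. \<exists>!\<tau>. \<tau> \<in> T \<and> isotropy_class G D \<sigma> = isotropy_class G D \<tau>)"


section \<open>Object crossed systems and object crossed products\<close>

text \<open>The rings \<open>A e\<close> have carriers in a common type; only the values at objects matter.\<close>

locale object_crossed_system = groupoid G
  for G :: "'g groupoid_struct" +
  fixes A :: "'g \<Rightarrow> 'a ring"
    and \<alpha> :: "'g \<Rightarrow> 'a \<Rightarrow> 'a"
    and \<beta> :: "'g \<Rightarrow> 'g \<Rightarrow> 'a"
  assumes ring_A: "e \<in> Obj G \<Longrightarrow> ring (A e)"
    and one_neq_zero: "e \<in> Obj G \<Longrightarrow> \<one>\<^bsub>A e\<^esub> \<noteq> \<zero>\<^bsub>A e\<^esub>"
    and \<alpha>_iso: "\<sigma> \<in> Arr G \<Longrightarrow> \<alpha> \<sigma> \<in> ring_iso (A (src G \<sigma>)) (A (trg G \<sigma>))"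
    and \<beta>_unit: "\<lbrakk>\<sigma> \<in> Arr G; \<tau> \<in> Arr G; src G \<sigma> = trg G \<tau>\<rbrakk> \<Longrightarrow> \<beta> \<sigma> \<tau> \<in> Units (A (trg G \<sigma>))"
    and O1: "\<lbrakk>e \<in> Obj G; a \<in> carrier (A e)\<rbrakk> \<Longrightarrow> \<alpha> e a = a"
    and O2: "\<sigma> \<in> Arr G \<Longrightarrow>
      \<beta> \<sigma> (src G \<sigma>) = \<one>\<^bsub>A (trg G \<sigma>)\<^esub> \<and> \<beta> (trg G \<sigma>) \<sigma> = \<one>\<^bsub>A (trg G \<sigma>)\<^esub>"
    and O3: "\<lbrakk>\<sigma> \<in> Arr G; \<tau> \<in> Arr G; src G \<sigma> = trg G \<tau>; a \<in> carrier (A (src G \<tau>))\<rbrakk> \<Longrightarrow>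
      \<alpha> \<sigma> (\<alpha> \<tau> a) =
        \<beta> \<sigma> \<tau> \<otimes>\<^bsub>A (trg G \<sigma>)\<^esub> \<alpha> (cmp G \<sigma> \<tau>) a \<otimes>\<^bsub>A (trg G \<sigma>)\<^esub> inv\<^bsub>A (trg G \<sigma>)\<^esub> (\<beta> \<sigma> \<tau>)"
    and O4: "\<lbrakk>\<sigma> \<in> Arr G; \<tau> \<in> Arr G; \<rho> \<in> Arr G; src G \<sigma> = trg G \<tau>; src G \<tau> = trg G \<rho>\<rbrakk> \<Longrightarrow>
      \<beta> \<sigma> \<tau> \<otimes>\<^bsub>A (trg G \<sigma>)\<^esub> \<beta> (cmp G \<sigma> \<tau>) \<rho> =
        \<alpha> \<sigma> (\<beta> \<tau> \<rho>) \<otimes>\<^bsub>A (trg G \<sigma>)\<^esub> \<beta> \<sigma> (cmp G \<tau> \<rho>)"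

text \<open>
  A formal sum is its coefficient function, set to \<open>undefined\<close> outside \<open>Arr G\<close>.
  The coefficient of a product at \<open>\<rho>\<close> collects the products of nonzero terms with
  \<open>\<sigma> \<tau> = \<rho>\<close>. There is in general no unit element, hence the unspecified field \<open>one\<close>.
\<close>

definition coeff_support :: "'g groupoid_struct \<Rightarrow> ('g \<Rightarrow> 'a ring) \<Rightarrow> ('g \<Rightarrow> 'a) \<Rightarrow> 'g set" where
  "coeff_support G A x = {\<sigma> \<in> Arr G. x \<sigma> \<noteq> \<zero>\<^bsub>A (trg G \<sigma>)\<^esub>}"

definition crossed_product ::
    "'g groupoid_struct \<Rightarrow> ('g \<Rightarrow> 'a ring) \<Rightarrow> ('g \<Rightarrow> 'a \<Rightarrow> 'a) \<Rightarrow> ('g \<Rightarrow> 'g \<Rightarrow> 'a) \<Rightarrow> ('g \<Rightarrow> 'a) ring" where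
  "crossed_product G A \<alpha> \<beta> =
     \<lparr>carrier = {x \<in> (\<Pi>\<^sub>E \<sigma>\<in>Arr G. carrier (A (trg G \<sigma>))). finite (coeff_support G A x)},
      monoid.mult = (\<lambda>x y. \<lambda>\<rho>\<in>Arr G.
        finsum (A (trg G \<rho>))
          (\<lambda>(\<sigma>, \<tau>). x \<sigma> \<otimes>\<^bsub>A (trg G \<rho>)\<^esub> \<alpha> \<sigma> (y \<tau>) \<otimes>\<^bsub>A (trg G \<rho>)\<^esub> \<beta> \<sigma> \<tau>)
          {(\<sigma>, \<tau>) \<in> coeff_support G A x \<times> coeff_support G A y.
             src G \<sigma> = trg G \<tau> \<and> cmp G \<sigma> \<tau> = \<rho>}),
      one = undefined,
      ring.zero = (\<lambda>\<sigma>\<in>Arr G. \<zero>\<^bsub>A (trg G \<sigma>)\<^esub>),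
      add = (\<lambda>x y. \<lambda>\<sigma>\<in>Arr G. x \<sigma> \<oplus>\<^bsub>A (trg G \<sigma>)\<^esub> y \<sigma>)\<rparr>"

text \<open>
  The crossed product over a subgroupoid \<open>D\<close>, regarded as the subring of the sums supported on \<open>D\<close>.
\<close>

definition crossed_subring ::
    "'g groupoid_struct \<Rightarrow> ('g \<Rightarrow> 'a ring) \<Rightarrow> ('g \<Rightarrow> 'a \<Rightarrow> 'a) \<Rightarrow> ('g \<Rightarrow> 'g \<Rightarrow> 'a) \<Rightarrow> 'g set \<Rightarrow> ('g \<Rightarrow> 'a) set" where
  "crossed_subring G A \<alpha> \<beta> D =
     {x \<in> carrier (crossed_product G A \<alpha> \<beta>). coeff_support G A x \<subseteq> D}"

definition object_twisted ::
    "'g groupoid_struct \<Rightarrow> ('g \<Rightarrow> 'a ring) \<Rightarrow> ('g \<Rightarrow> 'a \<Rightarrow> 'a) \<Rightarrow> 'a ring \<Rightarrow> bool" where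
  "object_twisted G A \<alpha> B \<longleftrightarrow>
     (\<forall>e\<in>Obj G. A e = B) \<and> (\<forall>\<sigma>\<in>Arr G. \<forall>b\<in>carrier B. \<alpha> \<sigma> b = b)"

definition ring_center :: "('a, 'm) ring_scheme \<Rightarrow> 'a set" where
  "ring_center R = {z \<in> carrier R. \<forall>x\<in>carrier R. x \<otimes>\<^bsub>R\<^esub> z = z \<otimes>\<^bsub>R\<^esub> x}"

definition invariants ::
    "'g groupoid_struct \<Rightarrow> ('g \<Rightarrow> 'a \<Rightarrow> 'a) \<Rightarrow> 'g set \<Rightarrow> 'g \<Rightarrow> 'a set \<Rightarrow> 'a set" where
  "invariants G \<alpha> D e Y = {x \<in> Y. \<forall>\<sigma>\<in>hom_in G D e e. \<alpha> \<sigma> x = x}"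

abbreviation central_invariants ::
    "'g groupoid_struct \<Rightarrow> ('g \<Rightarrow> 'a ring) \<Rightarrow> ('g \<Rightarrow> 'a \<Rightarrow> 'a) \<Rightarrow> 'g set \<Rightarrow> 'g \<Rightarrow> 'a set" where
  "central_invariants G A \<alpha> D e \<equiv> invariants G \<alpha> D e (ring_center (A e))"

text \<open>
  The sum is over a finite set when \<open>f \<in> Obj_fin G D\<close>; otherwise the value is not meaningful.
\<close>

definition groupoid_trace ::
    "'g groupoid_struct \<Rightarrow> ('g \<Rightarrow> 'a ring) \<Rightarrow> ('g \<Rightarrow> 'a \<Rightarrow> 'a) \<Rightarrow> 'g set \<Rightarrow> 'g \<Rightarrow> 'g \<Rightarrow> 'a \<Rightarrow> 'a" where
  "groupoid_trace G A \<alpha> T f e a = (\<Oplus>\<^bsub>A e\<^esub>\<tau>\<in>hom_in G T f e. \<alpha> \<tau> a)"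

end

theory Submission
  imports Defs
begin

text \<open>
  Write \<open>u\<^sub>\<sigma>\<close> for the basis elements and \<open>v\<^sub>\<sigma>\<close> for the inverse of \<open>u\<^sub>\<sigma>\<close>. The element \<open>u\<^sub>\<sigma> \<otimes> v\<^sub>\<sigma>\<close>
  of the tensor square depends only on the left coset of \<open>\<sigma>\<close> modulo \<open>D\<close>. A separability splitting
  \<open>\<delta>\<close> is determined by the elements \<open>\<delta> u\<^sub>e\<close>; their components of degree \<open>e\<close> have the form
  \<open>\<Sum> c\<^sub>C u\<^sub>\<sigma> \<otimes> v\<^sub>\<sigma>\<close>, the sum over cosets \<open>C\<close> with target \<open>e\<close>, and the bimodule conditions say that
  the \<open>c\<^sub>C\<close> are central, satisfy \<open>\<alpha>\<^sub>\<tau> c\<^sub>C = c\<^bsub>\<tau>C\<^esub>\<close> and add up to one. By equivariance such a family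
  is given by one central invariant for each connected component of \<open>D\<close>, which can be nonzero only
  where the isotropy index is finite, and the sum then becomes a sum of traces.
\<close>


section \<open>The tensor square on representatives\<close>

text \<open>The crossed product need not have a unit, so there need not be a separability
  idempotent; the identities of the objects act as local units, and all statements concern finite
  partial sums over objects. Coefficients of a tensor are not directly accessible, because the
  tensor square is a quotient. They are read off by maps taking x, y to g(x) y, which descend to the
  quotient once g is right linear over the subring. Finiteness comes from the representative: an
  element of the free abelian group has finitely many keys, each of finite support, so only finitely
  many cosets carry a nonzero coefficient. The maps \<alpha> compose only up to conjugation by
  \<beta>, but conjugation is trivial on centres, so there they form an honest action and can be
  summed over cosets. Two kinds of cosets compete: those of \<open>D\<close> have varying sources,
  whereas \<open>T\<close> separates sources. Keeping one object from each component of
  \<open>D\<close> prevents counting a coset of \<open>D\<close> several times. In the converse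
  direction the data found at one object must serve all objects at once; connectedness transports
  them.\<close>

definition frag_lift :: "('b, 'm) ring_scheme \<Rightarrow> ('p \<Rightarrow> 'b) \<Rightarrow> ('p \<Rightarrow>\<^sub>0 int) \<Rightarrow> 'b" where
  "frag_lift H f c =
     (\<Oplus>\<^bsub>H\<^esub>p\<in>Poly_Mapping.keys c. [Poly_Mapping.lookup c p] \<cdot>\<^bsub>H\<^esub> f p)"

context abelian_group
begin

lemma add_pow_int_0: "[(0::int)] \<cdot> x = \<zero>"
  by (simp add: add_pow_def)

text \<open>Extra indices carry coefficient 0 and contribute zero, so lifts of different elements
  can be summed over one common index set.\<close>

lemma frag_lift_superset:
  assumes "finite Y" "Poly_Mapping.keys c \<subseteq> Y" "f \<in> Y \<rightarrow> carrier G"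
  shows "frag_lift G f c = (\<Oplus>p\<in>Y. [Poly_Mapping.lookup c p] \<cdot> f p)"
  unfolding frag_lift_def using assms
  by (intro add.finprod_mono_neutral_cong_left)
     (auto simp: in_keys_iff Pi_iff subset_iff add_pow_int_0)

lemma frag_lift_closed:
  assumes "f \<in> Poly_Mapping.keys c \<rightarrow> carrier G"
  shows "frag_lift G f c \<in> carrier G"
  unfolding frag_lift_def using assms by (intro finsum_closed) auto

lemma frag_lift_zero [simp]: "frag_lift G f 0 = \<zero>"
  by (simp add: frag_lift_def)

lemma frag_lift_of [simp]: "f p \<in> carrier G \<Longrightarrow> frag_lift G f (frag_of p) = f p"
  by (simp add: frag_lift_def)

lemma frag_lift_add:
  assumes "f \<in> Poly_Mapping.keys c \<rightarrow> carrier G" "f \<in> Poly_Mapping.keys d \<rightarrow> carrier G"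
  shows "frag_lift G f (c + d) = frag_lift G f c \<oplus> frag_lift G f d"
proof -
  let ?Y = "Poly_Mapping.keys c \<union> Poly_Mapping.keys d"
  have Y: "finite ?Y" and f: "f \<in> ?Y \<rightarrow> carrier G"
    using assms by auto
  have "frag_lift G f (c + d) = (\<Oplus>p\<in>?Y. [Poly_Mapping.lookup (c + d) p] \<cdot> f p)"
    using Y f keys_add[of c d] by (intro frag_lift_superset)
  also have "\<dots> = (\<Oplus>p\<in>?Y. [Poly_Mapping.lookup c p] \<cdot> f p \<oplus> [Poly_Mapping.lookup d p] \<cdot> f p)"
    using f by (intro add.finprod_cong') (auto simp: Poly_Mapping.lookup_add add.int_pow_mult Pi_iff)
  also have "\<dots> = (\<Oplus>p\<in>?Y. [Poly_Mapping.lookup c p] \<cdot> f p) \<oplus> (\<Oplus>p\<in>?Y. [Poly_Mapping.lookup d p] \<cdot> f p)"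
    using f by (intro finsum_addf) auto
  also have "\<dots> = frag_lift G f c \<oplus> frag_lift G f d"
    using Y f by (simp add: frag_lift_superset[of ?Y])
  finally show ?thesis .
qed

lemma frag_lift_uminus:
  assumes "f \<in> Poly_Mapping.keys c \<rightarrow> carrier G"
  shows "frag_lift G f (- c) = \<ominus> frag_lift G f c"
proof -
  have "frag_lift G f (- c) \<oplus> frag_lift G f c = frag_lift G f (- c + c)"
    using assms by (intro frag_lift_add[symmetric]) (auto simp: keys_minus)
  then have "frag_lift G f (- c) \<oplus> frag_lift G f c = \<zero>"
    by simp
  moreover have "frag_lift G f (- c) \<in> carrier G" "frag_lift G f c \<in> carrier G"
    using assms by (auto intro!: frag_lift_closed simp: keys_minus)
  ultimately show ?thesis
    by (simp add: minus_equality)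
qed

lemma frag_lift_diff:
  assumes "f \<in> Poly_Mapping.keys c \<rightarrow> carrier G" "f \<in> Poly_Mapping.keys d \<rightarrow> carrier G"
  shows "frag_lift G f (c - d) = frag_lift G f c \<ominus> frag_lift G f d"
  using frag_lift_add[of f c "- d"] frag_lift_uminus[of f d] assms
  by (simp add: keys_minus minus_eq)

end

section \<open>The kernel of the tensor relations and congruence modulo it\<close>

locale nonunital_extension = nonunital_ring R for R (structure) +
  fixes S
  assumes subring: "nonunital_subring S R"
begin

lemma S_closed: "s \<in> S \<Longrightarrow> s \<in> carrier R"
  using subring subgroup.subset[of S "add_monoid R"] by (auto simp: nonunital_subring_def)

lemma l_null [simp]: "x \<in> carrier R \<Longrightarrow> \<zero> \<otimes> x = \<zero>"
  using l_distr[of \<zero> \<zero> x] m_closed[of \<zero> x] by simp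

lemma r_null [simp]: "x \<in> carrier R \<Longrightarrow> x \<otimes> \<zero> = \<zero>"
  using r_distr[of \<zero> \<zero> x] m_closed[of x \<zero>] by simp

abbreviation "PP \<equiv> carrier R \<times> carrier R"
abbreviation FA :: "('a \<times> 'a \<Rightarrow>\<^sub>0 int) set" where "FA \<equiv> {z. Poly_Mapping.keys z \<subseteq> PP}"
abbreviation "K \<equiv> tensor_kernel R S"

text \<open>Equality in the tensor square, expressed on representatives. It unfolds automatically
  while its rules are derived from closure properties of \<open>K\<close>; the unfolding is switched
  off once cosets have been dealt with.\<close>

definition tensor_eq (infix "\<approx>\<^sub>K" 50) where [simp]: "z \<approx>\<^sub>K w \<longleftrightarrow> z - w \<in> K"

lemma FA_eq: "carrier (tensor_free R) = FA"
  by auto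

lemma FA_add: "z \<in> FA \<Longrightarrow> w \<in> FA \<Longrightarrow> z + w \<in> FA"
  using keys_add[of z w] by auto
lemma FA_diff: "z \<in> FA \<Longrightarrow> w \<in> FA \<Longrightarrow> z - w \<in> FA"
  using keys_diff[of z w] by auto
lemma FA_of: "x \<in> carrier R \<Longrightarrow> y \<in> carrier R \<Longrightarrow> frag_of (x, y) \<in> FA"
  by simp
lemma FA_sum: "(\<And>i. i \<in> I \<Longrightarrow> z i \<in> FA) \<Longrightarrow> sum z I \<in> FA"
  using sum_closed_free_Abelian_group[of I z PP] by simp

lemma relationI:
  "\<lbrakk>x \<in> carrier R; x' \<in> carrier R; y \<in> carrier R\<rbrakk>
    \<Longrightarrow> frag_of (x \<oplus> x', y) - frag_of (x, y) - frag_of (x', y) \<in> tensor_relations R S"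
  "\<lbrakk>x \<in> carrier R; y \<in> carrier R; y' \<in> carrier R\<rbrakk>
    \<Longrightarrow> frag_of (x, y \<oplus> y') - frag_of (x, y) - frag_of (x, y') \<in> tensor_relations R S"
  "\<lbrakk>x \<in> carrier R; s \<in> S; y \<in> carrier R\<rbrakk>
    \<Longrightarrow> frag_of (x \<otimes> s, y) - frag_of (x, s \<otimes> y) \<in> tensor_relations R S"
  unfolding tensor_relations_def
  subgoal by (intro UnI1) blast
  subgoal by (rule UnI1, rule UnI2) blast
  subgoal by (rule UnI2) blast
  done

lemma relationE:
  assumes "t \<in> tensor_relations R S"
  obtains x x' y where "x \<in> carrier R" "x' \<in> carrier R" "y \<in> carrier R"
      "t = frag_of (x \<oplus> x', y) - frag_of (x, y) - frag_of (x', y)"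
    | x y y' where "x \<in> carrier R" "y \<in> carrier R" "y' \<in> carrier R"
      "t = frag_of (x, y \<oplus> y') - frag_of (x, y) - frag_of (x, y')"
    | x s y where "x \<in> carrier R" "s \<in> S" "y \<in> carrier R"
      "t = frag_of (x \<otimes> s, y) - frag_of (x, s \<otimes> y)"
  using assms unfolding tensor_relations_def by (elim UnE CollectE exE conjE)

lemma relations_FA: "tensor_relations R S \<subseteq> FA"
proof
  fix t assume "t \<in> tensor_relations R S"
  then show "t \<in> FA"
    by (cases rule: relationE; simp only:; intro FA_diff FA_of; auto intro: m_closed S_closed)
qed

lemma K_subgroup: "subgroup K (tensor_free R)"
  unfolding tensor_kernel_def
  using relations_FA by (intro group.generate_is_subgroup) auto

lemma K_FA: "z \<in> K \<Longrightarrow> z \<in> FA"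
  using subgroup.subset[OF K_subgroup] by (metis FA_eq subsetD)

lemma K_rel: "t \<in> tensor_relations R S \<Longrightarrow> t \<in> K"
  by (simp add: tensor_kernel_def generate.incl)

lemma K_0: "0 \<in> K"
  using subgroup.one_closed[OF K_subgroup] by simp

lemma K_add: "z \<in> K \<Longrightarrow> w \<in> K \<Longrightarrow> z + w \<in> K"
  using subgroup.m_closed[OF K_subgroup] by simp

lemma K_uminus: "z \<in> K \<Longrightarrow> - z \<in> K"
  using subgroup.m_inv_closed[OF K_subgroup, of z] K_FA[of z] by simp

lemma K_diff: "z \<in> K \<Longrightarrow> w \<in> K \<Longrightarrow> z - w \<in> K"
  using K_add[OF _ K_uminus, of z w] by simp

lemma K_sum: "(\<And>i. i \<in> I \<Longrightarrow> z i \<in> K) \<Longrightarrow> sum z I \<in> K"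
  by (induction I rule: infinite_finite_induct) (auto simp: K_0 K_add)

text \<open>A single clause for differences replaces the inverse and product clauses of
  \<open>generate\<close>: negatives are differences from 0, and a sum subtracts a negative.\<close>

lemma K_induct [consumes 1, case_names zero rel diff]:
  assumes "z \<in> K" "Q 0" "\<And>t. t \<in> tensor_relations R S \<Longrightarrow> Q t"
    "\<And>z w. \<lbrakk>z \<in> K; w \<in> K; Q z; Q w\<rbrakk> \<Longrightarrow> Q (z - w)"
  shows "Q z"
proof -
  have um: "Q (- w)" if "w \<in> K" "Q w" for w
    using assms(4)[of 0 w] K_0 assms(2) that by simp
  have "z \<in> generate (tensor_free R) (tensor_relations R S)"
    using assms(1) by (simp add: tensor_kernel_def)
  then show ?thesis
  proof (induction rule: generate.induct)
    case one
    then show ?case using assms(2) by simp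
  next
    case (incl h)
    then show ?case using assms(3) by simp
  next
    case (inv h)
    then have "h \<in> K" by (simp add: tensor_kernel_def generate.incl)
    then show ?case
      using um[of h] assms(3)[OF inv] K_FA[of h] by simp
  next
    case (eng h1 h2)
    then have "h1 \<in> K" "h2 \<in> K" by (simp_all add: tensor_kernel_def)
    then show ?case
      using assms(4)[of h1 "- h2"] um[of h2] K_uminus[of h2] eng by simp
  qed
qed

lemma tensor_eq_refl: "z \<approx>\<^sub>K z"
  by (simp add: K_0)

lemma tensor_eq_sym: "z \<approx>\<^sub>K w \<Longrightarrow> w \<approx>\<^sub>K z"
  using K_uminus[of "z - w"] by simp

lemma tensor_eq_trans [trans]: "z \<approx>\<^sub>K w \<Longrightarrow> w \<approx>\<^sub>K v \<Longrightarrow> z \<approx>\<^sub>K v"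
  using K_add[of "z - w" "w - v"] by simp

lemma tensor_eq_add: "z \<approx>\<^sub>K w \<Longrightarrow> z' \<approx>\<^sub>K w' \<Longrightarrow> z + z' \<approx>\<^sub>K w + w'"
  using K_add[of "z - w" "z' - w'"] by (simp add: algebra_simps)

lemma tensor_eq_diff: "z \<approx>\<^sub>K w \<Longrightarrow> z' \<approx>\<^sub>K w' \<Longrightarrow> z - z' \<approx>\<^sub>K w - w'"
  using K_diff[of "z - w" "z' - w'"] by (simp add: algebra_simps)

lemma tensor_eq_sum: "(\<And>i. i \<in> I \<Longrightarrow> z i \<approx>\<^sub>K w i) \<Longrightarrow> sum z I \<approx>\<^sub>K sum w I"
  using K_sum[of I "\<lambda>i. z i - w i"] by (simp add: sum_subtractf)

lemma tensor_eq_bal: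
  "\<lbrakk>x \<in> carrier R; s \<in> S; y \<in> carrier R\<rbrakk> \<Longrightarrow> frag_of (x \<otimes> s, y) \<approx>\<^sub>K frag_of (x, s \<otimes> y)"
  by (simp add: K_rel relationI)

lemma tensor_eq_add_left:
  "\<lbrakk>x \<in> carrier R; x' \<in> carrier R; y \<in> carrier R\<rbrakk>
    \<Longrightarrow> frag_of (x \<oplus> x', y) \<approx>\<^sub>K frag_of (x, y) + frag_of (x', y)"
  using K_rel[OF relationI(1)] by (simp add: diff_diff_eq)

lemma tensor_eq_add_right:
  "\<lbrakk>x \<in> carrier R; y \<in> carrier R; y' \<in> carrier R\<rbrakk>
    \<Longrightarrow> frag_of (x, y \<oplus> y') \<approx>\<^sub>K frag_of (x, y) + frag_of (x, y')"
  using K_rel[OF relationI(2)] by (simp add: diff_diff_eq)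

section \<open>The bimodule structure on representatives\<close>

definition left_mul where "left_mul r = frag_extend (\<lambda>(x, y). frag_of (r \<otimes> x, y))"
definition right_mul where "right_mul r = frag_extend (\<lambda>(x, y). frag_of (x, y \<otimes> r))"

lemma left_mul_of [simp]: "left_mul r (frag_of (x, y)) = frag_of (r \<otimes> x, y)"
  by (simp add: left_mul_def)
lemma right_mul_of [simp]: "right_mul r (frag_of (x, y)) = frag_of (x, y \<otimes> r)"
  by (simp add: right_mul_def)
lemma left_mul_0 [simp]: "left_mul r 0 = 0" by (simp add: left_mul_def)
lemma right_mul_0 [simp]: "right_mul r 0 = 0" by (simp add: right_mul_def)
lemma left_mul_add: "left_mul r (z + w) = left_mul r z + left_mul r w"
    by (simp add: left_mul_def frag_extend_add)
lemma right_mul_add: "right_mul r (z + w) = right_mul r z + right_mul r w"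
    by (simp add: right_mul_def frag_extend_add)
lemma left_mul_diff: "left_mul r (z - w) = left_mul r z - left_mul r w"
    by (simp add: left_mul_def frag_extend_diff)
lemma right_mul_diff: "right_mul r (z - w) = right_mul r z - right_mul r w"
    by (simp add: right_mul_def frag_extend_diff)
lemma left_mul_sum: "left_mul r (sum z I) = (\<Sum>i\<in>I. left_mul r (z i))"
  by (induction I rule: infinite_finite_induct) (auto simp: left_mul_add)
lemma right_mul_sum: "right_mul r (sum z I) = (\<Sum>i\<in>I. right_mul r (z i))"
  by (induction I rule: infinite_finite_induct) (auto simp: right_mul_add)

lemma FA_induct [consumes 1, case_names zero of diff]:
  assumes "z \<in> FA" "Q 0" "\<And>x y. \<lbrakk>x \<in> carrier R; y \<in> carrier R\<rbrakk> \<Longrightarrow> Q (frag_of (x, y))"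
    "\<And>z w. \<lbrakk>z \<in> FA; w \<in> FA; Q z; Q w\<rbrakk> \<Longrightarrow> Q (z - w)"
  shows "Q z"
  using assms(1) by (intro free_Abelian_group_induct[of z PP Q]) (use assms in auto)

lemma left_mul_FA: "z \<in> FA \<Longrightarrow> r \<in> carrier R \<Longrightarrow> left_mul r z \<in> FA"
proof (induction rule: FA_induct)
  case (diff z w)
  then show ?case unfolding left_mul_diff by (intro FA_diff) auto
qed (auto simp: m_closed)

lemma right_mul_FA: "z \<in> FA \<Longrightarrow> r \<in> carrier R \<Longrightarrow> right_mul r z \<in> FA"
proof (induction rule: FA_induct)
  case (diff z w)
  then show ?case unfolding right_mul_diff by (intro FA_diff) auto
qed (auto simp: m_closed)

text \<open>Each kind of relation is sent to one of the same kind, by distributivity for sums in the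
  first factor and by associativity for balancing. Hence the action on representatives descends to
  the tensor square.\<close>

lemma left_mul_rel: "t \<in> tensor_relations R S \<Longrightarrow> r \<in> carrier R \<Longrightarrow> left_mul r t \<in> tensor_relations R S"
proof (erule relationE)
  fix x x' y
  assume "r \<in> carrier R" "x \<in> carrier R" "x' \<in> carrier R" "y \<in> carrier R"
    and "t = frag_of (x \<oplus> x', y) - frag_of (x, y) - frag_of (x', y)"
  then show ?thesis
    using relationI(1)[of "r \<otimes> x" "r \<otimes> x'" y] by (simp add: left_mul_diff r_distr m_closed)
next
  fix x y y'
  assume "r \<in> carrier R" "x \<in> carrier R" "y \<in> carrier R" "y' \<in> carrier R"
    and "t = frag_of (x, y \<oplus> y') - frag_of (x, y) - frag_of (x, y')"
  then show ?thesis
    using relationI(2)[of "r \<otimes> x" y y'] by (simp add: left_mul_diff r_distr m_closed)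
next
  fix x s y
  assume "r \<in> carrier R" "x \<in> carrier R" "s \<in> S" "y \<in> carrier R"
    and "t = frag_of (x \<otimes> s, y) - frag_of (x, s \<otimes> y)"
  then show ?thesis
    using relationI(3)[of "r \<otimes> x" s y] by (simp add: left_mul_diff m_assoc S_closed m_closed)
qed

lemma right_mul_rel: "t \<in> tensor_relations R S \<Longrightarrow> r \<in> carrier R \<Longrightarrow> right_mul r t \<in> tensor_relations R S"
proof (erule relationE)
  fix x x' y
  assume "r \<in> carrier R" "x \<in> carrier R" "x' \<in> carrier R" "y \<in> carrier R"
    and "t = frag_of (x \<oplus> x', y) - frag_of (x, y) - frag_of (x', y)"
  then show ?thesis
    using relationI(1)[of x x' "y \<otimes> r"] by (simp add: right_mul_diff l_distr m_closed)
next
  fix x y y'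
  assume "r \<in> carrier R" "x \<in> carrier R" "y \<in> carrier R" "y' \<in> carrier R"
    and "t = frag_of (x, y \<oplus> y') - frag_of (x, y) - frag_of (x, y')"
  then show ?thesis
    using relationI(2)[of x "y \<otimes> r" "y' \<otimes> r"] by (simp add: right_mul_diff l_distr m_closed)
next
  fix x s y
  assume "r \<in> carrier R" "x \<in> carrier R" "s \<in> S" "y \<in> carrier R"
    and "t = frag_of (x \<otimes> s, y) - frag_of (x, s \<otimes> y)"
  then show ?thesis
    using relationI(3)[of x s "y \<otimes> r"] by (simp add: right_mul_diff m_assoc S_closed m_closed)
qed

lemma left_mul_K: "z \<in> K \<Longrightarrow> r \<in> carrier R \<Longrightarrow> left_mul r z \<in> K"
  by (induction rule: K_induct) (auto simp: K_0 left_mul_diff K_diff K_rel left_mul_rel)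

lemma right_mul_K: "z \<in> K \<Longrightarrow> r \<in> carrier R \<Longrightarrow> right_mul r z \<in> K"
  by (induction rule: K_induct) (auto simp: K_0 right_mul_diff K_diff K_rel right_mul_rel)

lemma left_mul_cong: "r \<in> carrier R \<Longrightarrow> z \<approx>\<^sub>K w \<Longrightarrow> left_mul r z \<approx>\<^sub>K left_mul r w"
  using left_mul_K[of "z - w" r] by (simp add: left_mul_diff)

lemma right_mul_cong: "r \<in> carrier R \<Longrightarrow> z \<approx>\<^sub>K w \<Longrightarrow> right_mul r z \<approx>\<^sub>K right_mul r w"
  using right_mul_K[of "z - w" r] by (simp add: right_mul_diff)

lemma left_mul_left_mul: "z \<in> FA \<Longrightarrow> r \<in> carrier R \<Longrightarrow> s \<in> carrier R
    \<Longrightarrow> left_mul r (left_mul s z) = left_mul (r \<otimes> s) z"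
  by (induction rule: FA_induct) (auto simp: left_mul_diff m_assoc)

lemma left_mul_right_mul: "z \<in> FA \<Longrightarrow> left_mul r (right_mul s z) = right_mul s (left_mul r z)"
  by (induction rule: FA_induct) (auto simp: left_mul_diff right_mul_diff)

text \<open>Only a congruence, since on generators it is the additivity relation in the first
  factor; composition of actions, in contrast, is an identity between representatives.\<close>

lemma left_mul_plus:
  "z \<in> FA \<Longrightarrow> r \<in> carrier R \<Longrightarrow> s \<in> carrier R \<Longrightarrow> left_mul (r \<oplus> s) z \<approx>\<^sub>K left_mul r z + left_mul s z"
proof (induction rule: FA_induct)
  case (of x y)
  then show ?case by (simp add: l_distr tensor_eq_add_left[simplified] m_closed)
next
  case (diff z w)
  then show ?case
    using tensor_eq_diff[of "left_mul (r \<oplus> s) z" "left_mul r z + left_mul s z" "left_mul (r \<oplus> s) w" "left_mul r w + left_mul s w"]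
    by (simp add: left_mul_diff algebra_simps)
qed (auto simp: K_0)

lemma right_mul_plus:
  "z \<in> FA \<Longrightarrow> r \<in> carrier R \<Longrightarrow> s \<in> carrier R \<Longrightarrow> right_mul (r \<oplus> s) z \<approx>\<^sub>K right_mul r z + right_mul s z"
proof (induction rule: FA_induct)
  case (of x y)
  then show ?case by (simp add: r_distr tensor_eq_add_right[simplified] m_closed)
next
  case (diff z w)
  then show ?case
    using tensor_eq_diff[of "right_mul (r \<oplus> s) z" "right_mul r z + right_mul s z" "right_mul (r \<oplus> s) w" "right_mul r w + right_mul s w"]
    by (simp add: right_mul_diff algebra_simps)
qed (auto simp: K_0)

text \<open>The additivity relation for 0 + 0 = 0 is minus the generator itself.\<close>

lemma tensor_eq_zero_left: "y \<in> carrier R \<Longrightarrow> frag_of (\<zero>, y) \<approx>\<^sub>K 0"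
  using tensor_eq_add_left[of \<zero> \<zero> y] K_uminus[of "- frag_of (\<zero>, y)"] by simp

lemma tensor_eq_zero_right: "y \<in> carrier R \<Longrightarrow> frag_of (y, \<zero>) \<approx>\<^sub>K 0"
  using tensor_eq_add_right[of y \<zero> \<zero>] K_uminus[of "- frag_of (y, \<zero>)"] by simp

lemma left_mul_zero: "z \<in> FA \<Longrightarrow> left_mul \<zero> z \<approx>\<^sub>K 0"
proof (induction rule: FA_induct)
  case (diff z w)
  then show ?case using K_diff[of "left_mul \<zero> z" "left_mul \<zero> w"] by (simp add: left_mul_diff)
qed (use tensor_eq_zero_left K_0 in auto)

lemma right_mul_zero: "z \<in> FA \<Longrightarrow> right_mul \<zero> z \<approx>\<^sub>K 0"
proof (induction rule: FA_induct)
  case (diff z w)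
  then show ?case using K_diff[of "right_mul \<zero> z" "right_mul \<zero> w"] by (simp add: right_mul_diff)
qed (use tensor_eq_zero_right K_0 in auto)

text \<open>For \<open>g = id\<close> this is the multiplication map; taking for \<open>g\<close> a
  restriction of coefficients isolates the component of a tensor in one coset before
  multiplying.\<close>

definition twisted_mult :: "('a \<Rightarrow> 'a) \<Rightarrow> ('a \<times> 'a \<Rightarrow>\<^sub>0 int) \<Rightarrow> 'a" where
  "twisted_mult g = frag_lift R (\<lambda>(x, y). g x \<otimes> y)"

abbreviation "mu \<equiv> twisted_mult id"

definition right_linear :: "('a \<Rightarrow> 'a) \<Rightarrow> bool" where
  "right_linear g \<longleftrightarrow> g \<in> carrier R \<rightarrow> carrier R \<and>
     (\<forall>x\<in>carrier R. \<forall>y\<in>carrier R. g (x \<oplus> y) = g x \<oplus> g y) \<and>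
     (\<forall>x\<in>carrier R. \<forall>s\<in>S. g (x \<otimes> s) = g x \<otimes> s)"

lemma right_linear_id: "right_linear id"
  by (simp add: right_linear_def)

context
  fixes g assumes g: "right_linear g"
begin

lemma right_linear_closed: "x \<in> carrier R \<Longrightarrow> g x \<in> carrier R"
  using g by (auto simp: right_linear_def)

lemma right_linear_plus: "x \<in> carrier R \<Longrightarrow> y \<in> carrier R \<Longrightarrow> g (x \<oplus> y) = g x \<oplus> g y"
  using g by (simp add: right_linear_def)

lemma right_linear_right: "x \<in> carrier R \<Longrightarrow> s \<in> S \<Longrightarrow> g (x \<otimes> s) = g x \<otimes> s"
  using g by (simp add: right_linear_def)

lemma twisted_Pi: "z \<in> FA \<Longrightarrow> (\<lambda>(x, y). g x \<otimes> y) \<in> Poly_Mapping.keys z \<rightarrow> carrier R"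
  using right_linear_closed m_closed by auto

lemma twisted_mult_closed: "z \<in> FA \<Longrightarrow> twisted_mult g z \<in> carrier R"
  unfolding twisted_mult_def by (intro frag_lift_closed twisted_Pi)

lemma twisted_mult_0 [simp]: "twisted_mult g 0 = \<zero>"
  by (simp add: twisted_mult_def)

lemma twisted_mult_of [simp]:
  "x \<in> carrier R \<Longrightarrow> y \<in> carrier R \<Longrightarrow> twisted_mult g (frag_of (x, y)) = g x \<otimes> y"
  by (simp add: twisted_mult_def right_linear_closed m_closed)

lemma twisted_mult_add:
  "z \<in> FA \<Longrightarrow> w \<in> FA \<Longrightarrow> twisted_mult g (z + w) = twisted_mult g z \<oplus> twisted_mult g w"
  unfolding twisted_mult_def by (intro frag_lift_add twisted_Pi)

lemma twisted_mult_diff: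
  "z \<in> FA \<Longrightarrow> w \<in> FA \<Longrightarrow> twisted_mult g (z - w) = twisted_mult g z \<ominus> twisted_mult g w"
  unfolding twisted_mult_def by (intro frag_lift_diff twisted_Pi)

text \<open>Additivity of \<open>g\<close> kills the relations in the first factor, distributivity
  those in the second, and g(x s) y = g(x) (s y) the balancing relation. So the value depends only
  on the class in the tensor square.\<close>

lemma twisted_mult_K: "z \<in> K \<Longrightarrow> twisted_mult g z = \<zero>"
proof (induction rule: K_induct)
  case (rel t)
  have *: "twisted_mult g (u - v - w) = (twisted_mult g u \<ominus> twisted_mult g v) \<ominus> twisted_mult g w"
    if "u \<in> FA" "v \<in> FA" "w \<in> FA" for u v w
    using that FA_diff[of u v] by (simp only: twisted_mult_diff)
  have cancel: "(a \<oplus> b) \<ominus> a \<ominus> b = \<zero>" if "a \<in> carrier R" "b \<in> carrier R" for a b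
    using that by (simp add: minus_eq a_comm[of a b] a_assoc r_neg2 r_neg)
  from rel show ?case
  proof (cases rule: relationE)
    case (1 x x' y)
    have "twisted_mult g t = twisted_mult g (frag_of (x \<oplus> x', y)) \<ominus> twisted_mult g (frag_of (x, y))
        \<ominus> twisted_mult g (frag_of (x', y))"
      unfolding 1(4) by (intro * FA_of a_closed 1)
    also have "\<dots> = (g x \<otimes> y \<oplus> g x' \<otimes> y) \<ominus> g x \<otimes> y \<ominus> g x' \<otimes> y"
      using 1(1-3) by (simp add: right_linear_plus l_distr right_linear_closed)
    also have "\<dots> = \<zero>"
      by (intro cancel m_closed right_linear_closed 1)
    finally show ?thesis .
  next
    case (2 x y y')
    have "twisted_mult g t = twisted_mult g (frag_of (x, y \<oplus> y')) \<ominus> twisted_mult g (frag_of (x, y))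
        \<ominus> twisted_mult g (frag_of (x, y'))"
      unfolding 2(4) by (intro * FA_of a_closed 2)
    also have "\<dots> = (g x \<otimes> y \<oplus> g x \<otimes> y') \<ominus> g x \<otimes> y \<ominus> g x \<otimes> y'"
      using 2(1-3) by (simp add: r_distr right_linear_closed)
    also have "\<dots> = \<zero>"
      by (intro cancel m_closed right_linear_closed 2)
    finally show ?thesis .
  next
    case (3 x s y)
    have "twisted_mult g t = twisted_mult g (frag_of (x \<otimes> s, y)) \<ominus> twisted_mult g (frag_of (x, s \<otimes> y))"
      unfolding 3(4) by (intro twisted_mult_diff FA_of m_closed S_closed 3)
    also have "\<dots> = g x \<otimes> (s \<otimes> y) \<ominus> g x \<otimes> (s \<otimes> y)"
      using 3(1-3) by (simp add: S_closed m_closed right_linear_right m_assoc right_linear_closed)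
    also have "\<dots> = \<zero>"
      using 3(1-3) by (simp add: minus_eq r_neg m_closed S_closed right_linear_closed)
    finally show ?thesis .
  qed
next
  case (diff z w)
  then show ?case by (simp add: twisted_mult_diff K_FA[simplified] minus_eq)
qed simp

lemma twisted_mult_cong:
  assumes "z \<approx>\<^sub>K w" "z \<in> FA" "w \<in> FA" shows "twisted_mult g z = twisted_mult g w"
proof -
  have "twisted_mult g ((z - w) + w) = twisted_mult g (z - w) \<oplus> twisted_mult g w"
    using assms by (intro twisted_mult_add FA_diff)
  then show ?thesis
    using assms twisted_mult_K[of "z - w"] twisted_mult_closed[of w] by simp
qed

lemma twisted_mult_right_mul:
  "z \<in> FA \<Longrightarrow> r \<in> carrier R \<Longrightarrow> twisted_mult g (right_mul r z) = twisted_mult g z \<otimes> r"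
proof (induction rule: FA_induct)
  case (of x y)
  then show ?case by (simp add: m_closed m_assoc right_linear_closed)
next
  case (diff z w)
  have neg: "\<ominus> a \<otimes> r = \<ominus> (a \<otimes> r)" if "a \<in> carrier R" for a
    using that diff.prems l_distr[of "\<ominus> a" a r] m_closed minus_equality[of "\<ominus> a \<otimes> r" "a \<otimes> r"]
    by (simp add: l_neg)
  show ?case
    using diff unfolding right_mul_diff
    by (simp only: twisted_mult_diff right_mul_FA) (simp add: minus_eq l_distr neg twisted_mult_closed)
qed simp

text \<open>A criterion on the finitely many first factors of one chosen representative; the
  finiteness of the coefficient family extracted from a splitting rests on it.\<close>

lemma twisted_mult_vanish:
  assumes "z \<in> FA" "\<And>x y. (x, y) \<in> Poly_Mapping.keys z \<Longrightarrow> g x = \<zero>"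
  shows "twisted_mult g z = \<zero>"
  unfolding twisted_mult_def frag_lift_def
proof (intro add.finprod_one_eqI)
  fix p assume p: "p \<in> Poly_Mapping.keys z"
  obtain x y where "p = (x, y)"
    by (cases p)
  with p assms have "(case p of (x, y) \<Rightarrow> g x \<otimes> y) = \<zero>"
    by auto
  then show "[Poly_Mapping.lookup z p] \<cdot> (case p of (x, y) \<Rightarrow> g x \<otimes> y) = \<zero>"
    using add.int_pow_one[of "Poly_Mapping.lookup z p"] by simp
qed

end

lemma twisted_mult_eq_on:
  assumes "z \<in> FA" "right_linear g" "\<And>x y. (x, y) \<in> Poly_Mapping.keys z \<Longrightarrow> g x = h x"
  shows "twisted_mult g z = twisted_mult h z"
  unfolding twisted_mult_def frag_lift_def
proof (intro add.finprod_cong' refl)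
  show "(\<lambda>p. [Poly_Mapping.lookup z p] \<cdot> (case p of (x, y) \<Rightarrow> h x \<otimes> y)) \<in> Poly_Mapping.keys z \<rightarrow> carrier R"
  proof
    fix p assume p: "p \<in> Poly_Mapping.keys z"
    then have "(case p of (x, y) \<Rightarrow> h x \<otimes> y) = (case p of (x, y) \<Rightarrow> g x \<otimes> y)"
      using assms(3) by (auto split: prod.splits)
    then show "[Poly_Mapping.lookup z p] \<cdot> (case p of (x, y) \<Rightarrow> h x \<otimes> y) \<in> carrier R"
      using twisted_Pi[OF assms(2,1)] p by (auto simp: Pi_iff)
  qed
qed (use assms(3) in \<open>auto split: prod.splits\<close>)

text \<open>Two maps \<open>g\<close> and \<open>h\<close> appear because left multiplication by an
  arrow permutes the components: what \<open>h\<close> sees after multiplication by \<open>r\<close>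
  is what \<open>g\<close> saw before.\<close>

lemma twisted_mult_left_mul:
  assumes "right_linear g" "right_linear h" "r \<in> carrier R" "\<And>x. x \<in> carrier R
      \<Longrightarrow> h (r \<otimes> x) = r \<otimes> g x" "z \<in> FA"
  shows "twisted_mult h (left_mul r z) = r \<otimes> twisted_mult g z"
  using assms(5)
proof (induction rule: FA_induct)
  case (of x y)
  then show ?case using assms(1-4) by (simp add: m_closed m_assoc right_linear_closed)
next
  case (diff z w)
  have neg: "r \<otimes> \<ominus> a = \<ominus> (r \<otimes> a)" if "a \<in> carrier R" for a
    using that assms(3) r_distr[of "\<ominus> a" a r] m_closed minus_equality[of "r \<otimes> \<ominus> a" "r \<otimes> a"]
    by (simp add: l_neg)
  show ?case
    using diff assms(1-3) unfolding left_mul_diff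
    by (simp only: twisted_mult_diff left_mul_FA) (simp add: minus_eq r_distr neg twisted_mult_closed)
qed (use assms in simp)

text \<open>With restrictions to disjoint sets for \<open>g\<close> and \<open>h\<close>, this adds
  up the contributions of several cosets.\<close>

lemma twisted_mult_plus:
  assumes "right_linear g" "right_linear h" "right_linear k" "\<And>x. x \<in> carrier R \<Longrightarrow> k x = g x \<oplus> h x" "z \<in> FA"
  shows "twisted_mult k z = twisted_mult g z \<oplus> twisted_mult h z"
  using assms(5)
proof (induction rule: FA_induct)
  case (of x y)
  then show ?case using assms(1-4) by (simp add: l_distr right_linear_closed)
next
  case (diff z w)
  then show ?case using assms(1-3)
    by (simp add: twisted_mult_diff[simplified] minus_eq minus_add a_ac twisted_mult_closed[simplified])
qed (use assms in simp)

lemma mu_left_mul: "z \<in> FA \<Longrightarrow> r \<in> carrier R \<Longrightarrow> mu (left_mul r z) = r \<otimes> mu z"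
  by (rule twisted_mult_left_mul) (auto simp: right_linear_id)

section \<open>Cosets, and separability expressed by representatives\<close>

definition tensor_class where "tensor_class z = K #>\<^bsub>tensor_free R\<^esub> z"

lemma tensor_class_eq: "tensor_class z = {k + z | k. k \<in> K}"
  by (auto simp: tensor_class_def r_coset_def)

lemma tensor_class_iff: "tensor_class z = tensor_class w \<longleftrightarrow> z \<approx>\<^sub>K w"
proof
  assume "tensor_class z = tensor_class w"
  then have "z \<in> tensor_class w" using K_0 by (force simp: tensor_class_eq)
  then show "z \<approx>\<^sub>K w" by (auto simp: tensor_class_eq)
next
  assume zw: "z \<approx>\<^sub>K w"
  have "tensor_class z \<subseteq> tensor_class w" if "z \<approx>\<^sub>K w" for z w
  proof
    fix v assume "v \<in> tensor_class z"
    then obtain k where "k \<in> K" "v = k + z" by (auto simp: tensor_class_eq)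
    then have "v = (k + (z - w)) + w" "k + (z - w) \<in> K" using K_add that by auto
    then show "v \<in> tensor_class w" unfolding tensor_class_eq by blast
  qed
  then show "tensor_class z = tensor_class w" using zw tensor_eq_sym by blast
qed

lemma self_tensor_class: "z \<in> tensor_class z"
  using K_0 by (force simp: tensor_class_eq)

lemma normal_K: "K \<lhd> tensor_free R"
  using K_subgroup abelian_free_Abelian_group by (rule comm_group.subgroup_imp_normal[rotated])

lemma carrier_tensor: "carrier (tensor_square R S) = tensor_class ` FA"
  unfolding tensor_square_def FactGroup_def RCOSETS_def tensor_class_def by auto

lemma tensor_mult_tensor_class: "z \<in> FA \<Longrightarrow> w \<in> FA
    \<Longrightarrow> tensor_class z \<otimes>\<^bsub>tensor_square R S\<^esub> tensor_class w = tensor_class (z + w)"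
  unfolding tensor_square_def tensor_class_def using normal.rcos_sum[OF normal_K, of z w]
  by (simp add: FactGroup_def)

lemma setmult_K: "K <#>\<^bsub>tensor_free R\<^esub> C = {k + c | k c. k \<in> K \<and> c \<in> C}"
  by (auto simp: set_mult_def)

text \<open>The image of a coset under an additive map need not be a full coset; adding
  \<open>K\<close> completes it, which is why the actions on cosets are defined with that
  summand.\<close>

lemma additive_tensor_class:
  assumes "\<And>k. k \<in> K \<Longrightarrow> h k \<in> K" "\<And>z w. h (z + w) = h z + h w"
  shows "K <#>\<^bsub>tensor_free R\<^esub> (h ` tensor_class z) = tensor_class (h z)"
proof
  show "K <#>\<^bsub>tensor_free R\<^esub> (h ` tensor_class z) \<subseteq> tensor_class (h z)"
  proof
    fix v assume "v \<in> K <#>\<^bsub>tensor_free R\<^esub> (h ` tensor_class z)"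
    then obtain k k' where "k \<in> K" "k' \<in> K" "v = k + h (k' + z)"
      by (auto simp: setmult_K tensor_class_eq)
    then have "v = (k + h k') + h z" "k + h k' \<in> K" using assms K_add by (auto simp: add.assoc)
    then show "v \<in> tensor_class (h z)" unfolding tensor_class_eq by blast
  qed
  show "tensor_class (h z) \<subseteq> K <#>\<^bsub>tensor_free R\<^esub> (h ` tensor_class z)"
    using self_tensor_class[of z] by (auto simp: setmult_K tensor_class_eq[of "h z"])
qed

lemma left_act_tensor_class: "r \<in> carrier R
    \<Longrightarrow> tensor_left_act R S r (tensor_class z) = tensor_class (left_mul r z)"
  unfolding tensor_left_act_def left_mul_def[symmetric]
      by (intro additive_tensor_class left_mul_K left_mul_add)

lemma right_act_tensor_class: "r \<in> carrier R
    \<Longrightarrow> tensor_right_act R S (tensor_class z) r = tensor_class (right_mul r z)"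
  unfolding tensor_right_act_def right_mul_def[symmetric]
      by (intro additive_tensor_class right_mul_K right_mul_add)

text \<open>\<open>mu\<close> vanishes on \<open>K\<close>, so its image of a coset is a singleton
  and \<open>the_elem\<close> returns the only value.\<close>

lemma mult_tensor_class:
  assumes z: "z \<in> FA" shows "tensor_mult R (tensor_class z) = mu z"
proof -
  have eq: "(\<lambda>c. \<Oplus>p\<in>Poly_Mapping.keys c. [Poly_Mapping.lookup c p] \<cdot> (fst p \<otimes> snd p)) = mu"
    by (auto simp: twisted_mult_def frag_lift_def case_prod_beta)
  have "mu ` tensor_class z = {mu z}"
  proof -
    have "mu w = mu z" if "w \<in> tensor_class z" for w
    proof -
      from that obtain k where "k \<in> K" "w = k + z" by (auto simp: tensor_class_eq)
      then show ?thesis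
        using z K_FA[of k] FA_add[of k z] by (intro twisted_mult_cong right_linear_id) auto
    qed
    with self_tensor_class[of z] show ?thesis by blast
  qed
  then show ?thesis unfolding tensor_mult_def eq by simp
qed

declare tensor_eq_def [simp del]

text \<open>Choosing a representative of each value of the splitting replaces a map into cosets by a
  plain function \<open>d\<close>. Additivity and bilinearity survive as congruences, while the
  splitting condition stays an equation because \<open>mu\<close> is constant on classes.\<close>

lemma separable_iff:
  "separable_extension R S \<longleftrightarrow>
     (\<exists>d. (\<forall>x\<in>carrier R. d x \<in> FA \<and> mu (d x) = x) \<and>
          (\<forall>x\<in>carrier R. \<forall>y\<in>carrier R. d (x \<oplus> y) \<approx>\<^sub>K d x + d y) \<and>
          (\<forall>r\<in>carrier R. \<forall>x\<in>carrier R. d (r \<otimes> x) \<approx>\<^sub>K left_mul r (d x) \<and> d (x \<otimes> r) \<approx>\<^sub>K right_mul r (d x)))"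
  (is "?l \<longleftrightarrow> (\<exists>d. ?P d)")
proof
  assume ?l
  then obtain \<delta> where hom: "\<delta> \<in> hom (add_monoid R) (tensor_square R S)"
    and act: "\<And>r x. r \<in> carrier R \<Longrightarrow> x \<in> carrier R \<Longrightarrow>
           \<delta> (r \<otimes> x) = tensor_left_act R S r (\<delta> x) \<and> \<delta> (x \<otimes> r) = tensor_right_act R S (\<delta> x) r"
    and mult: "\<And>x. x \<in> carrier R \<Longrightarrow> tensor_mult R (\<delta> x) = x"
    unfolding separable_extension_def by blast
  have "\<exists>z\<in>FA. \<delta> x = tensor_class z" if "x \<in> carrier R" for x
  proof -
    have "\<delta> x \<in> tensor_class ` FA"
      using hom that carrier_tensor by (auto simp: hom_def Pi_iff)
    then show ?thesis by blast
  qed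
  then obtain d where d: "\<And>x. x \<in> carrier R \<Longrightarrow> d x \<in> FA" "\<And>x. x \<in> carrier R \<Longrightarrow> \<delta> x = tensor_class (d x)"
    by metis
  have "?P d"
  proof (intro conjI ballI)
    fix x assume x: "x \<in> carrier R"
    show "d x \<in> FA" using d(1) x by blast
    show "mu (d x) = x" using mult[OF x] d x mult_tensor_class by metis
  next
    fix x y assume xy: "x \<in> carrier R" "y \<in> carrier R"
    then have "\<delta> (x \<oplus> y) = \<delta> x \<otimes>\<^bsub>tensor_square R S\<^esub> \<delta> y"
      using hom by (auto simp: hom_def)
    then have "tensor_class (d (x \<oplus> y)) = tensor_class (d x + d y)"
      using xy d(2)[symmetric] tensor_mult_tensor_class[OF d(1) d(1), of x y] by simp
    then show "d (x \<oplus> y) \<approx>\<^sub>K d x + d y"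
      by (simp only: tensor_class_iff)
  next
    fix r x assume rx: "r \<in> carrier R" "x \<in> carrier R"
    have "tensor_class (d (r \<otimes> x)) = tensor_class (left_mul r (d x))"
      using act[OF rx] d(2)[OF rx(2)] d(2)[OF m_closed[OF rx]] rx by (simp add: left_act_tensor_class)
    then show "d (r \<otimes> x) \<approx>\<^sub>K left_mul r (d x)"
      by (simp only: tensor_class_iff)
    have "tensor_class (d (x \<otimes> r)) = tensor_class (right_mul r (d x))"
      using act[OF rx] d(2)[OF rx(2)] d(2)[OF m_closed[OF rx(2,1)]] rx by (simp add: right_act_tensor_class)
    then show "d (x \<otimes> r) \<approx>\<^sub>K right_mul r (d x)"
      by (simp only: tensor_class_iff)
  qed
  then show "\<exists>d. ?P d" by (rule exI[of _ d])
next
  assume "\<exists>d. ?P d"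
  then obtain d where P: "?P d" by (elim exE)
  then have d: "\<And>x. x \<in> carrier R \<Longrightarrow> d x \<in> FA" by blast
  have "(\<lambda>x. tensor_class (d x)) \<in> hom (add_monoid R) (tensor_square R S)"
    using P d by (auto simp: hom_def carrier_tensor tensor_mult_tensor_class[simplified] tensor_class_iff)
  moreover have "\<forall>r\<in>carrier R. \<forall>x\<in>carrier R.
      tensor_class (d (r \<otimes> x)) = tensor_left_act R S r (tensor_class (d x)) \<and>
      tensor_class (d (x \<otimes> r)) = tensor_right_act R S (tensor_class (d x)) r"
    using P d by (simp add: left_act_tensor_class right_act_tensor_class tensor_class_iff)
  moreover have "\<forall>x\<in>carrier R. tensor_mult R (tensor_class (d x)) = x"
    using P d mult_tensor_class by auto
  ultimately show ?l
    unfolding separable_extension_def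
    by (intro conjI bexI[of _ "\<lambda>x. tensor_class (d x)"] nonunital_ring_axioms subring)
qed

text \<open>
  In the absence of a unit, a separability idempotent is replaced by a family whose finite
  partial sums are eventually central and eventually act as a unit.
\<close>

lemma separable_local:
  assumes \<xi>: "\<And>e. e \<in> Ob \<Longrightarrow> \<xi> e \<in> FA"
    and E: "\<And>x. x \<in> carrier R \<Longrightarrow> finite (E x) \<and> E x \<subseteq> Ob"
    and zero: "\<And>x e. \<lbrakk>x \<in> carrier R; e \<in> Ob - E x\<rbrakk> \<Longrightarrow> left_mul x (\<xi> e) \<approx>\<^sub>K 0"
    and central: "\<And>x E'. \<lbrakk>x \<in> carrier R; finite E'; E x \<subseteq> E'; E' \<subseteq> Ob\<rbrakk>
      \<Longrightarrow> left_mul x (\<Sum>e\<in>E'. \<xi> e) \<approx>\<^sub>K right_mul x (\<Sum>e\<in>E'. \<xi> e)"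
    and unit: "\<And>x. x \<in> carrier R \<Longrightarrow> x \<otimes> mu (\<Sum>e\<in>E x. \<xi> e) = x"
  shows "separable_extension R S"
proof -
  define Y where "Y E' = (\<Sum>e\<in>E'. \<xi> e)" for E'
  \<comment> \<open>\<open>Y (E x)\<close> plays the part of a separability idempotent for the
    single element \<open>x\<close>.\<close>
  define d where "d x = left_mul x (Y (E x))" for x
  have Y: "Y E' \<in> FA" if "E' \<subseteq> Ob" for E'
    unfolding Y_def using that \<xi> by (intro FA_sum) blast
  \<comment> \<open>Summands outside \<open>E x\<close> are annihilated by \<open>x\<close>, so a
    larger index set gives the same class. This lets elements with different \<open>E\<close> be
    compared over a common set.\<close>
  have d_eq: "d x \<approx>\<^sub>K left_mul x (Y E')" if "x \<in> carrier R" "finite E'" "E x \<subseteq> E'" "E' \<subseteq> Ob" for x E'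
  proof -
    have "Y E' = Y (E x) + Y (E' - E x)"
      unfolding Y_def using that by (metis add.commute sum.subset_diff)
    moreover have "left_mul x (Y (E' - E x)) \<approx>\<^sub>K (\<Sum>e\<in>E' - E x. 0)"
      unfolding Y_def left_mul_sum by (intro tensor_eq_sum) (use zero that in auto)
    ultimately show ?thesis
      unfolding d_def using tensor_eq_sym[of "left_mul x (Y (E' - E x))" 0]
          by (simp add: left_mul_add tensor_eq_def)
  qed
  have common: "\<exists>E'. finite E' \<and> E x \<subseteq> E' \<and> E y \<subseteq> E' \<and> E w \<subseteq> E' \<and> E' \<subseteq> Ob"
    if "x \<in> carrier R" "y \<in> carrier R" "w \<in> carrier R" for x y w
    using that E by (intro exI[of _ "E x \<union> E y \<union> E w"]) auto
  have "d x \<in> FA \<and> mu (d x) = x" if "x \<in> carrier R" for x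
    using that Y E left_mul_FA unit by (auto simp: d_def mu_left_mul[simplified] Y_def[symmetric])
  moreover have "d (x \<oplus> y) \<approx>\<^sub>K d x + d y" if xy: "x \<in> carrier R" "y \<in> carrier R" for x y
  proof -
    obtain E' where E': "finite E'" "E x \<subseteq> E'" "E y \<subseteq> E'" "E (x \<oplus> y) \<subseteq> E'" "E' \<subseteq> Ob"
      using common[of x y "x \<oplus> y"] xy by auto
    have "d (x \<oplus> y) \<approx>\<^sub>K left_mul (x \<oplus> y) (Y E')" using E' xy by (intro d_eq) auto
    also have "\<dots> \<approx>\<^sub>K left_mul x (Y E') + left_mul y (Y E')" using xy Y E' by (intro left_mul_plus) auto
    also have "\<dots> \<approx>\<^sub>K d x + d y" using xy E' by (intro tensor_eq_add tensor_eq_sym[OF d_eq]) auto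
    finally show ?thesis .
  qed
  moreover have "d (r \<otimes> x) \<approx>\<^sub>K left_mul r (d x) \<and> d (x \<otimes> r) \<approx>\<^sub>K right_mul r (d x)"
    if rx: "r \<in> carrier R" "x \<in> carrier R" for r x
  proof
    obtain E' where E': "finite E'" "E r \<subseteq> E'" "E x \<subseteq> E'" "E (r \<otimes> x) \<subseteq> E'" "E' \<subseteq> Ob"
      using common[of r x "r \<otimes> x"] rx m_closed by blast
    have "d (r \<otimes> x) \<approx>\<^sub>K left_mul (r \<otimes> x) (Y E')" using E' rx m_closed by (intro d_eq) auto
    also have "left_mul (r \<otimes> x) (Y E') = left_mul r (left_mul x (Y E'))" using rx Y[OF E'(5)]
        by (simp only: left_mul_left_mul)
    also have "\<dots> \<approx>\<^sub>K left_mul r (d x)" using rx E' by (intro left_mul_cong tensor_eq_sym[OF d_eq]) auto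
    finally show "d (r \<otimes> x) \<approx>\<^sub>K left_mul r (d x)" .
  next
    obtain E' where E': "finite E'" "E r \<subseteq> E'" "E x \<subseteq> E'" "E (x \<otimes> r) \<subseteq> E'" "E' \<subseteq> Ob"
      using common[of r x "x \<otimes> r"] rx m_closed by blast
    have "d (x \<otimes> r) \<approx>\<^sub>K left_mul (x \<otimes> r) (Y E')" using E' rx m_closed by (intro d_eq) auto
    also have "left_mul (x \<otimes> r) (Y E') = left_mul x (left_mul r (Y E'))" using rx Y[OF E'(5)]
        by (simp only: left_mul_left_mul)
    \<comment> \<open>Right linearity is where centrality enters: \<open>r\<close> changes sides of
      the partial sum and can then be pulled out to the right.\<close>
    also have "\<dots> \<approx>\<^sub>K left_mul x (right_mul r (Y E'))" unfolding Y_def using rx E'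
        by (intro left_mul_cong central) auto
    also have "left_mul x (right_mul r (Y E')) = right_mul r (left_mul x (Y E'))" using Y[OF E'(5)]
        by (rule left_mul_right_mul)
    also have "\<dots> \<approx>\<^sub>K right_mul r (d x)" using rx E' by (intro right_mul_cong tensor_eq_sym[OF d_eq]) auto
    finally show "d (x \<otimes> r) \<approx>\<^sub>K right_mul r (d x)" .
  qed
  ultimately show ?thesis
    unfolding separable_iff by (intro exI[of _ d]) simp
qed

end

section \<open>The object crossed product as a ring\<close>

lemma crossed_product_simps:
  "carrier (crossed_product G A \<alpha> \<beta>) =
    {x \<in> (\<Pi>\<^sub>E \<sigma>\<in>Arr G. carrier (A (trg G \<sigma>))). finite (coeff_support G A x)}"
  "x \<otimes>\<^bsub>crossed_product G A \<alpha> \<beta>\<^esub> y = (\<lambda>\<rho>\<in>Arr G. finsum (A (trg G \<rho>))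
     (\<lambda>(\<sigma>, \<tau>). x \<sigma> \<otimes>\<^bsub>A (trg G \<rho>)\<^esub> \<alpha> \<sigma> (y \<tau>) \<otimes>\<^bsub>A (trg G \<rho>)\<^esub> \<beta> \<sigma> \<tau>)
     {(\<sigma>, \<tau>) \<in> coeff_support G A x \<times> coeff_support G A y. src G \<sigma> = trg G \<tau> \<and> cmp G \<sigma> \<tau> = \<rho>})"
  "\<zero>\<^bsub>crossed_product G A \<alpha> \<beta>\<^esub> = (\<lambda>\<sigma>\<in>Arr G. \<zero>\<^bsub>A (trg G \<sigma>)\<^esub>)"
  "x \<oplus>\<^bsub>crossed_product G A \<alpha> \<beta>\<^esub> y = (\<lambda>\<sigma>\<in>Arr G. x \<sigma> \<oplus>\<^bsub>A (trg G \<sigma>)\<^esub> y \<sigma>)"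
  by (simp_all only: crossed_product_def partial_object.simps monoid.simps ring.simps)

section \<open>Composition and inverses in a groupoid\<close>

context groupoid
begin

abbreviation "ar \<equiv> Arr G"
abbreviation "sr \<equiv> src G"
abbreviation "tg \<equiv> trg G"
abbreviation comp (infixl "\<bullet>" 70) where "\<sigma> \<bullet> \<tau> \<equiv> cmp G \<sigma> \<tau>"
abbreviation "iv \<equiv> ginv G"

lemma ginv:
  assumes "\<sigma> \<in> ar"
  shows ginv_closed: "iv \<sigma> \<in> ar" and src_ginv: "sr (iv \<sigma>) = tg \<sigma>" and trg_ginv: "tg (iv \<sigma>) = sr \<sigma>"
    and cmp_ginv: "\<sigma> \<bullet> iv \<sigma> = tg \<sigma>" and ginv_cmp: "iv \<sigma> \<bullet> \<sigma> = sr \<sigma>"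
proof -
  let ?P = "\<lambda>\<tau>. \<tau> \<in> ar \<and> sr \<tau> = tg \<sigma> \<and> tg \<tau> = sr \<sigma> \<and> \<sigma> \<bullet> \<tau> = tg \<sigma> \<and> \<tau> \<bullet> \<sigma> = sr \<sigma>"
  obtain \<tau> where \<tau>: "?P \<tau>" using invertible[OF assms] by blast
  have "\<tau>' = \<tau>" if \<tau>': "?P \<tau>'" for \<tau>'
  proof -
    have "\<tau>' = \<tau>' \<bullet> (\<sigma> \<bullet> \<tau>)" using \<tau> \<tau>' cmp_src[of \<tau>'] by simp
    also have "\<dots> = (\<tau>' \<bullet> \<sigma>) \<bullet> \<tau>" using \<tau> \<tau>' assms by (intro cmp_assoc[symmetric]) auto
    also have "\<dots> = \<tau>" using \<tau> \<tau>' cmp_trg[of \<tau>] by simp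
    finally show ?thesis .
  qed
  then have "?P (iv \<sigma>)" unfolding ginv_def using \<tau> by (intro theI[of ?P \<tau>])
  then show "iv \<sigma> \<in> ar" "sr (iv \<sigma>) = tg \<sigma>" "tg (iv \<sigma>) = sr \<sigma>"
    "\<sigma> \<bullet> iv \<sigma> = tg \<sigma>" "iv \<sigma> \<bullet> \<sigma> = sr \<sigma>" by blast+
qed

lemmas groupoid_simps [simp] = ginv_closed src_ginv trg_ginv cmp_ginv ginv_cmp src_Obj trg_Obj src_id trg_id
  cmp_closed src_cmp trg_cmp cmp_src cmp_trg

lemma Obj_Arr [simp]: "e \<in> Obj G \<Longrightarrow> e \<in> ar"
  using Obj_subset by blast

lemma ginv_cmp_cancel [simp]:
  "\<lbrakk>\<sigma> \<in> ar; \<tau> \<in> ar; sr \<sigma> = tg \<tau>\<rbrakk> \<Longrightarrow> iv \<sigma> \<bullet> (\<sigma> \<bullet> \<tau>) = \<tau>"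
  using cmp_assoc[of "iv \<sigma>" \<sigma> \<tau>] by simp

lemma cmp_ginv_cancel [simp]:
  "\<lbrakk>\<sigma> \<in> ar; \<rho> \<in> ar; tg \<sigma> = tg \<rho>\<rbrakk> \<Longrightarrow> \<sigma> \<bullet> (iv \<sigma> \<bullet> \<rho>) = \<rho>"
  using cmp_assoc[of \<sigma> "iv \<sigma>" \<rho>] by simp

lemma cmp_ginv_cancel_right [simp]:
  "\<lbrakk>\<sigma> \<in> ar; \<tau> \<in> ar; sr \<sigma> = sr \<tau>\<rbrakk> \<Longrightarrow> \<sigma> \<bullet> iv \<tau> \<bullet> \<tau> = \<sigma>"
  using cmp_assoc[of \<sigma> "iv \<tau>" \<tau>] cmp_src[of \<sigma>] by simp

lemma ginv_Obj [simp]: "e \<in> Obj G \<Longrightarrow> iv e = e"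
  using cmp_ginv[of e] cmp_trg[of "iv e"] by simp

lemma ginv_eqI: "\<lbrakk>\<sigma> \<in> ar; \<tau> \<in> ar; sr \<sigma> = tg \<tau>; \<sigma> \<bullet> \<tau> = tg \<sigma>\<rbrakk> \<Longrightarrow> \<tau> = iv \<sigma>"
  using ginv_cmp_cancel[of \<sigma> \<tau>] cmp_src[of "iv \<sigma>"] by simp

lemma ginv_ginv [simp]: "\<sigma> \<in> ar \<Longrightarrow> iv (iv \<sigma>) = \<sigma>"
  by (rule ginv_eqI[symmetric]) auto

lemma ginv_cmp_distrib [simp]:
  "\<lbrakk>\<sigma> \<in> ar; \<tau> \<in> ar; sr \<sigma> = tg \<tau>\<rbrakk> \<Longrightarrow> iv (\<sigma> \<bullet> \<tau>) = iv \<tau> \<bullet> iv \<sigma>"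
  using cmp_assoc[of \<sigma> \<tau> "iv \<tau> \<bullet> iv \<sigma>"] by (intro ginv_eqI[symmetric]) auto

end

section \<open>Coefficients, supports and multiplication of formal sums\<close>

context object_crossed_system
begin

abbreviation "CP \<equiv> crossed_product G A \<alpha> \<beta>"
abbreviation CP_mult (infixl "\<star>" 70) where "x \<star> y \<equiv> x \<otimes>\<^bsub>CP\<^esub> y"
abbreviation CP_add (infixl "\<boxplus>" 65) where "x \<boxplus> y \<equiv> x \<oplus>\<^bsub>CP\<^esub> y"
abbreviation "supp \<equiv> coeff_support G A"
abbreviation "At \<rho> \<equiv> A (tg \<rho>)"

lemma ring_tg [simp, intro]: "\<sigma> \<in> ar \<Longrightarrow> ring (At \<sigma>)"
  by (simp add: ring_A)

lemma ring_sr [simp, intro]: "\<sigma> \<in> ar \<Longrightarrow> ring (A (sr \<sigma>))"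
  by (simp add: ring_A)

text \<open>The coefficient ring changes with the arrow, so no single interpretation covers a
  formula; these conditional rules make elementary ring facts available at every arrow.\<close>

lemma At_simps [simp]:
  assumes "\<sigma> \<in> ar"
  shows "\<zero>\<^bsub>At \<sigma>\<^esub> \<in> carrier (At \<sigma>)" "\<one>\<^bsub>At \<sigma>\<^esub> \<in> carrier (At \<sigma>)"
    "a \<in> carrier (At \<sigma>) \<Longrightarrow> \<zero>\<^bsub>At \<sigma>\<^esub> \<oplus>\<^bsub>At \<sigma>\<^esub> a = a"
    "a \<in> carrier (At \<sigma>) \<Longrightarrow> a \<oplus>\<^bsub>At \<sigma>\<^esub> \<zero>\<^bsub>At \<sigma>\<^esub> = a"
    "a \<in> carrier (At \<sigma>) \<Longrightarrow> \<ominus>\<^bsub>At \<sigma>\<^esub> a \<oplus>\<^bsub>At \<sigma>\<^esub> a = \<zero>\<^bsub>At \<sigma>\<^esub>"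
    "a \<in> carrier (At \<sigma>) \<Longrightarrow> \<ominus>\<^bsub>At \<sigma>\<^esub> a \<in> carrier (At \<sigma>)"
    "\<ominus>\<^bsub>At \<sigma>\<^esub> \<zero>\<^bsub>At \<sigma>\<^esub> = \<zero>\<^bsub>At \<sigma>\<^esub>"
    "a \<in> carrier (At \<sigma>) \<Longrightarrow> b \<in> carrier (At \<sigma>) \<Longrightarrow> a \<oplus>\<^bsub>At \<sigma>\<^esub> b \<in> carrier (At \<sigma>)"
proof -
  interpret Ae: ring "At \<sigma>" using assms by simp
  show "\<zero>\<^bsub>At \<sigma>\<^esub> \<in> carrier (At \<sigma>)" "\<one>\<^bsub>At \<sigma>\<^esub> \<in> carrier (At \<sigma>)"
    "a \<in> carrier (At \<sigma>) \<Longrightarrow> \<zero>\<^bsub>At \<sigma>\<^esub> \<oplus>\<^bsub>At \<sigma>\<^esub> a = a"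
    "a \<in> carrier (At \<sigma>) \<Longrightarrow> a \<oplus>\<^bsub>At \<sigma>\<^esub> \<zero>\<^bsub>At \<sigma>\<^esub> = a"
    "a \<in> carrier (At \<sigma>) \<Longrightarrow> \<ominus>\<^bsub>At \<sigma>\<^esub> a \<oplus>\<^bsub>At \<sigma>\<^esub> a = \<zero>\<^bsub>At \<sigma>\<^esub>"
    "a \<in> carrier (At \<sigma>) \<Longrightarrow> \<ominus>\<^bsub>At \<sigma>\<^esub> a \<in> carrier (At \<sigma>)"
    "\<ominus>\<^bsub>At \<sigma>\<^esub> \<zero>\<^bsub>At \<sigma>\<^esub> = \<zero>\<^bsub>At \<sigma>\<^esub>"
    "a \<in> carrier (At \<sigma>) \<Longrightarrow> b \<in> carrier (At \<sigma>) \<Longrightarrow> a \<oplus>\<^bsub>At \<sigma>\<^esub> b \<in> carrier (At \<sigma>)"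
    by (simp_all add: Ae.l_neg)
qed

lemma \<alpha>_closed [simp]: "\<sigma> \<in> ar \<Longrightarrow> a \<in> carrier (A (sr \<sigma>)) \<Longrightarrow> \<alpha> \<sigma> a \<in> carrier (At \<sigma>)"
  by (rule ring_hom_closed) (use \<alpha>_iso in \<open>auto simp: ring_iso_def\<close>)

lemma \<alpha>_zero [simp]: "\<sigma> \<in> ar \<Longrightarrow> \<alpha> \<sigma> \<zero>\<^bsub>A (sr \<sigma>)\<^esub> = \<zero>\<^bsub>At \<sigma>\<^esub>"
  by (rule ring_hom_zero) (use \<alpha>_iso in \<open>auto simp: ring_iso_def\<close>)

lemma \<alpha>_one [simp]: "\<sigma> \<in> ar \<Longrightarrow> \<alpha> \<sigma> \<one>\<^bsub>A (sr \<sigma>)\<^esub> = \<one>\<^bsub>At \<sigma>\<^esub>"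
  by (rule ring_hom_one) (use \<alpha>_iso in \<open>auto simp: ring_iso_def\<close>)

lemma \<alpha>_add: "\<lbrakk>\<sigma> \<in> ar; a \<in> carrier (A (sr \<sigma>)); b \<in> carrier (A (sr \<sigma>))\<rbrakk>
    \<Longrightarrow> \<alpha> \<sigma> (a \<oplus>\<^bsub>A (sr \<sigma>)\<^esub> b) = \<alpha> \<sigma> a \<oplus>\<^bsub>At \<sigma>\<^esub> \<alpha> \<sigma> b"
  by (rule ring_hom_add) (use \<alpha>_iso in \<open>auto simp: ring_iso_def\<close>)

lemma \<alpha>_mult: "\<lbrakk>\<sigma> \<in> ar; a \<in> carrier (A (sr \<sigma>)); b \<in> carrier (A (sr \<sigma>))\<rbrakk>
    \<Longrightarrow> \<alpha> \<sigma> (a \<otimes>\<^bsub>A (sr \<sigma>)\<^esub> b) = \<alpha> \<sigma> a \<otimes>\<^bsub>At \<sigma>\<^esub> \<alpha> \<sigma> b"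
  by (rule ring_hom_mult) (use \<alpha>_iso in \<open>auto simp: ring_iso_def\<close>)

lemma \<alpha>_bij: "\<sigma> \<in> ar \<Longrightarrow> bij_betw (\<alpha> \<sigma>) (carrier (A (sr \<sigma>))) (carrier (At \<sigma>))"
  using \<alpha>_iso[of \<sigma>] by (auto simp: ring_iso_def)

lemma \<beta>_closed [simp]:
  "\<lbrakk>\<sigma> \<in> ar; \<tau> \<in> ar; sr \<sigma> = tg \<tau>\<rbrakk> \<Longrightarrow> \<beta> \<sigma> \<tau> \<in> carrier (At \<sigma>)"
  using \<beta>_unit[of \<sigma> \<tau>] by (auto simp: Units_def)

lemma carrier_CP: "x \<in> carrier CP \<longleftrightarrow>
    (\<forall>\<sigma>\<in>ar. x \<sigma> \<in> carrier (At \<sigma>)) \<and> (\<forall>\<sigma>. \<sigma> \<notin> ar \<longrightarrow> x \<sigma> = undefined) \<and> finite (supp x)"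
  by (auto simp: crossed_product_simps PiE_iff extensional_def)

lemma coeff_closed [simp]: "x \<in> carrier CP \<Longrightarrow> \<sigma> \<in> ar \<Longrightarrow> x \<sigma> \<in> carrier (At \<sigma>)"
  by (simp add: carrier_CP)

lemma finite_supp [simp]: "x \<in> carrier CP \<Longrightarrow> finite (supp x)"
  by (simp add: carrier_CP)

lemma supp_ar: "supp x \<subseteq> ar"
  by (auto simp: coeff_support_def)

lemma not_supp: "\<sigma> \<in> ar \<Longrightarrow> \<sigma> \<notin> supp x \<Longrightarrow> x \<sigma> = \<zero>\<^bsub>At \<sigma>\<^esub>"
  by (simp add: coeff_support_def)

lemma CP_eqI:
  assumes "x \<in> carrier CP" "y \<in> carrier CP" "\<And>\<sigma>. \<sigma> \<in> ar \<Longrightarrow> x \<sigma> = y \<sigma>"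
  shows "x = y"
  using assms by (intro ext) (metis carrier_CP)

lemma add_coeff: "\<sigma> \<in> ar \<Longrightarrow> (x \<boxplus> y) \<sigma> = x \<sigma> \<oplus>\<^bsub>At \<sigma>\<^esub> y \<sigma>"
  by (simp add: crossed_product_simps)

lemma zero_coeff: "\<sigma> \<in> ar \<Longrightarrow> \<zero>\<^bsub>CP\<^esub> \<sigma> = \<zero>\<^bsub>At \<sigma>\<^esub>"
  by (simp add: crossed_product_simps)

lemma supp_zero [simp]: "supp \<zero>\<^bsub>CP\<^esub> = {}"
  by (auto simp: coeff_support_def zero_coeff)

lemma zero_CP [simp]: "\<zero>\<^bsub>CP\<^esub> \<in> carrier CP"
  unfolding carrier_CP supp_zero
  by (auto simp: crossed_product_simps)

lemma supp_add: "supp (x \<boxplus> y) \<subseteq> supp x \<union> supp y"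
proof
  fix \<sigma> assume s: "\<sigma> \<in> supp (x \<boxplus> y)"
  then have \<sigma>: "\<sigma> \<in> ar" using supp_ar by blast
  then interpret Ae: ring "At \<sigma>" by simp
  show "\<sigma> \<in> supp x \<union> supp y"
    using s \<sigma> by (auto simp: coeff_support_def add_coeff)
qed

lemma add_CP [simp]: "x \<in> carrier CP \<Longrightarrow> y \<in> carrier CP \<Longrightarrow> x \<boxplus> y \<in> carrier CP"
  unfolding carrier_CP[of "x \<boxplus> y"]
proof (intro conjI ballI allI impI)
  assume xy: "x \<in> carrier CP" "y \<in> carrier CP"
  show "(x \<boxplus> y) \<sigma> \<in> carrier (At \<sigma>)" if "\<sigma> \<in> ar" for \<sigma>
    using xy that by (simp add: add_coeff)
  show "(x \<boxplus> y) \<sigma> = undefined" if "\<sigma> \<notin> ar" for \<sigma>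
    using that by (simp add: crossed_product_simps)
  show "finite (supp (x \<boxplus> y))"
    using xy by (intro finite_subset[OF supp_add]) simp
qed

definition restriction :: "'g set \<Rightarrow> ('g \<Rightarrow> 'a) \<Rightarrow> 'g \<Rightarrow> 'a" where
  "restriction P x = (\<lambda>\<sigma>\<in>ar. if \<sigma> \<in> P then x \<sigma> else \<zero>\<^bsub>At \<sigma>\<^esub>)"

definition monomial :: "'g \<Rightarrow> 'a \<Rightarrow> 'g \<Rightarrow> 'a" where
  "monomial \<sigma> a = (\<lambda>\<rho>\<in>ar. if \<rho> = \<sigma> then a else \<zero>\<^bsub>At \<rho>\<^esub>)"

lemma restriction_coeff: "\<sigma> \<in> ar \<Longrightarrow> restriction P x \<sigma> = (if \<sigma> \<in> P then x \<sigma> else \<zero>\<^bsub>At \<sigma>\<^esub>)"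
  by (simp add: restriction_def)

lemma monomial_coeff: "\<rho> \<in> ar \<Longrightarrow> monomial \<sigma> a \<rho> = (if \<rho> = \<sigma> then a else \<zero>\<^bsub>At \<rho>\<^esub>)"
  by (simp add: monomial_def)

lemma supp_restriction: "supp (restriction P x) = supp x \<inter> P"
  by (auto simp: coeff_support_def restriction_coeff split: if_splits)

lemma supp_monomial: "supp (monomial \<sigma> a) \<subseteq> {\<sigma>}"
  by (auto simp: coeff_support_def monomial_coeff split: if_splits)

lemma restriction_CP [simp]: "x \<in> carrier CP \<Longrightarrow> restriction P x \<in> carrier CP"
  unfolding carrier_CP[of "restriction P x"] supp_restriction
  by (auto simp: restriction_def)

lemma monomial_CP [simp]: "\<sigma> \<in> ar \<Longrightarrow> a \<in> carrier (At \<sigma>) \<Longrightarrow> monomial \<sigma> a \<in> carrier CP"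
  unfolding carrier_CP using finite_subset[OF supp_monomial]
  by (auto simp: monomial_def)

lemma abelian_group_CP: "abelian_group CP"
proof (rule abelian_groupI)
  fix x y z assume xyz: "x \<in> carrier CP" "y \<in> carrier CP" "z \<in> carrier CP"
  show "x \<boxplus> y \<boxplus> z = x \<boxplus> (y \<boxplus> z)"
  proof (rule CP_eqI)
    fix \<sigma> assume \<sigma>: "\<sigma> \<in> ar"
    then interpret Ae: ring "At \<sigma>" by simp
    show "(x \<boxplus> y \<boxplus> z) \<sigma> = (x \<boxplus> (y \<boxplus> z)) \<sigma>"
      using \<sigma> xyz by (simp add: add_coeff Ae.a_assoc)
  qed (use xyz in auto)
next
  fix x y assume xyz: "x \<in> carrier CP" "y \<in> carrier CP"
  show "x \<boxplus> y = y \<boxplus> x"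
  proof (rule CP_eqI)
    fix \<sigma> assume \<sigma>: "\<sigma> \<in> ar"
    then interpret Ae: ring "At \<sigma>" by simp
    show "(x \<boxplus> y) \<sigma> = (y \<boxplus> x) \<sigma>"
      using \<sigma> xyz by (simp add: add_coeff Ae.a_comm)
  qed (use xyz in auto)
next
  fix x assume x: "x \<in> carrier CP"
  show "\<zero>\<^bsub>CP\<^esub> \<boxplus> x = x"
    by (rule CP_eqI) (use x in \<open>auto simp: add_coeff zero_coeff\<close>)
  let ?y = "\<lambda>\<sigma>\<in>ar. \<ominus>\<^bsub>At \<sigma>\<^esub> x \<sigma>"
  have "supp ?y \<subseteq> supp x"
    by (auto simp: coeff_support_def)
  then have "?y \<in> carrier CP"
    using x finite_subset[of "supp ?y" "supp x"]
    unfolding carrier_CP[of ?y] by (auto simp:)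
  moreover have "?y \<boxplus> x = \<zero>\<^bsub>CP\<^esub>"
    by (rule CP_eqI) (use x \<open>?y \<in> carrier CP\<close> in \<open>auto simp: add_coeff zero_coeff\<close>)
  ultimately show "\<exists>y\<in>carrier CP. y \<boxplus> x = \<zero>\<^bsub>CP\<^esub>" by blast
qed auto

lemma restriction_add: "\<lbrakk>x \<in> carrier CP; y \<in> carrier CP\<rbrakk>
    \<Longrightarrow> restriction P (x \<boxplus> y) = restriction P x \<boxplus> restriction P y"
  by (rule CP_eqI) (auto simp: restriction_coeff add_coeff)

lemma restriction_split:
  assumes "x \<in> carrier CP" "P \<inter> Q = {}"
  shows "restriction (P \<union> Q) x = restriction P x \<boxplus> restriction Q x"
  by (rule CP_eqI) (use assms in \<open>auto simp: restriction_coeff add_coeff\<close>)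

text \<open>An element is a finite sum of monomials, split off its support one arrow at a time. The
  bound \<open>Q\<close> passes to the monomials, so the rule also serves elements supported on
  \<open>D\<close> or between prescribed objects.\<close>

lemma CP_induct [consumes 2, case_names zero mono add]:
  assumes "x \<in> carrier CP" "supp x \<subseteq> Q" "P \<zero>\<^bsub>CP\<^esub>"
    and mono: "\<And>\<sigma> a. \<lbrakk>\<sigma> \<in> Q; \<sigma> \<in> ar; a \<in> carrier (At \<sigma>)\<rbrakk> \<Longrightarrow> P (monomial \<sigma> a)"
    and add: "\<And>x y. \<lbrakk>x \<in> carrier CP; y \<in> carrier CP; P x; P y\<rbrakk> \<Longrightarrow> P (x \<boxplus> y)"
  shows "P x"
proof -
  have "P x" if "finite F" "x \<in> carrier CP" "supp x \<subseteq> F" "F \<subseteq> Q \<inter> ar" for F x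
    using that
  proof (induction F arbitrary: x)
    case empty
    then have "x = \<zero>\<^bsub>CP\<^esub>"
      by (intro CP_eqI) (auto simp: zero_coeff intro!: not_supp)
    then show ?case using assms(3) by simp
  next
    case (insert \<sigma> F)
    have "x = restriction ({\<sigma>} \<union> - {\<sigma>}) x"
      using insert.prems by (intro CP_eqI) (auto simp: restriction_coeff)
    also have "\<dots> = restriction {\<sigma>} x \<boxplus> restriction (- {\<sigma>}) x"
      using insert.prems by (intro restriction_split) auto
    also have "restriction {\<sigma>} x = monomial \<sigma> (x \<sigma>)"
      by (auto simp: restriction_def monomial_def)
    finally have "x = monomial \<sigma> (x \<sigma>) \<boxplus> restriction (- {\<sigma>}) x" .
    moreover have "P (monomial \<sigma> (x \<sigma>) \<boxplus> restriction (- {\<sigma>}) x)"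
      using insert.prems insert.hyps by (intro add insert.IH mono) (auto simp: supp_restriction)
    ultimately show ?case by simp
  qed
  then show ?thesis
    using assms(1,2) supp_ar[of x] by (metis finite_supp le_inf_iff order_refl)
qed

text \<open>In a product \<sigma> \<tau> = \<rho> the left factor determines \<tau> as \<sigma>^-1
  \<rho>, so the double sum for a coefficient becomes a single sum. The value is meaningful for
  \<open>tg \<sigma> = tg \<rho>\<close>.\<close>

definition mult_term :: "('g \<Rightarrow> 'a) \<Rightarrow> ('g \<Rightarrow> 'a) \<Rightarrow> 'g \<Rightarrow> 'g \<Rightarrow> 'a" where
  "mult_term x y \<rho> \<sigma> =
     x \<sigma> \<otimes>\<^bsub>At \<rho>\<^esub> \<alpha> \<sigma> (y (iv \<sigma> \<bullet> \<rho>)) \<otimes>\<^bsub>At \<rho>\<^esub> \<beta> \<sigma> (iv \<sigma> \<bullet> \<rho>)"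

lemma mult_term_closed:
  assumes "x \<in> carrier CP" "y \<in> carrier CP" "\<rho> \<in> ar" "\<sigma> \<in> ar" "tg \<sigma> = tg \<rho>"
  shows "mult_term x y \<rho> \<sigma> \<in> carrier (At \<rho>)"
proof -
  interpret Ae: ring "At \<rho>" using assms by simp
  have "x \<sigma> \<in> carrier (At \<rho>)"
    using coeff_closed[OF assms(1,4)] assms(5) by simp
  moreover have "y (iv \<sigma> \<bullet> \<rho>) \<in> carrier (A (sr \<sigma>))"
    using coeff_closed[of y "iv \<sigma> \<bullet> \<rho>"] assms by simp
  then have "\<alpha> \<sigma> (y (iv \<sigma> \<bullet> \<rho>)) \<in> carrier (At \<rho>)"
    using \<alpha>_closed[of \<sigma>] assms by simp
  moreover have "\<beta> \<sigma> (iv \<sigma> \<bullet> \<rho>) \<in> carrier (At \<rho>)"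
    using \<beta>_closed[of \<sigma> "iv \<sigma> \<bullet> \<rho>"] assms by simp
  ultimately show ?thesis
    by (simp add: mult_term_def)
qed

lemma mult_term_zero:
  assumes "x \<in> carrier CP" "y \<in> carrier CP" "\<rho> \<in> ar" "\<sigma> \<in> ar" "tg \<sigma> = tg \<rho>"
    and "\<sigma> \<notin> supp x \<or> iv \<sigma> \<bullet> \<rho> \<notin> supp y"
  shows "mult_term x y \<rho> \<sigma> = \<zero>\<^bsub>At \<rho>\<^esub>"
proof -
  interpret Ae: ring "At \<rho>" using assms by simp
  have x: "x \<sigma> \<in> carrier (At \<rho>)"
    using coeff_closed[OF assms(1,4)] assms(5) by simp
  have "y (iv \<sigma> \<bullet> \<rho>) \<in> carrier (A (sr \<sigma>))"
    using coeff_closed[of y "iv \<sigma> \<bullet> \<rho>"] assms by simp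
  then have y: "\<alpha> \<sigma> (y (iv \<sigma> \<bullet> \<rho>)) \<in> carrier (At \<rho>)"
    using \<alpha>_closed[of \<sigma>] assms by simp
  have b: "\<beta> \<sigma> (iv \<sigma> \<bullet> \<rho>) \<in> carrier (At \<rho>)"
    using \<beta>_closed[of \<sigma> "iv \<sigma> \<bullet> \<rho>"] assms by simp
  from assms(6) show ?thesis
  proof
    assume "\<sigma> \<notin> supp x"
    then have "x \<sigma> = \<zero>\<^bsub>At \<rho>\<^esub>" using not_supp[of \<sigma> x] assms by simp
    then show ?thesis using y b by (simp add: mult_term_def)
  next
    assume "iv \<sigma> \<bullet> \<rho> \<notin> supp y"
    then have "y (iv \<sigma> \<bullet> \<rho>) = \<zero>\<^bsub>A (sr \<sigma>)\<^esub>"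
      using not_supp[of "iv \<sigma> \<bullet> \<rho>" y] assms by simp
    then have "\<alpha> \<sigma> (y (iv \<sigma> \<bullet> \<rho>)) = \<zero>\<^bsub>At \<rho>\<^esub>"
      using \<alpha>_zero[of \<sigma>] assms by simp
    then show ?thesis using x b by (simp add: mult_term_def)
  qed
qed

text \<open>Any finite set of arrows \<open>Y\<close> containing the support of the left factor may
  index the sum, since additional terms vanish. This freedom allows products with different left
  factors to be added termwise.\<close>

lemma mult_coeff:
  assumes xy: "x \<in> carrier CP" "y \<in> carrier CP" and Y: "finite Y" "supp x \<subseteq> Y" "Y \<subseteq> ar" and \<rho>: "\<rho> \<in> ar"
  shows "(x \<star> y) \<rho> = (\<Oplus>\<^bsub>At \<rho>\<^esub>\<sigma>\<in>{\<sigma>\<in>Y. tg \<sigma> = tg \<rho>}. mult_term x y \<rho> \<sigma>)"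
proof -
  interpret Ae: ring "At \<rho>" using \<rho> by simp
  let ?P = "{(\<sigma>, \<tau>) \<in> supp x \<times> supp y. sr \<sigma> = tg \<tau> \<and> \<sigma> \<bullet> \<tau> = \<rho>}"
  let ?f = "\<lambda>(\<sigma>, \<tau>). x \<sigma> \<otimes>\<^bsub>At \<rho>\<^esub> \<alpha> \<sigma> (y \<tau>) \<otimes>\<^bsub>At \<rho>\<^esub> \<beta> \<sigma> \<tau>"
  let ?h = "\<lambda>\<sigma>. (\<sigma>, iv \<sigma> \<bullet> \<rho>)"
  let ?Q = "{\<sigma> \<in> supp x. tg \<sigma> = tg \<rho> \<and> iv \<sigma> \<bullet> \<rho> \<in> supp y}"
  have sx: "\<sigma> \<in> ar" if "\<sigma> \<in> supp x" for \<sigma> x using that supp_ar by blast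
  have P: "?P = ?h ` ?Q"
  proof (intro equalityI subsetI)
    fix p assume "p \<in> ?P"
    then obtain \<sigma> \<tau> where "p = (\<sigma>, \<tau>)" "\<sigma> \<in> supp x" "\<tau> \<in> supp y" "sr \<sigma> = tg \<tau>" "\<sigma> \<bullet> \<tau> = \<rho>" by blast
    then have "p = ?h \<sigma>" "\<sigma> \<in> ?Q" using sx[of \<sigma>] sx[of \<tau>] by auto
    then show "p \<in> ?h ` ?Q" by blast
  next
    fix p assume "p \<in> ?h ` ?Q"
    then show "p \<in> ?P" using sx \<rho> by auto
  qed
  have Pi: "mult_term x y \<rho> \<in> {\<sigma>\<in>Y. tg \<sigma> = tg \<rho>} \<rightarrow> carrier (At \<rho>)"
    using xy Y \<rho> by (auto intro!: mult_term_closed)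
  have "(x \<star> y) \<rho> = finsum (At \<rho>) ?f ?P"
    using \<rho> by (simp add: crossed_product_simps)
  also have "\<dots> = (\<Oplus>\<^bsub>At \<rho>\<^esub>\<sigma>\<in>?Q. ?f (?h \<sigma>))"
    unfolding P
  proof (rule Ae.finsum_reindex)
    show "?f \<in> ?h ` ?Q \<rightarrow> carrier (At \<rho>)"
      using Pi Y(2) by (fastforce simp: mult_term_def)
  qed (auto simp: inj_on_def)
  also have "\<dots> = (\<Oplus>\<^bsub>At \<rho>\<^esub>\<sigma>\<in>?Q. mult_term x y \<rho> \<sigma>)"
    by (simp add: mult_term_def)
  also have "\<dots> = (\<Oplus>\<^bsub>At \<rho>\<^esub>\<sigma>\<in>{\<sigma>\<in>Y. tg \<sigma> = tg \<rho>}. mult_term x y \<rho> \<sigma>)"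
    using xy Y \<rho> Pi by (intro Ae.add.finprod_mono_neutral_cong_left) (auto intro!: mult_term_zero)
  finally show ?thesis .
qed

lemma supp_mult: "supp (x \<star> y) \<subseteq> {\<sigma> \<bullet> \<tau> | \<sigma> \<tau>. \<sigma> \<in> supp x \<and> \<tau> \<in> supp y \<and> sr \<sigma> = tg \<tau>}"
proof
  fix \<rho> assume \<rho>: "\<rho> \<in> supp (x \<star> y)"
  then have "\<rho> \<in> ar" using supp_ar by blast
  then interpret Ae: ring "At \<rho>" by simp
  have "{(\<sigma>, \<tau>) \<in> supp x \<times> supp y. sr \<sigma> = tg \<tau> \<and> \<sigma> \<bullet> \<tau> = \<rho>} \<noteq> {}"
  proof
    assume *: "{(\<sigma>, \<tau>) \<in> supp x \<times> supp y. sr \<sigma> = tg \<tau> \<and> \<sigma> \<bullet> \<tau> = \<rho>} = {}"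
    have "(x \<star> y) \<rho> = \<zero>\<^bsub>At \<rho>\<^esub>"
      unfolding crossed_product_simps restrict_apply'[OF \<open>\<rho> \<in> ar\<close>] * by simp
    then show False using \<rho> by (simp add: coeff_support_def)
  qed
  then show "\<rho> \<in> {\<sigma> \<bullet> \<tau> | \<sigma> \<tau>. \<sigma> \<in> supp x \<and> \<tau> \<in> supp y \<and> sr \<sigma> = tg \<tau>}" by blast
qed

lemma mult_CP [simp]:
  assumes "x \<in> carrier CP" "y \<in> carrier CP" shows "x \<star> y \<in> carrier CP"
  unfolding carrier_CP[of "x \<star> y"]
proof (intro conjI ballI allI impI)
  fix \<rho> assume \<rho>: "\<rho> \<in> ar"
  interpret Ae: ring "At \<rho>" using \<rho> by simp
  show "(x \<star> y) \<rho> \<in> carrier (At \<rho>)"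
    unfolding mult_coeff[OF assms finite_supp[OF assms(1)] order_refl supp_ar \<rho>]
    using assms \<rho> supp_ar by (intro Ae.finsum_closed) (auto intro!: mult_term_closed)
next
  fix \<rho> assume "\<rho> \<notin> ar"
  then show "(x \<star> y) \<rho> = undefined" by (simp add: crossed_product_simps)
next
  have "{\<sigma> \<bullet> \<tau> | \<sigma> \<tau>. \<sigma> \<in> supp x \<and> \<tau> \<in> supp y \<and> sr \<sigma> = tg \<tau>} \<subseteq> (\<lambda>(\<sigma>, \<tau>). \<sigma> \<bullet> \<tau>) ` (supp x \<times> supp y)"
    by auto
  then show "finite (supp (x \<star> y))"
    by (rule finite_subset[OF supp_mult finite_subset]) (use assms in simp)
qed

lemma mult_zero:
  assumes "x \<in> carrier CP"
  shows "\<zero>\<^bsub>CP\<^esub> \<star> x = \<zero>\<^bsub>CP\<^esub>" "x \<star> \<zero>\<^bsub>CP\<^esub> = \<zero>\<^bsub>CP\<^esub>"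
proof -
  have *: "z = \<zero>\<^bsub>CP\<^esub>" if "z \<in> carrier CP" "supp z \<subseteq> {}" for z
    using that by (intro CP_eqI) (auto simp: zero_coeff intro!: not_supp)
  show "\<zero>\<^bsub>CP\<^esub> \<star> x = \<zero>\<^bsub>CP\<^esub>"
    using supp_mult[of "\<zero>\<^bsub>CP\<^esub>" x] assms by (intro *) auto
  show "x \<star> \<zero>\<^bsub>CP\<^esub> = \<zero>\<^bsub>CP\<^esub>"
    using supp_mult[of x "\<zero>\<^bsub>CP\<^esub>"] assms by (intro *) auto
qed

lemma mult_distr:
  assumes "x \<in> carrier CP" "y \<in> carrier CP" "z \<in> carrier CP"
  shows mult_l_distr: "(x \<boxplus> y) \<star> z = x \<star> z \<boxplus> y \<star> z"
    and mult_r_distr: "z \<star> (x \<boxplus> y) = z \<star> x \<boxplus> z \<star> y"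
proof -
  show "(x \<boxplus> y) \<star> z = x \<star> z \<boxplus> y \<star> z"
  proof (rule CP_eqI)
    fix \<rho> assume \<rho>: "\<rho> \<in> ar"
    interpret Ae: ring "At \<rho>" using \<rho> by simp
    \<comment> \<open>The union contains the supports of \<open>x\<close>, of \<open>y\<close> and
      of their sum, so all three products become sums over the same index set.\<close>
    let ?Y = "supp x \<union> supp y" let ?Q = "{\<sigma> \<in> ?Y. tg \<sigma> = tg \<rho>}"
    have Y: "finite ?Y" "?Y \<subseteq> ar" "supp x \<subseteq> ?Y" "supp y \<subseteq> ?Y" "supp (x \<boxplus> y) \<subseteq> ?Y"
      using assms supp_ar supp_add by auto
    have Q: "\<sigma> \<in> ar \<and> tg \<sigma> = tg \<rho>" if "\<sigma> \<in> ?Q" for \<sigma>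
      using that Y(2) by auto
    have mc: "mult_term u w \<rho> \<sigma> \<in> carrier (At \<rho>)"
      if "u \<in> carrier CP" "w \<in> carrier CP" "\<sigma> \<in> ?Q" for u w \<sigma>
      using that(1,2) \<rho> Q[OF that(3)] by (intro mult_term_closed) auto
    have "((x \<boxplus> y) \<star> z) \<rho> = (\<Oplus>\<^bsub>At \<rho>\<^esub>\<sigma>\<in>?Q. mult_term (x \<boxplus> y) z \<rho> \<sigma>)"
      using assms Y \<rho> by (intro mult_coeff) auto
    also have "\<dots> = (\<Oplus>\<^bsub>At \<rho>\<^esub>\<sigma>\<in>?Q. mult_term x z \<rho> \<sigma> \<oplus>\<^bsub>At \<rho>\<^esub> mult_term y z \<rho> \<sigma>)"
    proof (rule Ae.finsum_cong')
      fix \<sigma> assume "\<sigma> \<in> ?Q"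
      note \<sigma> = Q[OF this]
      have c: "x \<sigma> \<in> carrier (At \<rho>)" "y \<sigma> \<in> carrier (At \<rho>)"
        using coeff_closed[OF assms(1), of \<sigma>] coeff_closed[OF assms(2), of \<sigma>] \<sigma> by auto
      have "z (iv \<sigma> \<bullet> \<rho>) \<in> carrier (A (sr \<sigma>))"
        using coeff_closed[OF assms(3), of "iv \<sigma> \<bullet> \<rho>"] \<sigma> \<rho> by simp
      then have "\<alpha> \<sigma> (z (iv \<sigma> \<bullet> \<rho>)) \<in> carrier (At \<rho>)"
        using \<alpha>_closed[of \<sigma>] \<sigma> by simp
      moreover have "\<beta> \<sigma> (iv \<sigma> \<bullet> \<rho>) \<in> carrier (At \<rho>)"
        using \<beta>_closed[of \<sigma> "iv \<sigma> \<bullet> \<rho>"] \<sigma> \<rho> by simp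
      ultimately show "mult_term (x \<boxplus> y) z \<rho> \<sigma> = mult_term x z \<rho> \<sigma> \<oplus>\<^bsub>At \<rho>\<^esub> mult_term y z \<rho> \<sigma>"
        using c \<sigma> by (simp add: mult_term_def add_coeff Ae.l_distr)
    qed (use assms mc in \<open>simp_all add: Pi_iff\<close>)
    also have "\<dots> = (\<Oplus>\<^bsub>At \<rho>\<^esub>\<sigma>\<in>?Q. mult_term x z \<rho> \<sigma>) \<oplus>\<^bsub>At \<rho>\<^esub> (\<Oplus>\<^bsub>At \<rho>\<^esub>\<sigma>\<in>?Q. mult_term y z \<rho> \<sigma>)"
      using assms mc by (intro Ae.finsum_addf) (simp_all add: Pi_iff)
    also have "\<dots> = (x \<star> z) \<rho> \<oplus>\<^bsub>At \<rho>\<^esub> (y \<star> z) \<rho>"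
      using assms Y \<rho> by (simp only: mult_coeff[of _ _ ?Y])
    finally show "((x \<boxplus> y) \<star> z) \<rho> = (x \<star> z \<boxplus> y \<star> z) \<rho>"
      using \<rho> by (simp add: add_coeff)
  qed (use assms in auto)
  show "z \<star> (x \<boxplus> y) = z \<star> x \<boxplus> z \<star> y"
  proof (rule CP_eqI)
    fix \<rho> assume \<rho>: "\<rho> \<in> ar"
    interpret Ae: ring "At \<rho>" using \<rho> by simp
    let ?Q = "{\<sigma> \<in> supp z. tg \<sigma> = tg \<rho>}"
    have Q: "\<sigma> \<in> ar \<and> tg \<sigma> = tg \<rho>" if "\<sigma> \<in> ?Q" for \<sigma>
      using that supp_ar by auto
    have mc: "mult_term u w \<rho> \<sigma> \<in> carrier (At \<rho>)"
      if "u \<in> carrier CP" "w \<in> carrier CP" "\<sigma> \<in> ?Q" for u w \<sigma>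
      using that(1,2) \<rho> Q[OF that(3)] by (intro mult_term_closed) auto
    have m: "(z \<star> w) \<rho> = (\<Oplus>\<^bsub>At \<rho>\<^esub>\<sigma>\<in>?Q. mult_term z w \<rho> \<sigma>)" if "w \<in> carrier CP" for w
      using assms \<rho> that supp_ar by (intro mult_coeff) auto
    have "(z \<star> (x \<boxplus> y)) \<rho> = (\<Oplus>\<^bsub>At \<rho>\<^esub>\<sigma>\<in>?Q. mult_term z (x \<boxplus> y) \<rho> \<sigma>)"
      using assms by (intro m) auto
    also have "\<dots> = (\<Oplus>\<^bsub>At \<rho>\<^esub>\<sigma>\<in>?Q. mult_term z x \<rho> \<sigma> \<oplus>\<^bsub>At \<rho>\<^esub> mult_term z y \<rho> \<sigma>)"
    proof (rule Ae.finsum_cong')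
      fix \<sigma> assume "\<sigma> \<in> ?Q"
      note \<sigma> = Q[OF this]
      let ?\<tau> = "iv \<sigma> \<bullet> \<rho>"
      have c: "z \<sigma> \<in> carrier (At \<rho>)"
        using coeff_closed[OF assms(3), of \<sigma>] \<sigma> by auto
      have \<tau>: "?\<tau> \<in> ar" "tg ?\<tau> = sr \<sigma>" using \<sigma> \<rho> by auto
      have xy: "x ?\<tau> \<in> carrier (A (sr \<sigma>))" "y ?\<tau> \<in> carrier (A (sr \<sigma>))"
        using coeff_closed[OF assms(1) \<tau>(1)] coeff_closed[OF assms(2) \<tau>(1)] \<tau>(2) by auto
      then have "\<alpha> \<sigma> (x ?\<tau>) \<in> carrier (At \<rho>)" "\<alpha> \<sigma> (y ?\<tau>) \<in> carrier (At \<rho>)"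
        using \<alpha>_closed[of \<sigma>] \<sigma> by auto
      moreover have "\<beta> \<sigma> ?\<tau> \<in> carrier (At \<rho>)"
        using \<beta>_closed[of \<sigma> ?\<tau>] \<sigma> \<rho> by simp
      moreover have "\<alpha> \<sigma> ((x \<boxplus> y) ?\<tau>) = \<alpha> \<sigma> (x ?\<tau>) \<oplus>\<^bsub>At \<rho>\<^esub> \<alpha> \<sigma> (y ?\<tau>)"
        using \<alpha>_add[OF _ xy] \<sigma> add_coeff[OF \<tau>(1)] \<tau>(2) by simp
      ultimately show "mult_term z (x \<boxplus> y) \<rho> \<sigma> = mult_term z x \<rho> \<sigma> \<oplus>\<^bsub>At \<rho>\<^esub> mult_term z y \<rho> \<sigma>"
        using c by (simp add: mult_term_def Ae.l_distr Ae.r_distr)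
    qed (use assms mc in \<open>simp_all add: Pi_iff\<close>)
    also have "\<dots> = (\<Oplus>\<^bsub>At \<rho>\<^esub>\<sigma>\<in>?Q. mult_term z x \<rho> \<sigma>) \<oplus>\<^bsub>At \<rho>\<^esub> (\<Oplus>\<^bsub>At \<rho>\<^esub>\<sigma>\<in>?Q. mult_term z y \<rho> \<sigma>)"
      using assms mc by (intro Ae.finsum_addf) (simp_all add: Pi_iff)
    also have "\<dots> = (z \<star> x) \<rho> \<oplus>\<^bsub>At \<rho>\<^esub> (z \<star> y) \<rho>"
      using assms by (simp only: m)
    finally show "(z \<star> (x \<boxplus> y)) \<rho> = (z \<star> x \<boxplus> z \<star> y) \<rho>"
      using \<rho> by (simp add: add_coeff)
  qed (use assms in auto)
qed

lemma monomial_mult_coeff: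
  assumes "\<sigma> \<in> ar" "a \<in> carrier (At \<sigma>)" "y \<in> carrier CP" "\<rho> \<in> ar"
  shows "(monomial \<sigma> a \<star> y) \<rho> = (if tg \<rho> = tg \<sigma>
     then a \<otimes>\<^bsub>At \<rho>\<^esub> \<alpha> \<sigma> (y (iv \<sigma> \<bullet> \<rho>)) \<otimes>\<^bsub>At \<rho>\<^esub> \<beta> \<sigma> (iv \<sigma> \<bullet> \<rho>) else \<zero>\<^bsub>At \<rho>\<^esub>)"
proof -
  interpret Ae: ring "At \<rho>" using assms by simp
  have "(monomial \<sigma> a \<star> y) \<rho> = (\<Oplus>\<^bsub>At \<rho>\<^esub>\<sigma>'\<in>{\<sigma>'\<in>{\<sigma>}. tg \<sigma>' = tg \<rho>}. mult_term (monomial \<sigma> a) y \<rho> \<sigma>')"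
    using assms supp_monomial by (intro mult_coeff) auto
  also have "{\<sigma>'\<in>{\<sigma>}. tg \<sigma>' = tg \<rho>} = (if tg \<rho> = tg \<sigma> then {\<sigma>} else {})"
    by auto
  finally have eq: "(monomial \<sigma> a \<star> y) \<rho> =
    (\<Oplus>\<^bsub>At \<rho>\<^esub>\<sigma>'\<in>(if tg \<rho> = tg \<sigma> then {\<sigma>} else {}). mult_term (monomial \<sigma> a) y \<rho> \<sigma>')" .
  show ?thesis
  proof (cases "tg \<rho> = tg \<sigma>")
    case True
    then have "mult_term (monomial \<sigma> a) y \<rho> \<sigma> \<in> carrier (At \<rho>)"
      using assms by (intro mult_term_closed) auto
    then have "(monomial \<sigma> a \<star> y) \<rho> = mult_term (monomial \<sigma> a) y \<rho> \<sigma>"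
      unfolding eq if_P[OF True] by simp
    then show ?thesis
      unfolding mult_term_def monomial_coeff[OF assms(1)] using True by simp
  next
    case False
    then show ?thesis unfolding eq by simp
  qed
qed

lemma mult_monomial_coeff:
  assumes "\<tau> \<in> ar" "b \<in> carrier (At \<tau>)" "x \<in> carrier CP" "\<rho> \<in> ar"
  shows "(x \<star> monomial \<tau> b) \<rho> = (if sr \<rho> = sr \<tau>
     then x (\<rho> \<bullet> iv \<tau>) \<otimes>\<^bsub>At \<rho>\<^esub> \<alpha> (\<rho> \<bullet> iv \<tau>) b \<otimes>\<^bsub>At \<rho>\<^esub> \<beta> (\<rho> \<bullet> iv \<tau>) \<tau> else \<zero>\<^bsub>At \<rho>\<^esub>)"
proof (cases "sr \<rho> = sr \<tau>")
  case True
  interpret Ae: ring "At \<rho>" using assms by simp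
  let ?\<sigma> = "\<rho> \<bullet> iv \<tau>"
  have \<sigma>: "?\<sigma> \<in> ar" "tg ?\<sigma> = tg \<rho>" "sr ?\<sigma> = tg \<tau>" using assms True by auto
  have inv: "iv ?\<sigma> \<bullet> \<rho> = \<tau>" using assms True cmp_assoc[of \<tau> "iv \<rho>" \<rho>] by simp
  \<comment> \<open>Only \<sigma> = \<rho> \<tau>^-1 can contribute; it is added to the support so
    that the formula also covers the case in which \<open>x\<close> vanishes there.\<close>
  let ?Y = "insert ?\<sigma> (supp x)"
  have "(x \<star> monomial \<tau> b) \<rho> = (\<Oplus>\<^bsub>At \<rho>\<^esub>\<sigma>\<in>{\<sigma>\<in>?Y. tg \<sigma> = tg \<rho>}. mult_term x (monomial \<tau> b) \<rho> \<sigma>)"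
    using assms supp_ar \<sigma> by (intro mult_coeff) auto
  also have "\<dots> = (\<Oplus>\<^bsub>At \<rho>\<^esub>\<sigma>\<in>{?\<sigma>}. mult_term x (monomial \<tau> b) \<rho> \<sigma>)"
  proof (rule Ae.add.finprod_mono_neutral_cong_right)
    fix \<sigma> assume s: "\<sigma> \<in> {\<sigma>\<in>?Y. tg \<sigma> = tg \<rho>} - {?\<sigma>}"
    then have sa: "\<sigma> \<in> ar" "tg \<sigma> = tg \<rho>" using supp_ar \<sigma> by auto
    have "iv \<sigma> \<bullet> \<rho> \<noteq> \<tau>"
    proof
      assume "iv \<sigma> \<bullet> \<rho> = \<tau>"
      then have "?\<sigma> = \<rho> \<bullet> iv (iv \<sigma> \<bullet> \<rho>)" by simp
      also have "\<dots> = \<sigma>" using sa assms by simp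
      finally show False using s by simp
    qed
    then show "mult_term x (monomial \<tau> b) \<rho> \<sigma> = \<zero>\<^bsub>At \<rho>\<^esub>"
      using sa assms supp_monomial[of \<tau> b] by (intro mult_term_zero) auto
  qed (use assms \<sigma> supp_ar in \<open>auto intro!: mult_term_closed\<close>)
  also have "\<dots> = mult_term x (monomial \<tau> b) \<rho> ?\<sigma>"
    using mult_term_closed[of x "monomial \<tau> b" \<rho> ?\<sigma>] assms \<sigma> by simp
  finally show ?thesis
    using True assms by (simp add: mult_term_def inv monomial_coeff del: ginv_cmp_distrib)
next
  case False
  have "\<rho> \<notin> supp (x \<star> monomial \<tau> b)"
  proof
    assume "\<rho> \<in> supp (x \<star> monomial \<tau> b)"
    then obtain \<sigma> \<tau>' where "\<sigma> \<in> supp x" "\<tau>' \<in> supp (monomial \<tau> b)" "sr \<sigma> = tg \<tau>'" "\<rho> = \<sigma> \<bullet> \<tau>'"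
      using supp_mult by blast
    moreover from this have "\<tau>' = \<tau>" "\<sigma> \<in> ar"
      using supp_monomial supp_ar by blast+
    ultimately show False
      using False assms by simp
  qed
  then show ?thesis using False not_supp assms by simp
qed

lemma monomial_mult_monomial:
  assumes "\<sigma> \<in> ar" "a \<in> carrier (At \<sigma>)" "\<tau> \<in> ar" "b \<in> carrier (At \<tau>)"
  shows "monomial \<sigma> a \<star> monomial \<tau> b =
    (if sr \<sigma> = tg \<tau> then monomial (\<sigma> \<bullet> \<tau>) (a \<otimes>\<^bsub>At \<sigma>\<^esub> \<alpha> \<sigma> b \<otimes>\<^bsub>At \<sigma>\<^esub> \<beta> \<sigma> \<tau>) else \<zero>\<^bsub>CP\<^esub>)"
proof (rule CP_eqI)
  interpret Ae: ring "At \<sigma>" using assms by simp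
  let ?c = "a \<otimes>\<^bsub>At \<sigma>\<^esub> \<alpha> \<sigma> b \<otimes>\<^bsub>At \<sigma>\<^esub> \<beta> \<sigma> \<tau>"
  have c: "?c \<in> carrier (At \<sigma>)" if "sr \<sigma> = tg \<tau>"
    using assms that by simp
  then show "(if sr \<sigma> = tg \<tau> then monomial (\<sigma> \<bullet> \<tau>) ?c else \<zero>\<^bsub>CP\<^esub>) \<in> carrier CP"
    using assms by simp
  fix \<rho> assume \<rho>: "\<rho> \<in> ar"
  show "(monomial \<sigma> a \<star> monomial \<tau> b) \<rho> = (if sr \<sigma> = tg \<tau> then monomial (\<sigma> \<bullet> \<tau>) ?c else \<zero>\<^bsub>CP\<^esub>) \<rho>"
  proof (cases "sr \<sigma> = tg \<tau> \<and> \<rho> = \<sigma> \<bullet> \<tau>")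
    case True
    then show ?thesis using assms \<rho> by (simp add: monomial_mult_coeff monomial_coeff)
  next
    case False
    have "\<rho> \<notin> supp (monomial \<sigma> a \<star> monomial \<tau> b)"
      using supp_mult[of "monomial \<sigma> a" "monomial \<tau> b"] supp_monomial[of \<tau> b] supp_monomial[of \<sigma> a] False
          by auto
    then show ?thesis using False not_supp[of \<rho>] \<rho> by (auto simp: monomial_coeff zero_coeff)
  qed
qed (use assms in auto)

text \<open>O3 produces a conjugation by \<open>\<beta> \<sigma> \<tau>\<close>, and O4 supplies
  another factor \<open>\<beta> \<sigma> \<tau>\<close> which cancels the inverse; what remains is
  the coefficient for the other bracketing. If the arrows do not compose, both sides are
  zero.\<close>

lemma monomial_assoc:
  assumes "\<sigma> \<in> ar" "a \<in> carrier (At \<sigma>)" "\<tau> \<in> ar" "b \<in> carrier (At \<tau>)" "\<rho> \<in> ar" "c \<in> carrier (At \<rho>)"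
  shows "(monomial \<sigma> a \<star> monomial \<tau> b) \<star> monomial \<rho> c = monomial \<sigma> a \<star> (monomial \<tau> b \<star> monomial \<rho> c)"
proof (cases "sr \<sigma> = tg \<tau> \<and> sr \<tau> = tg \<rho>")
  case True
  then have st: "sr \<sigma> = tg \<tau>" and tr: "sr \<tau> = tg \<rho>" by auto
  interpret Ae: ring "At \<sigma>" using assms by simp
  interpret Af: ring "At \<tau>" using assms by simp
  let ?B = "\<beta> \<sigma> \<tau>" let ?c = "\<alpha> (\<sigma> \<bullet> \<tau>) c"
  have B: "?B \<in> Units (At \<sigma>)" using \<beta>_unit assms st by simp
  have cl: "\<alpha> \<sigma> b \<in> carrier (At \<sigma>)" "?c \<in> carrier (At \<sigma>)" "\<beta> (\<sigma> \<bullet> \<tau>) \<rho> \<in> carrier (At \<sigma>)"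
    "\<alpha> \<tau> c \<in> carrier (At \<tau>)" "\<beta> \<tau> \<rho> \<in> carrier (At \<tau>)" "\<beta> \<sigma> (\<tau> \<bullet> \<rho>) \<in> carrier (At \<sigma>)"
    "\<alpha> \<sigma> (\<beta> \<tau> \<rho>) \<in> carrier (At \<sigma>)" "?B \<in> carrier (At \<sigma>)" "inv\<^bsub>At \<sigma>\<^esub> ?B \<in> carrier (At \<sigma>)"
    "\<alpha> \<sigma> (\<alpha> \<tau> c) \<in> carrier (At \<sigma>)"
    using assms st tr B \<alpha>_closed[of "\<sigma> \<bullet> \<tau>" c] \<beta>_closed[of "\<sigma> \<bullet> \<tau>" \<rho>] by auto
  have o3: "\<alpha> \<sigma> (\<alpha> \<tau> c) = ?B \<otimes>\<^bsub>At \<sigma>\<^esub> ?c \<otimes>\<^bsub>At \<sigma>\<^esub> inv\<^bsub>At \<sigma>\<^esub> ?B"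
    using assms st tr by (intro O3) auto
  have o4: "\<alpha> \<sigma> (\<beta> \<tau> \<rho>) \<otimes>\<^bsub>At \<sigma>\<^esub> \<beta> \<sigma> (\<tau> \<bullet> \<rho>) = ?B \<otimes>\<^bsub>At \<sigma>\<^esub> \<beta> (\<sigma> \<bullet> \<tau>) \<rho>"
    using assms st tr by (intro O4[symmetric]) auto
  have "a \<otimes>\<^bsub>At \<sigma>\<^esub> \<alpha> \<sigma> (b \<otimes>\<^bsub>At \<tau>\<^esub> \<alpha> \<tau> c \<otimes>\<^bsub>At \<tau>\<^esub> \<beta> \<tau> \<rho>) \<otimes>\<^bsub>At \<sigma>\<^esub> \<beta> \<sigma> (\<tau> \<bullet> \<rho>)
      = a \<otimes>\<^bsub>At \<sigma>\<^esub> (\<alpha> \<sigma> b \<otimes>\<^bsub>At \<sigma>\<^esub> \<alpha> \<sigma> (\<alpha> \<tau> c) \<otimes>\<^bsub>At \<sigma>\<^esub> \<alpha> \<sigma> (\<beta> \<tau> \<rho>)) \<otimes>\<^bsub>At \<sigma>\<^esub> \<beta> \<sigma> (\<tau> \<bullet> \<rho>)"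
    using assms st cl \<alpha>_mult[of \<sigma> "b \<otimes>\<^bsub>At \<tau>\<^esub> \<alpha> \<tau> c" "\<beta> \<tau> \<rho>"] \<alpha>_mult[of \<sigma> b "\<alpha> \<tau> c"] by simp
  also have "\<dots> = a \<otimes>\<^bsub>At \<sigma>\<^esub> \<alpha> \<sigma> b \<otimes>\<^bsub>At \<sigma>\<^esub> \<alpha> \<sigma> (\<alpha> \<tau> c)
      \<otimes>\<^bsub>At \<sigma>\<^esub> (\<alpha> \<sigma> (\<beta> \<tau> \<rho>) \<otimes>\<^bsub>At \<sigma>\<^esub> \<beta> \<sigma> (\<tau> \<bullet> \<rho>))"
    using assms cl by (simp add: Ae.m_assoc)
  also have "\<dots> = a \<otimes>\<^bsub>At \<sigma>\<^esub> \<alpha> \<sigma> b \<otimes>\<^bsub>At \<sigma>\<^esub> (?B \<otimes>\<^bsub>At \<sigma>\<^esub> ?c)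
      \<otimes>\<^bsub>At \<sigma>\<^esub> ((inv\<^bsub>At \<sigma>\<^esub> ?B \<otimes>\<^bsub>At \<sigma>\<^esub> ?B) \<otimes>\<^bsub>At \<sigma>\<^esub> \<beta> (\<sigma> \<bullet> \<tau>) \<rho>)"
    unfolding o3 o4 using assms cl by (simp add: Ae.m_assoc del: Ae.Units_l_inv)
  also have "\<dots> = a \<otimes>\<^bsub>At \<sigma>\<^esub> \<alpha> \<sigma> b \<otimes>\<^bsub>At \<sigma>\<^esub> ?B \<otimes>\<^bsub>At \<sigma>\<^esub> ?c \<otimes>\<^bsub>At \<sigma>\<^esub> \<beta> (\<sigma> \<bullet> \<tau>) \<rho>"
    using assms cl B by (simp add: Ae.m_assoc)
  finally show ?thesis
    using assms st tr cl by (simp add: monomial_mult_monomial cmp_assoc)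
next
  case False
  interpret Ae: ring "At \<sigma>" using assms by simp
  interpret Af: ring "At \<tau>" using assms by simp
  show ?thesis
    using assms False by (auto simp: monomial_mult_monomial mult_zero)
qed

text \<open>Both sides are additive in each argument, so three nested inductions leave only
  monomials.\<close>

lemma mult_assoc:
  assumes "x \<in> carrier CP" "y \<in> carrier CP" "z \<in> carrier CP"
  shows "(x \<star> y) \<star> z = x \<star> (y \<star> z)"
  using assms(1) subset_UNIV[of "supp x"]
proof (induction rule: CP_induct)
  case (mono \<sigma> a)
  note x = mono
  show ?case
    using assms(2) subset_UNIV[of "supp y"]
  proof (induction rule: CP_induct)
    case (mono \<tau> b)
    note y = mono
    show ?case
      using assms(3) subset_UNIV[of "supp z"]
    proof (induction rule: CP_induct)
      case (mono \<rho> c)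
      show ?case using x y mono by (intro monomial_assoc)
    qed (use x y in \<open>auto simp: mult_zero mult_r_distr\<close>)
  qed (use x assms in \<open>auto simp: mult_zero mult_r_distr mult_l_distr\<close>)
qed (use assms in \<open>auto simp: mult_zero mult_l_distr\<close>)

lemma nonunital_ring_CP: "nonunital_ring CP"
proof -
  interpret abelian_group CP by (rule abelian_group_CP)
  show ?thesis
    by unfold_locales (auto simp: mult_assoc mult_l_distr mult_r_distr)
qed

end

section \<open>From a separability splitting to a family on cosets\<close>

locale wide_crossed_system = object_crossed_system G A \<alpha> \<beta>
  for G :: "'g groupoid_struct" and A :: "'g \<Rightarrow> 'a ring" and \<alpha> \<beta> +
  fixes D :: "'g set"
  assumes wide: "wide_subgroupoid D G"
begin

abbreviation "SD \<equiv> crossed_subring G A \<alpha> \<beta> D"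

lemma D_ar: "\<delta> \<in> D \<Longrightarrow> \<delta> \<in> ar"
  and Obj_D: "e \<in> Obj G \<Longrightarrow> e \<in> D"
  and D_ginv: "\<delta> \<in> D \<Longrightarrow> iv \<delta> \<in> D"
  and D_cmp: "\<lbrakk>\<delta> \<in> D; \<epsilon> \<in> D; sr \<delta> = tg \<epsilon>\<rbrakk> \<Longrightarrow> \<delta> \<bullet> \<epsilon> \<in> D"
  using wide by (auto simp: wide_subgroupoid_def subgroupoid_def)

lemma D_cmp_right_iff:
  assumes "\<delta> \<in> D" "\<sigma> \<in> ar" "sr \<sigma> = tg \<delta>"
  shows "\<sigma> \<bullet> \<delta> \<in> D \<longleftrightarrow> \<sigma> \<in> D"
proof
  assume "\<sigma> \<bullet> \<delta> \<in> D"
  then have "\<sigma> \<bullet> \<delta> \<bullet> iv \<delta> \<in> D"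
    using assms D_ginv[OF assms(1)] D_ar[OF assms(1)] by (intro D_cmp[of "\<sigma> \<bullet> \<delta>"]) auto
  also have "\<sigma> \<bullet> \<delta> \<bullet> iv \<delta> = \<sigma>"
    using assms D_ar[OF assms(1)] cmp_assoc[of \<sigma> \<delta> "iv \<delta>"] cmp_src[of \<sigma>] by simp
  finally show "\<sigma> \<in> D" .
qed (use assms D_cmp in auto)

lemma SD_iff: "x \<in> SD \<longleftrightarrow> x \<in> carrier CP \<and> supp x \<subseteq> D"
  by (simp add: crossed_subring_def)

lemma subring_SD: "nonunital_subring SD CP"
  unfolding nonunital_subring_def
proof (intro conjI ballI)
  interpret CP: abelian_group CP by (rule abelian_group_CP)
  show "subgroup SD (add_monoid CP)"
  proof (rule CP.add.subgroupI)
    show "SD \<subseteq> carrier CP" by (auto simp: SD_iff)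
    show "SD \<noteq> {}" using zero_CP supp_zero by (force simp: SD_iff)
    fix x assume x: "x \<in> SD"
    have "supp (\<ominus>\<^bsub>CP\<^esub> x) \<subseteq> supp x"
    proof
      fix \<sigma> assume s: "\<sigma> \<in> supp (\<ominus>\<^bsub>CP\<^esub> x)"
      then have \<sigma>: "\<sigma> \<in> ar" using supp_ar by blast
      have "\<ominus>\<^bsub>CP\<^esub> x \<boxplus> x = \<zero>\<^bsub>CP\<^esub>"
        using x by (intro CP.l_neg) (simp add: SD_iff)
      then have "(\<ominus>\<^bsub>CP\<^esub> x) \<sigma> \<oplus>\<^bsub>At \<sigma>\<^esub> x \<sigma> = \<zero>\<^bsub>At \<sigma>\<^esub>"
        using add_coeff[OF \<sigma>, of "\<ominus>\<^bsub>CP\<^esub> x" x] zero_coeff[OF \<sigma>] by simp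
      moreover have "(\<ominus>\<^bsub>CP\<^esub> x) \<sigma> \<in> carrier (At \<sigma>)"
        using x \<sigma> by (simp add: SD_iff)
      ultimately have "x \<sigma> \<noteq> \<zero>\<^bsub>At \<sigma>\<^esub>"
        using s \<sigma> by (auto simp: coeff_support_def)
      then show "\<sigma> \<in> supp x" using \<sigma> by (simp add: coeff_support_def)
    qed
    then show "\<ominus>\<^bsub>CP\<^esub> x \<in> SD" using x by (auto simp: SD_iff)
  next
    fix x y assume "x \<in> SD" "y \<in> SD"
    then show "x \<boxplus> y \<in> SD" using supp_add[of x y] by (auto simp: SD_iff)
  qed
next
  fix x y assume xy: "x \<in> SD" "y \<in> SD"
  have "supp (x \<star> y) \<subseteq> D"
  proof
    fix \<rho> assume "\<rho> \<in> supp (x \<star> y)"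
    then obtain \<sigma> \<tau> where "\<rho> = \<sigma> \<bullet> \<tau>" "\<sigma> \<in> supp x" "\<tau> \<in> supp y" "sr \<sigma> = tg \<tau>"
      using supp_mult by blast
    then show "\<rho> \<in> D" using xy by (auto simp: SD_iff intro: D_cmp)
  qed
  then show "x \<star> y \<in> SD" using xy by (simp add: SD_iff)
qed

sublocale ext: nonunital_extension CP SD
  using nonunital_ring_CP subring_SD
  by (auto simp: nonunital_extension_def nonunital_extension_axioms_def)

abbreviation tensor_eq_CP (infix "\<approx>\<^sub>T" 50) where "z \<approx>\<^sub>T w \<equiv> ext.tensor_eq z w"

definition basis where "basis \<tau> = monomial \<tau> \<one>\<^bsub>At \<tau>\<^esub>"
text \<open>The coefficient cancels \<open>\<beta> (iv \<tau>) \<tau>\<close>, so that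
  \<open>basis_inv \<tau>\<close> is inverse to \<open>basis \<tau>\<close> up to local units; the
  bare monomial over the inverse arrow would leave that unit behind.\<close>

definition basis_inv where "basis_inv \<tau> = monomial (iv \<tau>) (inv\<^bsub>A (sr \<tau>)\<^esub> (\<beta> (iv \<tau>) \<tau>))"

lemma basis_CP [simp]: "\<tau> \<in> ar \<Longrightarrow> basis \<tau> \<in> carrier CP"
  by (simp add: basis_def)

lemma inv_\<beta>_closed: "\<tau> \<in> ar \<Longrightarrow> inv\<^bsub>A (sr \<tau>)\<^esub> (\<beta> (iv \<tau>) \<tau>) \<in> carrier (A (sr \<tau>))"
proof -
  assume \<tau>: "\<tau> \<in> ar"
  then interpret Ae: ring "A (sr \<tau>)" by simp
  show ?thesis using \<beta>_unit[of "iv \<tau>" \<tau>] \<tau> by (intro Ae.Units_inv_closed) simp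
qed

lemma basis_inv_CP [simp]: "\<tau> \<in> ar \<Longrightarrow> basis_inv \<tau> \<in> carrier CP"
  using inv_\<beta>_closed[of \<tau>] by (simp add: basis_inv_def)

text \<open>At an identity O1 and O2 remove all twisting, so coefficients at \<open>e\<close> act on
  the left by plain scaling. From the right, as \<open>mult_Obj_coeff\<close> shows, only the
  cocycle disappears and \<open>\<alpha> \<rho>\<close> remains.\<close>

lemma Obj_mult_coeff:
  assumes "e \<in> Obj G" "a \<in> carrier (A e)" "y \<in> carrier CP" "\<rho> \<in> ar"
  shows "(monomial e a \<star> y) \<rho> = (if tg \<rho> = e then a \<otimes>\<^bsub>A e\<^esub> y \<rho> else \<zero>\<^bsub>At \<rho>\<^esub>)"
proof (cases "tg \<rho> = e")
  case True
  interpret Ae: ring "At \<rho>" using assms by simp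
  have y: "y \<rho> \<in> carrier (At \<rho>)" using assms by simp
  have cmp: "iv e \<bullet> \<rho> = \<rho>" using cmp_trg[of \<rho>] assms True by simp
  have \<beta>: "\<beta> e \<rho> = \<one>\<^bsub>A e\<^esub>" using O2[of \<rho>] assms True by simp
  have \<alpha>: "\<alpha> e (y \<rho>) = y \<rho>" using O1[of e "y \<rho>"] y assms True by simp
  have "(monomial e a \<star> y) \<rho> =
      a \<otimes>\<^bsub>At \<rho>\<^esub> \<alpha> e (y (iv e \<bullet> \<rho>)) \<otimes>\<^bsub>At \<rho>\<^esub> \<beta> e (iv e \<bullet> \<rho>)"
    using assms True by (subst monomial_mult_coeff) auto
  also have "\<dots> = a \<otimes>\<^bsub>A e\<^esub> y \<rho>"
    unfolding cmp \<alpha> \<beta> using assms y True by auto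
  finally show ?thesis using True by simp
next
  case False
  then show ?thesis using assms by (subst monomial_mult_coeff) auto
qed

lemma mult_Obj_coeff:
  assumes "e \<in> Obj G" "a \<in> carrier (A e)" "x \<in> carrier CP" "\<rho> \<in> ar"
  shows "(x \<star> monomial e a) \<rho> = (if sr \<rho> = e then x \<rho> \<otimes>\<^bsub>At \<rho>\<^esub> \<alpha> \<rho> a else \<zero>\<^bsub>At \<rho>\<^esub>)"
proof (cases "sr \<rho> = e")
  case True
  interpret Ae: ring "At \<rho>" using assms by simp
  have x: "x \<rho> \<in> carrier (At \<rho>)" using assms by simp
  have cmp: "\<rho> \<bullet> iv e = \<rho>" using cmp_src[of \<rho>] assms True by simp
  have \<beta>: "\<beta> \<rho> e = \<one>\<^bsub>At \<rho>\<^esub>" using O2[of \<rho>] assms True by simp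
  have \<alpha>: "\<alpha> \<rho> a \<in> carrier (At \<rho>)" using \<alpha>_closed[of \<rho> a] assms True by simp
  have "(x \<star> monomial e a) \<rho> =
      x (\<rho> \<bullet> iv e) \<otimes>\<^bsub>At \<rho>\<^esub> \<alpha> (\<rho> \<bullet> iv e) a \<otimes>\<^bsub>At \<rho>\<^esub> \<beta> (\<rho> \<bullet> iv e) e"
    using assms True by (subst mult_monomial_coeff) auto
  also have "\<dots> = x \<rho> \<otimes>\<^bsub>At \<rho>\<^esub> \<alpha> \<rho> a"
    unfolding cmp \<beta> using \<alpha> x by simp
  finally show ?thesis using True by simp
next
  case False
  then show ?thesis using assms by (subst mult_monomial_coeff) auto
qed

text \<open>Identities act as local units, the substitute for a global unit: left multiplication
  selects by target, right multiplication by source.\<close>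

lemma basis_Obj_mult:
  assumes "e \<in> Obj G" "y \<in> carrier CP"
  shows "basis e \<star> y = restriction {\<sigma>. tg \<sigma> = e} y"
proof (rule CP_eqI)
  fix \<rho> assume \<rho>: "\<rho> \<in> ar"
  interpret Ae: ring "At \<rho>" using \<rho> by simp
  have "y \<rho> \<in> carrier (At \<rho>)" using assms \<rho> by simp
  then show "(basis e \<star> y) \<rho> = restriction {\<sigma>. tg \<sigma> = e} y \<rho>"
    using assms \<rho> At_simps(2)[of e] unfolding basis_def
    by (subst Obj_mult_coeff) (auto simp: restriction_coeff)
qed (use assms in auto)

lemma mult_basis_Obj:
  assumes "e \<in> Obj G" "y \<in> carrier CP"
  shows "y \<star> basis e = restriction {\<sigma>. sr \<sigma> = e} y"
proof (rule CP_eqI)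
  fix \<rho> assume \<rho>: "\<rho> \<in> ar"
  interpret Ae: ring "At \<rho>" using \<rho> by simp
  have "y \<rho> \<in> carrier (At \<rho>)" using assms \<rho> by simp
  then show "(y \<star> basis e) \<rho> = restriction {\<sigma>. sr \<sigma> = e} y \<rho>"
    using assms \<rho> At_simps(2)[of e] \<alpha>_one[of \<rho>] unfolding basis_def
    by (subst mult_Obj_coeff) (auto simp: restriction_coeff)
qed (use assms in auto)

lemma restriction_all:
  assumes "x \<in> carrier CP" "supp x \<subseteq> P" shows "restriction P x = x"
  using assms by (intro CP_eqI) (auto simp: restriction_coeff coeff_support_def)

lemma restriction_none:
  assumes "x \<in> carrier CP" "supp x \<inter> P = {}" shows "restriction P x = \<zero>\<^bsub>CP\<^esub>"
  using assms by (intro CP_eqI) (auto simp: restriction_coeff coeff_support_def zero_coeff)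

lemma restriction_monomial:
  assumes "\<sigma> \<in> ar" "a \<in> carrier (At \<sigma>)"
  shows "restriction P (monomial \<sigma> a) = (if \<sigma> \<in> P then monomial \<sigma> a else \<zero>\<^bsub>CP\<^esub>)"
  using assms supp_monomial[of \<sigma> a] restriction_all[of "monomial \<sigma> a" P] restriction_none[of "monomial \<sigma> a" P]
  by auto

lemma monomial_cmp_trg:
  assumes "\<sigma> \<in> ar" "a \<in> carrier (At \<sigma>)"
  shows "basis (tg \<sigma>) \<star> monomial \<sigma> a = monomial \<sigma> a"
    and "monomial \<sigma> a \<star> basis (sr \<sigma>) = monomial \<sigma> a"
  using assms supp_monomial[of \<sigma> a] by (auto simp: basis_Obj_mult mult_basis_Obj intro!: restriction_all)

text \<open>The coefficient of \<open>basis_inv\<close> is normalised for the opposite product; O4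
  at \<tau>, its inverse and \<tau> gives \<open>\<beta> \<tau> (iv \<tau>) = \<alpha> \<tau>
  (\<beta> (iv \<tau>) \<tau>)\<close>, which carries the normalisation over.\<close>

lemma basis_basis_inv:
  assumes "\<tau> \<in> ar"
  shows "basis \<tau> \<star> basis_inv \<tau> = basis (tg \<tau>)"
proof -
  interpret As: ring "A (sr \<tau>)" using assms by simp
  interpret At: ring "At \<tau>" using assms by simp
  let ?B = "\<beta> (iv \<tau>) \<tau>" let ?b = "inv\<^bsub>A (sr \<tau>)\<^esub> ?B"
  have B: "?B \<in> Units (A (sr \<tau>))" using \<beta>_unit[of "iv \<tau>" \<tau>] assms by simp
  have b: "?b \<in> carrier (A (sr \<tau>))" "?B \<in> carrier (A (sr \<tau>))" using B by auto
  have "\<beta> \<tau> (iv \<tau>) \<otimes>\<^bsub>At \<tau>\<^esub> \<beta> (tg \<tau>) \<tau> = \<alpha> \<tau> ?B \<otimes>\<^bsub>At \<tau>\<^esub> \<beta> \<tau> (sr \<tau>)"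
    using O4[of \<tau> "iv \<tau>" \<tau>] assms by simp
  moreover have "\<alpha> \<tau> ?B \<in> carrier (At \<tau>)" "\<beta> \<tau> (iv \<tau>) \<in> carrier (At \<tau>)"
    using assms b by auto
  ultimately have "\<beta> \<tau> (iv \<tau>) = \<alpha> \<tau> ?B"
    using O2[of \<tau>] assms by simp
  then have "\<alpha> \<tau> ?b \<otimes>\<^bsub>At \<tau>\<^esub> \<beta> \<tau> (iv \<tau>) = \<alpha> \<tau> (?b \<otimes>\<^bsub>A (sr \<tau>)\<^esub> ?B)"
    using assms b by (simp add: \<alpha>_mult)
  also have "\<dots> = \<one>\<^bsub>At \<tau>\<^esub>" using B assms by simp
  finally have "\<alpha> \<tau> ?b \<otimes>\<^bsub>At \<tau>\<^esub> \<beta> \<tau> (iv \<tau>) = \<one>\<^bsub>At \<tau>\<^esub>" .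
  moreover have "\<alpha> \<tau> ?b \<in> carrier (At \<tau>)" using assms b by simp
  ultimately show "basis \<tau> \<star> basis_inv \<tau> = basis (tg \<tau>)"
    unfolding basis_inv_def basis_def using assms b
    by (subst monomial_mult_monomial) auto
qed

text \<open>On arrows these sets are the unions of left cosets of \<open>D\<close>, which makes
  restriction to them compatible with right multiplication by the subring.\<close>

definition right_closed :: "'g set \<Rightarrow> bool" where
  "right_closed P \<longleftrightarrow> (\<forall>\<sigma>\<in>ar. \<forall>\<delta>\<in>D. sr \<sigma> = tg \<delta> \<longrightarrow> (\<sigma> \<bullet> \<delta> \<in> P \<longleftrightarrow> \<sigma> \<in> P))"

lemma restriction_mult_SD:
  assumes P: "right_closed P" and x: "x \<in> carrier CP" and s: "s \<in> SD"
  shows "restriction P (x \<star> s) = restriction P x \<star> s"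
proof -
  have s': "s \<in> carrier CP" "supp s \<subseteq> D" using s by (auto simp: SD_iff)
  have z: "restriction P \<zero>\<^bsub>CP\<^esub> = \<zero>\<^bsub>CP\<^esub>" by (intro restriction_none) auto
  show ?thesis
    using x subset_UNIV[of "supp x"]
  proof (induction rule: CP_induct)
    case zero
    then show ?case using s' z by simp
  next
    case (add x y)
    then show ?case using s' by (simp add: mult_l_distr restriction_add)
  next
    case (mono \<sigma> a)
    note x = mono
    show ?case
      using s'
    proof (induction rule: CP_induct)
      case zero
      then show ?case using x z by simp
    next
      case (add s t)
      then show ?case using x by (simp add: mult_r_distr restriction_add)
    next
      case (mono \<delta> b)
      show ?case
      proof (cases "sr \<sigma> = tg \<delta>")
        case True
        interpret Ae: ring "At \<sigma>" using x by simp
        have "a \<otimes>\<^bsub>At \<sigma>\<^esub> \<alpha> \<sigma> b \<otimes>\<^bsub>At \<sigma>\<^esub> \<beta> \<sigma> \<delta> \<in> carrier (At \<sigma>)"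
          using x mono True by simp
        moreover have "\<sigma> \<bullet> \<delta> \<in> P \<longleftrightarrow> \<sigma> \<in> P"
          using P x mono True by (auto simp: right_closed_def)
        ultimately show ?thesis
          using x mono True by (simp add: monomial_mult_monomial restriction_monomial)
      next
        case False
        then show ?thesis
          using x mono z by (simp add: monomial_mult_monomial restriction_monomial)
      qed
    qed
  qed
qed

lemma right_linear_restriction: "right_closed P \<Longrightarrow> ext.right_linear (restriction P)"
  unfolding ext.right_linear_def by (auto simp: restriction_add restriction_mult_SD)

text \<open>On arrows composable with \<tau> the set \<open>Q\<close> is the translate of
  \<open>P\<close> by \<tau>; left multiplication carries the component over \<open>P\<close> to the
  one over \<open>Q\<close>.\<close>

lemma restriction_translate:
  assumes PQ: "\<And>\<sigma>. \<lbrakk>\<sigma> \<in> ar; sr \<tau> = tg \<sigma>\<rbrakk> \<Longrightarrow> \<tau> \<bullet> \<sigma> \<in> Q \<longleftrightarrow> \<sigma> \<in> P"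
    and \<tau>: "\<tau> \<in> ar" "a \<in> carrier (At \<tau>)" and x: "x \<in> carrier CP"
  shows "restriction Q (monomial \<tau> a \<star> x) = monomial \<tau> a \<star> restriction P x"
  using x subset_UNIV[of "supp x"]
proof (induction rule: CP_induct)
  case zero
  have "restriction R \<zero>\<^bsub>CP\<^esub> = \<zero>\<^bsub>CP\<^esub>" for R by (intro restriction_none) auto
  then show ?case using \<tau> by simp
next
  case (add x y)
  then show ?case using \<tau> by (simp add: mult_r_distr restriction_add)
next
  case (mono \<sigma> b)
  have z: "restriction R \<zero>\<^bsub>CP\<^esub> = \<zero>\<^bsub>CP\<^esub>" for R by (intro restriction_none) auto
  show ?case
  proof (cases "sr \<tau> = tg \<sigma>")
    case True
    interpret Ae: ring "At \<tau>" using \<tau> by simp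
    have "a \<otimes>\<^bsub>At \<tau>\<^esub> \<alpha> \<tau> b \<otimes>\<^bsub>At \<tau>\<^esub> \<beta> \<tau> \<sigma> \<in> carrier (At \<tau>)"
      using \<tau> mono True by simp
    then show ?thesis
      using \<tau> mono True PQ[of \<sigma>] by (simp add: monomial_mult_monomial restriction_monomial)
  next
    case False
    then show ?thesis
      using \<tau> mono z by (simp add: monomial_mult_monomial restriction_monomial)
  qed
qed

text \<open>The coset \<sigma> D, phrased as a membership test. Its arrows share the target of
  \<sigma>, but their sources run through a whole connected component of \<open>D\<close>, in
  contrast to \<open>isotropy_class\<close>.\<close>

definition left_coset :: "'g \<Rightarrow> 'g set" where
  "left_coset \<sigma> = {\<rho> \<in> ar. tg \<rho> = tg \<sigma> \<and> iv \<sigma> \<bullet> \<rho> \<in> D}"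

lemma left_coset_self: "\<sigma> \<in> ar \<Longrightarrow> \<sigma> \<in> left_coset \<sigma>"
  by (simp add: left_coset_def Obj_D)

lemma left_coset_eq:
  assumes "\<sigma> \<in> ar" "\<rho> \<in> left_coset \<sigma>" shows "left_coset \<rho> = left_coset \<sigma>"
proof -
  have r: "\<rho> \<in> ar" "tg \<rho> = tg \<sigma>" "iv \<sigma> \<bullet> \<rho> \<in> D" using assms by (auto simp: left_coset_def)
  have "iv \<rho> \<bullet> \<mu> \<in> D \<longleftrightarrow> iv \<sigma> \<bullet> \<mu> \<in> D" if m: "\<mu> \<in> ar" "tg \<mu> = tg \<sigma>" for \<mu>
  proof
    assume d: "iv \<rho> \<bullet> \<mu> \<in> D"
    have "iv \<sigma> \<bullet> \<mu> = (iv \<sigma> \<bullet> \<rho>) \<bullet> (iv \<rho> \<bullet> \<mu>)"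
      using assms(1) r m cmp_assoc[of "iv \<sigma>" \<rho> "iv \<rho> \<bullet> \<mu>"] by simp
    then show "iv \<sigma> \<bullet> \<mu> \<in> D" using d r m assms(1) by (auto intro!: D_cmp)
  next
    assume d: "iv \<sigma> \<bullet> \<mu> \<in> D"
    have "iv \<rho> \<bullet> \<mu> = iv (iv \<sigma> \<bullet> \<rho>) \<bullet> (iv \<sigma> \<bullet> \<mu>)"
      using assms(1) r m cmp_assoc[of "iv \<rho>" \<sigma> "iv \<sigma> \<bullet> \<mu>"] by simp
    moreover have "iv (iv \<sigma> \<bullet> \<rho>) \<in> D" using r D_ginv by blast
    ultimately show "iv \<rho> \<bullet> \<mu> \<in> D" using d r m assms(1) by (auto intro!: D_cmp simp del: ginv_cmp_distrib)
  qed
  then show ?thesis using r by (auto simp: left_coset_def)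
qed

lemma right_closed_left_coset:
  assumes "\<sigma> \<in> ar" shows "right_closed (left_coset \<sigma>)"
  unfolding right_closed_def
proof (intro ballI impI)
  fix \<rho> \<delta> assume r: "\<rho> \<in> ar" "\<delta> \<in> D" "sr \<rho> = tg \<delta>"
  have "iv \<sigma> \<bullet> (\<rho> \<bullet> \<delta>) \<in> D \<longleftrightarrow> iv \<sigma> \<bullet> \<rho> \<in> D" if "tg \<rho> = tg \<sigma>"
    using r D_ar[OF r(2)] assms that D_cmp_right_iff[of \<delta> "iv \<sigma> \<bullet> \<rho>"] cmp_assoc[of "iv \<sigma>" \<rho> \<delta>] by simp
  then show "\<rho> \<bullet> \<delta> \<in> left_coset \<sigma> \<longleftrightarrow> \<rho> \<in> left_coset \<sigma>"
    using r D_ar[OF r(2)] by (auto simp: left_coset_def)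
qed

lemma right_closed_UN: "(\<And>i. i \<in> I \<Longrightarrow> right_closed (P i)) \<Longrightarrow> right_closed (\<Union>i\<in>I. P i)"
  unfolding right_closed_def by blast

lemma right_closed_trg: "right_closed {\<sigma>. tg \<sigma> = e}"
  unfolding right_closed_def using D_ar by auto

text \<open>The arrow to be tested is unchanged, because (\<tau> \<sigma>)^-1 (\<tau> \<rho>) =
  \<sigma>^-1 \<rho>.\<close>

lemma left_coset_translate:
  assumes "\<tau> \<in> ar" "\<sigma> \<in> ar" "sr \<tau> = tg \<sigma>" "\<rho> \<in> ar" "sr \<tau> = tg \<rho>"
  shows "\<tau> \<bullet> \<rho> \<in> left_coset (\<tau> \<bullet> \<sigma>) \<longleftrightarrow> \<rho> \<in> left_coset \<sigma>"
proof -
  have "iv (\<tau> \<bullet> \<sigma>) \<bullet> (\<tau> \<bullet> \<rho>) = iv \<sigma> \<bullet> \<rho>"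
    using assms cmp_assoc[of "iv \<sigma>" "iv \<tau>" "\<tau> \<bullet> \<rho>"] by simp
  then show ?thesis using assms by (simp add: left_coset_def)
qed

text \<open>
  The map \<open>x \<otimes> y \<mapsto> x|\<^sub>C y\<close> is
  well defined on the tensor square since restriction to a left coset \<open>C\<close> is right linear over the subring.
\<close>

lemma separable_imp_family:
  assumes "separable_extension CP SD"
  obtains c where
    "\<And>\<sigma>. \<sigma> \<in> ar \<Longrightarrow> c \<sigma> \<in> ring_center (At \<sigma>)"
    "\<And>\<sigma> \<tau>. \<lbrakk>\<sigma> \<in> ar; \<tau> \<in> ar; sr \<tau> = tg \<sigma>\<rbrakk> \<Longrightarrow> c (\<tau> \<bullet> \<sigma>) = \<alpha> \<tau> (c \<sigma>)"
    "\<And>\<sigma> \<rho>. \<lbrakk>\<sigma> \<in> ar; \<rho> \<in> left_coset \<sigma>\<rbrakk> \<Longrightarrow> c \<rho> = c \<sigma>"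
    "\<And>e. e \<in> Obj G \<Longrightarrow> \<exists>Y. finite Y \<and> Y \<subseteq> {\<sigma> \<in> ar. tg \<sigma> = e} \<and> inj_on left_coset Y \<and>
       (\<forall>\<sigma>\<in>ar. tg \<sigma> = e \<longrightarrow> c \<sigma> \<noteq> \<zero>\<^bsub>A e\<^esub> \<longrightarrow> (\<exists>\<tau>\<in>Y. \<sigma> \<in> left_coset \<tau>)) \<and>
       (\<Oplus>\<^bsub>A e\<^esub>\<sigma>\<in>Y. c \<sigma>) = \<one>\<^bsub>A e\<^esub>"
proof -
  obtain d where d: "\<And>x. x \<in> carrier CP \<Longrightarrow> d x \<in> ext.FA" "\<And>x. x \<in> carrier CP \<Longrightarrow> ext.mu (d x) = x"
    and dL: "\<And>r x. \<lbrakk>r \<in> carrier CP; x \<in> carrier CP\<rbrakk> \<Longrightarrow> d (r \<star> x) \<approx>\<^sub>T ext.left_mul r (d x)"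
    and dR: "\<And>r x. \<lbrakk>r \<in> carrier CP; x \<in> carrier CP\<rbrakk> \<Longrightarrow> d (x \<star> r) \<approx>\<^sub>T ext.right_mul r (d x)"
    using assms unfolding ext.separable_iff by blast
  \<comment> \<open>The values at the local units take the place of the value at 1.\<close>
  define \<xi> where "\<xi> e = d (basis e)" for e
  have \<xi>: "\<xi> e \<in> ext.FA" "ext.mu (\<xi> e) = basis e" if "e \<in> Obj G" for e
    using d that by (auto simp: \<xi>_def)
  \<comment> \<open>Both sides represent the value of \<open>d\<close> at one monomial, which
    absorbs a local unit on its right as well as on its left.\<close>
  have comm: "ext.left_mul (monomial \<tau> a) (\<xi> (sr \<tau>)) \<approx>\<^sub>T ext.right_mul (monomial \<tau> a) (\<xi> (tg \<tau>))"
    if \<tau>: "\<tau> \<in> ar" "a \<in> carrier (At \<tau>)" for \<tau> a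
  proof -
    have "ext.left_mul (monomial \<tau> a) (\<xi> (sr \<tau>)) \<approx>\<^sub>T d (monomial \<tau> a \<star> basis (sr \<tau>))"
      unfolding \<xi>_def using \<tau> by (intro ext.tensor_eq_sym[OF dL]) auto
    also have "monomial \<tau> a \<star> basis (sr \<tau>) = basis (tg \<tau>) \<star> monomial \<tau> a"
      using \<tau> by (simp add: monomial_cmp_trg)
    also have "d \<dots> \<approx>\<^sub>T ext.right_mul (monomial \<tau> a) (\<xi> (tg \<tau>))"
      unfolding \<xi>_def using \<tau> by (intro dR) auto
    finally show ?thesis .
  qed
  define \<Phi> where "\<Phi> P = ext.twisted_mult (restriction P)" for P
  have \<Phi>_CP: "\<Phi> P z \<in> carrier CP" if "right_closed P" "z \<in> ext.FA" for P z
    unfolding \<Phi>_def using that by (intro ext.twisted_mult_closed right_linear_restriction)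
  \<comment> \<open>This is \<open>comm\<close> projected to the coset of \<tau> \<sigma>: left
    multiplication over \<tau> pulls the projection back to the coset of \<sigma>, while right
    multiplication commutes with it.\<close>
  have \<Phi>_comm: "monomial \<tau> a \<star> \<Phi> (left_coset \<sigma>) (\<xi> (sr \<tau>))
      = \<Phi> (left_coset (\<tau> \<bullet> \<sigma>)) (\<xi> (tg \<tau>)) \<star> monomial \<tau> a"
    if \<tau>: "\<tau> \<in> ar" "a \<in> carrier (At \<tau>)" "\<sigma> \<in> ar" "sr \<tau> = tg \<sigma>" for \<tau> a \<sigma>
  proof -
    have rc: "right_closed (left_coset \<sigma>)" "right_closed (left_coset (\<tau> \<bullet> \<sigma>))"
      using \<tau> by (auto intro!: right_closed_left_coset)
    have "monomial \<tau> a \<star> \<Phi> (left_coset \<sigma>) (\<xi> (sr \<tau>))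
        = \<Phi> (left_coset (\<tau> \<bullet> \<sigma>)) (ext.left_mul (monomial \<tau> a) (\<xi> (sr \<tau>)))"
      unfolding \<Phi>_def
    proof (rule ext.twisted_mult_left_mul[symmetric])
      show "restriction (left_coset (\<tau> \<bullet> \<sigma>)) (monomial \<tau> a \<star> x)
          = monomial \<tau> a \<star> restriction (left_coset \<sigma>) x"
        if "x \<in> carrier CP" for x
        using \<tau> that by (intro restriction_translate left_coset_translate)
    qed (use \<tau> \<xi> rc right_linear_restriction in auto)
    also have "\<dots> = \<Phi> (left_coset (\<tau> \<bullet> \<sigma>)) (ext.right_mul (monomial \<tau> a) (\<xi> (tg \<tau>)))"
      unfolding \<Phi>_def using \<tau> \<xi> rc
      by (intro ext.twisted_mult_cong right_linear_restriction comm ext.left_mul_FA ext.right_mul_FA) auto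
    also have "\<dots> = \<Phi> (left_coset (\<tau> \<bullet> \<sigma>)) (\<xi> (tg \<tau>)) \<star> monomial \<tau> a"
      unfolding \<Phi>_def using \<tau> \<xi> rc by (intro ext.twisted_mult_right_mul right_linear_restriction) auto
    finally show ?thesis .
  qed
  \<comment> \<open>For a tensor c u \<otimes> v, with u the basis element over \<sigma> and v its
    inverse, the projection to the coset multiplies out to c times a local unit, so the coefficient
    at the identity recovers c.\<close>
  define c where "c \<sigma> = \<Phi> (left_coset \<sigma>) (\<xi> (tg \<sigma>)) (tg \<sigma>)" for \<sigma>
  have \<Phi>l: "\<Phi> (left_coset \<sigma>) (\<xi> (tg \<sigma>)) \<in> carrier CP" if "\<sigma> \<in> ar" for \<sigma>
    using that \<xi> by (intro \<Phi>_CP right_closed_left_coset) auto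
  have c_closed: "c \<sigma> \<in> carrier (At \<sigma>)" if "\<sigma> \<in> ar" for \<sigma>
    using coeff_closed[OF \<Phi>l[OF that], of "tg \<sigma>"] that by (simp add: c_def)
  have c_center: "c \<sigma> \<in> ring_center (At \<sigma>)" if \<sigma>: "\<sigma> \<in> ar" for \<sigma>
    unfolding ring_center_def
  proof (intro CollectI conjI ballI c_closed \<sigma>)
    fix a assume a: "a \<in> carrier (At \<sigma>)"
    let ?p = "\<Phi> (left_coset \<sigma>) (\<xi> (tg \<sigma>))"
    \<comment> \<open>An identity arrow leaves the coset fixed, so the commutation rule makes the
      projected element commute with the coefficients at \<open>tg \<sigma>\<close>.\<close>
    have "monomial (tg \<sigma>) a \<star> ?p = ?p \<star> monomial (tg \<sigma>) a"
      using \<Phi>_comm[of "tg \<sigma>" a \<sigma>] \<sigma> a by simp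
    then have "(monomial (tg \<sigma>) a \<star> ?p) (tg \<sigma>) = (?p \<star> monomial (tg \<sigma>) a) (tg \<sigma>)"
      by simp
    then show "a \<otimes>\<^bsub>At \<sigma>\<^esub> c \<sigma> = c \<sigma> \<otimes>\<^bsub>At \<sigma>\<^esub> a"
      using \<Phi>l \<sigma> a O1[of "tg \<sigma>" a] by (simp add: Obj_mult_coeff mult_Obj_coeff c_def)
  qed
  have c_equi: "c (\<tau> \<bullet> \<sigma>) = \<alpha> \<tau> (c \<sigma>)" if \<tau>: "\<sigma> \<in> ar" "\<tau> \<in> ar" "sr \<tau> = tg \<sigma>" for \<sigma> \<tau>
  proof -
    interpret Ae: ring "At \<tau>" using \<tau> by simp
    let ?p = "\<Phi> (left_coset \<sigma>) (\<xi> (sr \<tau>))" let ?q = "\<Phi> (left_coset (\<tau> \<bullet> \<sigma>)) (\<xi> (tg \<tau>))"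
    have p: "?p \<in> carrier CP" using \<Phi>l[of \<sigma>] \<tau> by simp
    have q: "?q \<in> carrier CP" using \<Phi>l[of "\<tau> \<bullet> \<sigma>"] \<tau> by simp
    \<comment> \<open>Comparing coefficients at \<tau> itself involves both projected elements at
      identity arrows only, where \<open>c\<close> is read off.\<close>
    have "(basis \<tau> \<star> ?p) \<tau> = (?q \<star> basis \<tau>) \<tau>"
      using \<Phi>_comm[of \<tau> "\<one>\<^bsub>At \<tau>\<^esub>" \<sigma>] \<tau> by (simp add: basis_def)
    moreover have "(basis \<tau> \<star> ?p) \<tau> = \<alpha> \<tau> (?p (sr \<tau>))"
      unfolding basis_def using \<tau> p O2[of \<tau>] coeff_closed[OF p, of "sr \<tau>"]
          by (subst monomial_mult_coeff) auto
    moreover have "(?q \<star> basis \<tau>) \<tau> = ?q (tg \<tau>)"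
      unfolding basis_def using \<tau> q O2[of \<tau>] coeff_closed[OF q, of "tg \<tau>"] \<alpha>_one[of "tg \<tau>"]
      by (subst mult_monomial_coeff) auto
    ultimately show ?thesis using \<tau> by (simp add: c_def)
  qed
  have c_left_coset: "c \<rho> = c \<sigma>" if "\<sigma> \<in> ar" "\<rho> \<in> left_coset \<sigma>" for \<sigma> \<rho>
    using left_coset_eq[OF that] that(2) by (simp add: c_def left_coset_def)
  have c_sum: "\<exists>Y. finite Y \<and> Y \<subseteq> {\<sigma> \<in> ar. tg \<sigma> = e} \<and> inj_on left_coset Y \<and>
       (\<forall>\<sigma>\<in>ar. tg \<sigma> = e \<longrightarrow> c \<sigma> \<noteq> \<zero>\<^bsub>A e\<^esub> \<longrightarrow> (\<exists>\<tau>\<in>Y. \<sigma> \<in> left_coset \<tau>)) \<and>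
       (\<Oplus>\<^bsub>A e\<^esub>\<sigma>\<in>Y. c \<sigma>) = \<one>\<^bsub>A e\<^esub>" if e: "e \<in> Obj G" for e
  proof -
    interpret Ae: ring "A e" using e ring_A by simp
    let ?z = "\<xi> e"
    \<comment> \<open>All arrows into \<open>e\<close> that occur in first factors of the
      representative; they form a finite set.\<close>
    define Z where "Z = (\<Union>p\<in>Poly_Mapping.keys ?z. supp (fst p)) \<inter> {\<sigma>. tg \<sigma> = e}"
    have key_CP: "x \<in> carrier CP" if "(x, y) \<in> Poly_Mapping.keys ?z" for x y
      using that \<xi>(1)[OF e] by auto
    have Z: "Z \<subseteq> {\<sigma> \<in> ar. tg \<sigma> = e}" "finite Z"
      using supp_ar key_CP unfolding Z_def by (blast, intro finite_Int disjI1 finite_UN_I) auto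
    have Z_mem: "\<sigma> \<in> Z" if "(x, y) \<in> Poly_Mapping.keys ?z" "\<sigma> \<in> supp x" "tg \<sigma> = e" for x y \<sigma>
      using that by (force simp: Z_def)
    \<comment> \<open>The choice depends on the coset as a set, so arrows of one coset get the same
      representative; this makes \<open>left_coset\<close> injective on the chosen ones.\<close>
    define rep where "rep \<sigma> = (SOME \<rho>. \<rho> \<in> left_coset \<sigma>)" for \<sigma>
    have rep: "rep \<sigma> \<in> left_coset \<sigma>" if "\<sigma> \<in> ar" for \<sigma>
      unfolding rep_def using left_coset_self[OF that] by (rule someI)
    have rep_left_coset: "left_coset (rep \<sigma>) = left_coset \<sigma>" if "\<sigma> \<in> ar" for \<sigma>
      using left_coset_eq[OF that rep[OF that]] .
    let ?Y = "rep ` Z"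
    have Y: "finite ?Y" "?Y \<subseteq> {\<sigma> \<in> ar. tg \<sigma> = e}"
      using Z rep by (auto simp: left_coset_def)
    have inj: "inj_on left_coset ?Y"
    proof (intro inj_onI)
      fix \<sigma> \<tau> assume "\<sigma> \<in> ?Y" "\<tau> \<in> ?Y" and eq: "left_coset \<sigma> = left_coset \<tau>"
      then obtain \<sigma>' \<tau>' where "\<sigma>' \<in> ar" "\<sigma> = rep \<sigma>'" "\<tau>' \<in> ar" "\<tau> = rep \<tau>'"
        using Z(1) by blast
      with eq have "left_coset \<sigma>' = left_coset \<tau>'" using rep_left_coset by metis
      then show "\<sigma> = \<tau>" using \<open>\<sigma> = rep \<sigma>'\<close> \<open>\<tau> = rep \<tau>'\<close> by (simp add: rep_def)
    qed
    have cover: "\<exists>\<tau>\<in>?Y. \<sigma> \<in> left_coset \<tau>" if \<sigma>: "\<sigma> \<in> ar" "tg \<sigma> = e" "c \<sigma> \<noteq> \<zero>\<^bsub>A e\<^esub>" for \<sigma>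
    proof -
      \<comment> \<open>If the coset contained no arrow of \<open>Z\<close>, restriction to it would
        kill every first factor and \<open>c \<sigma>\<close> would be zero.\<close>
      have "left_coset \<sigma> \<inter> Z \<noteq> {}"
      proof
        assume emp: "left_coset \<sigma> \<inter> Z = {}"
        have "\<Phi> (left_coset \<sigma>) ?z = \<zero>\<^bsub>CP\<^esub>"
          unfolding \<Phi>_def
        proof (rule ext.twisted_mult_vanish)
          show "ext.right_linear (restriction (left_coset \<sigma>))" using \<sigma>
              by (intro right_linear_restriction right_closed_left_coset)
          fix x y assume xy: "(x, y) \<in> Poly_Mapping.keys ?z"
          have "supp x \<inter> left_coset \<sigma> = {}"
            using emp Z_mem[OF xy] \<sigma> by (auto simp: left_coset_def)
          then show "restriction (left_coset \<sigma>) x = \<zero>\<^bsub>CP\<^esub>"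
            using key_CP[OF xy] by (intro restriction_none)
        qed (use \<xi> e in auto)
        then show False using \<sigma> e zero_coeff[of e] by (simp add: c_def)
      qed
      then obtain \<rho> where \<rho>: "\<rho> \<in> left_coset \<sigma>" "\<rho> \<in> Z" by blast
      then have "\<sigma> \<in> left_coset (rep \<rho>)"
        using rep_left_coset[of \<rho>] left_coset_eq[OF \<sigma>(1) \<rho>(1)] left_coset_self[OF \<sigma>(1)] Z(1) by auto
      then show ?thesis using \<rho> by blast
    qed
    \<comment> \<open>Distinct cosets are disjoint, so the projections to them add up to the
      projection to their union.\<close>
    have sum: "(\<Oplus>\<^bsub>A e\<^esub>\<sigma>\<in>W. c \<sigma>) = \<Phi> (\<Union>\<sigma>\<in>W. left_coset \<sigma>) ?z e"
      if "finite W" "W \<subseteq> {\<sigma> \<in> ar. tg \<sigma> = e}" "inj_on left_coset W" for W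
      using that
    proof (induction W)
      case empty
      have "\<Phi> {} ?z = \<zero>\<^bsub>CP\<^esub>"
        unfolding \<Phi>_def
        by (intro ext.twisted_mult_vanish restriction_none right_linear_restriction)
          (use \<xi> e key_CP in \<open>auto simp: right_closed_def\<close>)
      then show ?case using e zero_coeff[of e] by simp
    next
      case (insert \<sigma> W)
      have W: "\<sigma> \<in> ar" "tg \<sigma> = e" "W \<subseteq> ar" using insert.prems by auto
      have disj: "left_coset \<sigma> \<inter> (\<Union>\<sigma>\<in>W. left_coset \<sigma>) = {}"
      proof (rule ccontr)
        assume "left_coset \<sigma> \<inter> (\<Union>\<sigma>\<in>W. left_coset \<sigma>) \<noteq> {}"
        then obtain \<tau> \<rho> where t: "\<tau> \<in> W" "\<rho> \<in> left_coset \<sigma>" "\<rho> \<in> left_coset \<tau>" by blast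
        then have "left_coset \<sigma> = left_coset \<tau>" using left_coset_eq[of \<sigma> \<rho>] left_coset_eq[of \<tau> \<rho>] W by auto
        then have "\<sigma> = \<tau>" using insert.prems(2) t(1) by (auto simp: inj_on_def)
        then show False using insert.hyps t(1) by simp
      qed
      have rc: "right_closed (left_coset \<sigma>)" "right_closed (\<Union>\<sigma>\<in>W. left_coset \<sigma>)"
        "right_closed (left_coset \<sigma> \<union> (\<Union>\<sigma>\<in>W. left_coset \<sigma>))"
        using W right_closed_UN[of "insert \<sigma> W" left_coset] right_closed_UN[of W left_coset]
        by (auto intro!: right_closed_left_coset)
      have "\<Phi> (left_coset \<sigma> \<union> (\<Union>\<sigma>\<in>W. left_coset \<sigma>)) ?z = \<Phi> (left_coset \<sigma>) ?z \<boxplus> \<Phi> (\<Union>\<sigma>\<in>W. left_coset \<sigma>) ?z"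
        unfolding \<Phi>_def using rc disj \<xi>(1)[OF e]
        by (intro ext.twisted_mult_plus right_linear_restriction restriction_split) auto
      then have "\<Phi> (\<Union>\<sigma>\<in>insert \<sigma> W. left_coset \<sigma>) ?z e = c \<sigma> \<oplus>\<^bsub>A e\<^esub> \<Phi> (\<Union>\<sigma>\<in>W. left_coset \<sigma>) ?z e"
        using e W add_coeff[of e] by (simp add: c_def)
      moreover have "(\<Oplus>\<^bsub>A e\<^esub>\<sigma>\<in>W. c \<sigma>) = \<Phi> (\<Union>\<sigma>\<in>W. left_coset \<sigma>) ?z e"
        using insert by (intro insert.IH) (auto simp: inj_on_def)
      moreover have "(\<Oplus>\<^bsub>A e\<^esub>\<sigma>\<in>insert \<sigma> W. c \<sigma>) = c \<sigma> \<oplus>\<^bsub>A e\<^esub> (\<Oplus>\<^bsub>A e\<^esub>\<sigma>\<in>W. c \<sigma>)"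
        using insert.hyps insert.prems c_closed by (intro Ae.finsum_insert) fastforce+
      ultimately show ?case by simp
    qed
    let ?U = "\<Union>\<sigma>\<in>?Y. left_coset \<sigma>" let ?V = "{\<sigma>. tg \<sigma> = e}"
    have rcU: "right_closed ?U"
      using Y by (intro right_closed_UN right_closed_left_coset) auto
    \<comment> \<open>The chosen cosets contain every arrow into \<open>e\<close> that occurs in a
      first factor, so on this representative their union acts like the set of all arrows into
      \<open>e\<close>.\<close>
    have "\<Phi> ?U ?z = \<Phi> ?V ?z"
      unfolding \<Phi>_def
    proof (rule ext.twisted_mult_eq_on)
      fix x y assume xy: "(x, y) \<in> Poly_Mapping.keys ?z"
      show "restriction ?U x = restriction ?V x"
      proof (rule CP_eqI)
        fix \<sigma> assume \<sigma>: "\<sigma> \<in> ar"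
        have "\<sigma> \<in> ?U" if "\<sigma> \<in> supp x" "tg \<sigma> = e"
          using Z_mem[OF xy that] rep_left_coset[OF \<sigma>] left_coset_self[OF \<sigma>] by blast
        moreover have "tg \<sigma> = e" if "\<sigma> \<in> ?U"
          using that Y by (auto simp: left_coset_def)
        ultimately show "restriction ?U x \<sigma> = restriction ?V x \<sigma>"
          using \<sigma> not_supp[OF \<sigma>, of x] by (cases "\<sigma> \<in> supp x") (auto simp: restriction_coeff)
      qed (use key_CP[OF xy] in auto)
    qed (use \<xi> e rcU right_linear_restriction in auto)
    \<comment> \<open>First factors may also involve arrows not ending at \<open>e\<close>. Passing
      to the equivalent representative multiplied by \<open>basis e\<close> removes these; the
      restriction then changes nothing and \<open>mu\<close> gives the value.\<close>
    also have "\<Phi> ?V ?z = \<Phi> ?V (ext.left_mul (basis e) ?z)"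
    proof -
      have "basis e \<star> basis e = basis e"
        using monomial_cmp_trg(1)[of e "\<one>\<^bsub>A e\<^esub>"] e by (simp add: basis_def)
      then have "?z \<approx>\<^sub>T ext.left_mul (basis e) ?z"
        using dL[of "basis e" "basis e"] e by (simp add: \<xi>_def)
      then show ?thesis
        unfolding \<Phi>_def using \<xi> e
        by (intro ext.twisted_mult_cong right_linear_restriction right_closed_trg ext.left_mul_FA) auto
    qed
    also have "\<dots> = basis e \<star> ext.mu ?z"
      unfolding \<Phi>_def
    proof (rule ext.twisted_mult_left_mul)
      show "ext.right_linear id" by (rule ext.right_linear_id)
      show "ext.right_linear (restriction ?V)" by (intro right_linear_restriction right_closed_trg)
      show "restriction ?V (basis e \<star> x) = basis e \<star> id x" if "x \<in> carrier CP" for x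
        using that e by (simp add: basis_Obj_mult restriction_all supp_restriction)
    qed (use \<xi> e in auto)
    also have "\<dots> = basis e"
      using \<xi>(2)[OF e] monomial_cmp_trg(1)[of e "\<one>\<^bsub>A e\<^esub>"] e by (simp add: basis_def)
    finally have "\<Phi> ?U ?z e = \<one>\<^bsub>A e\<^esub>"
      using e by (simp add: basis_def monomial_coeff)
    then have "(\<Oplus>\<^bsub>A e\<^esub>\<sigma>\<in>?Y. c \<sigma>) = \<one>\<^bsub>A e\<^esub>"
      using sum[OF Y inj] by simp
    then show ?thesis using Y inj cover by (intro exI[of _ ?Y]) blast
  qed
  show ?thesis by (rule that[of c, OF c_center c_equi c_left_coset c_sum])
qed

end

section \<open>From a trace condition to a separability splitting\<close>

context object_crossed_system
begin

lemma ring_center_closed: "a \<in> ring_center (A e) \<Longrightarrow> a \<in> carrier (A e)"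
  by (simp add: ring_center_def)

lemma \<alpha>_center:
  assumes "\<sigma> \<in> ar" "a \<in> ring_center (A (sr \<sigma>))"
  shows "\<alpha> \<sigma> a \<in> ring_center (At \<sigma>)"
  unfolding ring_center_def
proof (intro CollectI conjI ballI)
  have a: "a \<in> carrier (A (sr \<sigma>))" using assms ring_center_closed by blast
  show "\<alpha> \<sigma> a \<in> carrier (At \<sigma>)" using a assms by simp
  fix y assume "y \<in> carrier (At \<sigma>)"
  then obtain x where x: "x \<in> carrier (A (sr \<sigma>))" "y = \<alpha> \<sigma> x"
    using \<alpha>_bij[OF assms(1)] by (auto simp: bij_betw_def)
  have "\<alpha> \<sigma> (x \<otimes>\<^bsub>A (sr \<sigma>)\<^esub> a) = \<alpha> \<sigma> (a \<otimes>\<^bsub>A (sr \<sigma>)\<^esub> x)"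
    using assms x by (simp add: ring_center_def)
  then show "y \<otimes>\<^bsub>At \<sigma>\<^esub> \<alpha> \<sigma> a = \<alpha> \<sigma> a \<otimes>\<^bsub>At \<sigma>\<^esub> y"
    using x a assms by (simp add: \<alpha>_mult)
qed

text \<open>By O3 the maps \<alpha> compose up to conjugation by a unit, and conjugation fixes
  central elements. On centres \<alpha> is therefore a genuine action, on which the calculus of
  traces relies.\<close>

lemma \<alpha>_cmp_center:
  assumes "\<sigma> \<in> ar" "\<tau> \<in> ar" "sr \<sigma> = tg \<tau>" "a \<in> ring_center (A (sr \<tau>))"
  shows "\<alpha> \<sigma> (\<alpha> \<tau> a) = \<alpha> (\<sigma> \<bullet> \<tau>) a"
proof -
  interpret Ae: ring "At \<sigma>" using assms by simp
  let ?B = "\<beta> \<sigma> \<tau>" let ?c = "\<alpha> (\<sigma> \<bullet> \<tau>) a"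
  have B: "?B \<in> Units (At \<sigma>)" using \<beta>_unit assms by simp
  have "?c \<in> ring_center (At \<sigma>)"
    using \<alpha>_center[of "\<sigma> \<bullet> \<tau>" a] assms by simp
  then have c: "?c \<in> carrier (At \<sigma>)" "?B \<otimes>\<^bsub>At \<sigma>\<^esub> ?c = ?c \<otimes>\<^bsub>At \<sigma>\<^esub> ?B"
    using B by (auto simp: ring_center_def)
  have "\<alpha> \<sigma> (\<alpha> \<tau> a) = ?B \<otimes>\<^bsub>At \<sigma>\<^esub> ?c \<otimes>\<^bsub>At \<sigma>\<^esub> inv\<^bsub>At \<sigma>\<^esub> ?B"
    using assms ring_center_closed by (intro O3)
  also have "\<dots> = ?c \<otimes>\<^bsub>At \<sigma>\<^esub> (?B \<otimes>\<^bsub>At \<sigma>\<^esub> inv\<^bsub>At \<sigma>\<^esub> ?B)"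
    unfolding c(2) using B c(1) by (intro Ae.m_assoc) auto
  also have "\<dots> = ?c" using B c by simp
  finally show ?thesis .
qed

text \<open>Covers infinite index sets as well: both sums are then zero by convention.\<close>

lemma \<alpha>_finsum:
  assumes "\<sigma> \<in> ar" "\<And>i. i \<in> I \<Longrightarrow> g i \<in> carrier (A (sr \<sigma>))"
  shows "\<alpha> \<sigma> (\<Oplus>\<^bsub>A (sr \<sigma>)\<^esub>i\<in>I. g i) = (\<Oplus>\<^bsub>At \<sigma>\<^esub>i\<in>I. \<alpha> \<sigma> (g i))"
proof -
  interpret As: ring "A (sr \<sigma>)" using assms by simp
  interpret At: ring "At \<sigma>" using assms by simp
  show ?thesis
    using assms(2)
  proof (induction I rule: infinite_finite_induct)
    case (insert i I)
    then show ?case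
      using assms(1) by (simp add: Pi_iff \<alpha>_add)
  qed (use assms(1) in simp_all)
qed

end

section \<open>Transversals of isotropy classes and traces\<close>

locale transversal_crossed_system = wide_crossed_system G A \<alpha> \<beta> D
  for G :: "'g groupoid_struct" and A :: "'g \<Rightarrow> 'a ring" and \<alpha> \<beta> D +
  fixes T :: "'g set"
  assumes transversal: "isotropy_transversal G D T"
begin

abbreviation "CI f \<equiv> central_invariants G A \<alpha> D f"
abbreviation "TT f e \<equiv> hom_in G T f e"
abbreviation "tr f e a \<equiv> groupoid_trace G A \<alpha> T f e a"

text \<open>Fixing the source is the only difference between the classes represented by
  \<open>T\<close> and the left cosets that carry the tensors. A left coset therefore has one
  representative in \<open>T\<close> for each source occurring in it.\<close>

lemma isotropy_class_left_coset:
  assumes "\<sigma> \<in> ar"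
  shows "isotropy_class G D \<sigma> = {\<rho> \<in> left_coset \<sigma>. sr \<rho> = sr \<sigma>}"
proof (intro equalityI subsetI)
  fix \<rho> assume "\<rho> \<in> isotropy_class G D \<sigma>"
  then obtain \<delta> where "\<rho> = \<sigma> \<bullet> \<delta>" "\<delta> \<in> D" "sr \<delta> = tg \<delta>" "sr \<sigma> = tg \<delta>"
    by (auto simp: isotropy_class_def isotropy_union_def hom_in_def)
  then show "\<rho> \<in> {\<rho> \<in> left_coset \<sigma>. sr \<rho> = sr \<sigma>}"
    using assms D_ar[of \<delta>] by (simp add: left_coset_def)
next
  fix \<rho> assume "\<rho> \<in> {\<rho> \<in> left_coset \<sigma>. sr \<rho> = sr \<sigma>}"
  then have r: "\<rho> \<in> ar" "tg \<rho> = tg \<sigma>" "iv \<sigma> \<bullet> \<rho> \<in> D" "sr \<rho> = sr \<sigma>"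
    by (auto simp: left_coset_def)
  then have "iv \<sigma> \<bullet> \<rho> \<in> isotropy_union G D" "\<rho> = \<sigma> \<bullet> (iv \<sigma> \<bullet> \<rho>)"
    using assms by (auto simp: isotropy_union_def hom_in_def intro!: bexI[of _ "sr \<sigma>"])
  then show "\<rho> \<in> isotropy_class G D \<sigma>"
    unfolding isotropy_class_def using r assms by (intro CollectI exI[of _ "iv \<sigma> \<bullet> \<rho>"]) auto
qed

lemma isotropy_class_eq_iff:
  assumes "\<sigma> \<in> ar" "\<tau> \<in> ar"
  shows "isotropy_class G D \<sigma> = isotropy_class G D \<tau> \<longleftrightarrow> \<tau> \<in> left_coset \<sigma> \<and> sr \<tau> = sr \<sigma>"
proof
  assume "isotropy_class G D \<sigma> = isotropy_class G D \<tau>"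
  then have "\<tau> \<in> isotropy_class G D \<sigma>"
    using left_coset_self[OF assms(2)] isotropy_class_left_coset[OF assms(2)] by simp
  then show "\<tau> \<in> left_coset \<sigma> \<and> sr \<tau> = sr \<sigma>"
    using isotropy_class_left_coset[OF assms(1)] by simp
next
  assume "\<tau> \<in> left_coset \<sigma> \<and> sr \<tau> = sr \<sigma>"
  then show "isotropy_class G D \<sigma> = isotropy_class G D \<tau>"
    using assms left_coset_eq[of \<sigma> \<tau>] by (simp add: isotropy_class_left_coset)
qed

lemma T_ar: "\<tau> \<in> T \<Longrightarrow> \<tau> \<in> ar"
  using transversal by (auto simp: isotropy_transversal_def)

definition representative where "representative \<sigma> = (THE \<tau>. \<tau> \<in> T \<and> \<tau> \<in> left_coset \<sigma> \<and> sr \<tau> = sr \<sigma>)"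

lemma representative_ex1: "\<sigma> \<in> ar \<Longrightarrow> \<exists>!\<tau>. \<tau> \<in> T \<and> \<tau> \<in> left_coset \<sigma> \<and> sr \<tau> = sr \<sigma>"
proof -
  assume \<sigma>: "\<sigma> \<in> ar"
  have "\<exists>!\<tau>. \<tau> \<in> T \<and> isotropy_class G D \<sigma> = isotropy_class G D \<tau>"
    using transversal \<sigma> by (simp add: isotropy_transversal_def)
  moreover have "\<tau> \<in> T \<and> isotropy_class G D \<sigma> = isotropy_class G D \<tau> \<longleftrightarrow>
      \<tau> \<in> T \<and> \<tau> \<in> left_coset \<sigma> \<and> sr \<tau> = sr \<sigma>" for \<tau>
    using isotropy_class_eq_iff[OF \<sigma>] T_ar by blast
  ultimately show ?thesis by simp
qed

lemma representative:
  assumes "\<sigma> \<in> ar"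
  shows representative_T: "representative \<sigma> \<in> T" and representative_left_coset: "representative \<sigma> \<in> left_coset \<sigma>" and src_representative: "sr (representative \<sigma>) = sr \<sigma>"
    and representative_ar: "representative \<sigma> \<in> ar" and trg_representative: "tg (representative \<sigma>) = tg \<sigma>"
proof -
  have "representative \<sigma> \<in> T \<and> representative \<sigma> \<in> left_coset \<sigma> \<and> sr (representative \<sigma>) = sr \<sigma>"
    unfolding representative_def by (rule theI'[OF representative_ex1[OF assms]])
  then show "representative \<sigma> \<in> T" "representative \<sigma> \<in> left_coset \<sigma>" "sr (representative \<sigma>)
      = sr \<sigma>" "representative \<sigma> \<in> ar" "tg (representative \<sigma>) = tg \<sigma>"
    by (auto simp: left_coset_def)
qed

lemma representative_unique: "\<lbrakk>\<sigma> \<in> ar; \<tau> \<in> T; \<tau> \<in> left_coset \<sigma>; sr \<tau> = sr \<sigma>\<rbrakk> \<Longrightarrow> representative \<sigma> = \<tau>"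
  unfolding representative_def by (rule the1_equality[OF representative_ex1]) auto

lemma TT_iff: "\<tau> \<in> TT f e \<longleftrightarrow> \<tau> \<in> T \<and> sr \<tau> = f \<and> tg \<tau> = e"
  by (simp add: hom_in_def)

lemma representative_translate_inverse:
  assumes "\<rho> \<in> ar" "\<tau> \<in> T" "sr \<rho> = tg \<tau>"
  shows "representative (iv \<rho> \<bullet> representative (\<rho> \<bullet> \<tau>)) = \<tau>"
proof (rule representative_unique)
  have \<tau>: "\<tau> \<in> ar" using assms T_ar by blast
  note r = representative_ar[of "\<rho> \<bullet> \<tau>"] src_representative[of "\<rho> \<bullet> \<tau>"] trg_representative[of "\<rho> \<bullet> \<tau>"]
  show "iv \<rho> \<bullet> representative (\<rho> \<bullet> \<tau>) \<in> ar" "sr \<tau> = sr (iv \<rho> \<bullet> representative (\<rho> \<bullet> \<tau>))"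
    using assms \<tau> r by auto
  have "\<rho> \<bullet> \<tau> \<in> left_coset (representative (\<rho> \<bullet> \<tau>))"
    using left_coset_eq[OF _ representative_left_coset] left_coset_self[of "\<rho> \<bullet> \<tau>"] assms \<tau> by simp
  then show "\<tau> \<in> left_coset (iv \<rho> \<bullet> representative (\<rho> \<bullet> \<tau>))"
    using left_coset_translate[of \<rho> "iv \<rho> \<bullet> representative (\<rho> \<bullet> \<tau>)" \<tau>] assms \<tau> r by simp
qed (use assms in auto)

text \<open>Left translation permutes isotropy classes, and translating back by the inverse arrow
  undoes it; taking representatives turns this into a bijection between slices of
  \<open>T\<close>.\<close>

lemma bij_translate:
  assumes "\<rho> \<in> ar"
  shows "bij_betw (\<lambda>\<tau>. representative (\<rho> \<bullet> \<tau>)) (TT f (sr \<rho>)) (TT f (tg \<rho>))"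
proof (rule bij_betw_byWitness[where f' = "\<lambda>\<tau>. representative (iv \<rho> \<bullet> \<tau>)"])
  have *: "representative (\<rho> \<bullet> \<tau>) \<in> TT f (tg \<rho>)" if "\<rho> \<in> ar" "\<tau> \<in> TT f (sr \<rho>)" for \<rho> \<tau>
    using that representative_T[of "\<rho> \<bullet> \<tau>"] src_representative[of "\<rho> \<bullet> \<tau>"] trg_representative[of "\<rho> \<bullet> \<tau>"] T_ar[of \<tau>]
    by (simp add: TT_iff)
  show "(\<lambda>\<tau>. representative (\<rho> \<bullet> \<tau>)) ` TT f (sr \<rho>) \<subseteq> TT f (tg \<rho>)"
    using *[OF assms] by blast
  show "(\<lambda>\<tau>. representative (iv \<rho> \<bullet> \<tau>)) ` TT f (tg \<rho>) \<subseteq> TT f (sr \<rho>)"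
    using *[of "iv \<rho>"] assms by auto
  show "\<forall>\<tau>\<in>TT f (sr \<rho>). representative (iv \<rho> \<bullet> representative (\<rho> \<bullet> \<tau>)) = \<tau>"
    using assms by (auto simp: TT_iff intro: representative_translate_inverse)
  show "\<forall>\<tau>\<in>TT f (tg \<rho>). representative (\<rho> \<bullet> representative (iv \<rho> \<bullet> \<tau>)) = \<tau>"
    using assms representative_translate_inverse[of "iv \<rho>"] by (auto simp: TT_iff)
qed

lemma CI_center: "a \<in> CI f \<Longrightarrow> a \<in> ring_center (A f)"
  by (simp add: invariants_def)

lemma CI_closed: "a \<in> CI f \<Longrightarrow> a \<in> carrier (A f)"
  using CI_center ring_center_closed by blast

text \<open>Two arrows of one coset with the same source differ by an isotropy element of
  \<open>D\<close> on the right, which fixes \<open>a\<close>. So the terms of a trace depend only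
  on the classes, not on the chosen representatives.\<close>

lemma \<alpha>_left_coset:
  assumes "a \<in> CI f" "\<sigma> \<in> ar" "sr \<sigma> = f" "\<tau> \<in> left_coset \<sigma>" "sr \<tau> = f"
  shows "\<alpha> \<tau> a = \<alpha> \<sigma> a"
proof -
  let ?\<delta> = "iv \<sigma> \<bullet> \<tau>"
  have t: "\<tau> \<in> ar" "tg \<tau> = tg \<sigma>" "?\<delta> \<in> D" using assms by (auto simp: left_coset_def)
  then have "?\<delta> \<in> hom_in G D f f" using assms by (simp add: hom_in_def)
  then have "\<alpha> ?\<delta> a = a" using assms(1) by (simp add: invariants_def)
  moreover have "\<alpha> \<sigma> (\<alpha> ?\<delta> a) = \<alpha> (\<sigma> \<bullet> ?\<delta>) a"
    using assms t CI_center by (intro \<alpha>_cmp_center) auto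
  ultimately show ?thesis using assms t by simp
qed

lemma \<alpha>_representative_translate:
  assumes "a \<in> CI f" "\<rho> \<in> ar" "\<tau> \<in> ar" "sr \<tau> = f" "sr \<rho> = tg \<tau>"
  shows "\<alpha> (representative (\<rho> \<bullet> \<tau>)) a = \<alpha> \<rho> (\<alpha> \<tau> a)"
proof -
  have "\<alpha> (representative (\<rho> \<bullet> \<tau>)) a = \<alpha> (\<rho> \<bullet> \<tau>) a"
    using assms representative_left_coset[of "\<rho> \<bullet> \<tau>"] src_representative[of "\<rho> \<bullet> \<tau>"]
        by (intro \<alpha>_left_coset) auto
  also have "\<dots> = \<alpha> \<rho> (\<alpha> \<tau> a)"
    using assms CI_center by (intro \<alpha>_cmp_center[symmetric]) auto
  finally show ?thesis .
qed

lemma TT_\<alpha>_closed: "a \<in> CI f \<Longrightarrow> \<tau> \<in> TT f e \<Longrightarrow> \<alpha> \<tau> a \<in> carrier (A e)"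
  using \<alpha>_closed[of \<tau> a] CI_closed[of a f] T_ar[of \<tau>] by (auto simp: TT_iff)

lemma tr_closed:
  assumes "a \<in> CI f" "e \<in> Obj G" shows "tr f e a \<in> carrier (A e)"
proof -
  interpret Ae: ring "A e" using assms ring_A by simp
  show ?thesis unfolding groupoid_trace_def using assms TT_\<alpha>_closed by (intro Ae.finsum_closed) auto
qed

text \<open>On central elements \<alpha> is an action, so applying \<rho> translates the arrows in
  the sum, and this only permutes the classes summed over.\<close>

lemma tr_translate:
  assumes "a \<in> CI f" "\<rho> \<in> ar"
  shows "\<alpha> \<rho> (tr f (sr \<rho>) a) = tr f (tg \<rho>) a"
proof -
  interpret Ae: ring "At \<rho>" using assms by simp
  let ?h = "\<lambda>\<tau>. representative (\<rho> \<bullet> \<tau>)"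
  note bij = bij_translate[OF assms(2), of f]
  have "\<alpha> \<rho> (tr f (sr \<rho>) a) = (\<Oplus>\<^bsub>At \<rho>\<^esub>\<tau>\<in>TT f (sr \<rho>). \<alpha> \<rho> (\<alpha> \<tau> a))"
    unfolding groupoid_trace_def using assms TT_\<alpha>_closed by (intro \<alpha>_finsum) auto
  also have "\<dots> = (\<Oplus>\<^bsub>At \<rho>\<^esub>\<tau>\<in>TT f (sr \<rho>). \<alpha> (?h \<tau>) a)"
  proof (rule Ae.finsum_cong'[OF refl])
    show "(\<lambda>\<tau>. \<alpha> (?h \<tau>) a) \<in> TT f (sr \<rho>) \<rightarrow> carrier (At \<rho>)"
      using bij_betw_apply[OF bij] TT_\<alpha>_closed[OF assms(1)] by auto
    show "\<alpha> \<rho> (\<alpha> \<tau> a) = \<alpha> (?h \<tau>) a" if "\<tau> \<in> TT f (sr \<rho>)" for \<tau>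
      using that assms T_ar[of \<tau>] by (intro \<alpha>_representative_translate[symmetric]) (auto simp: TT_iff)
  qed
  also have "\<dots> = (\<Oplus>\<^bsub>At \<rho>\<^esub>\<tau>\<in>?h ` TT f (sr \<rho>). \<alpha> \<tau> a)"
    using bij TT_\<alpha>_closed[OF assms(1)]
    by (intro Ae.finsum_reindex[symmetric]) (auto simp: bij_betw_def)
  also have "\<dots> = tr f (tg \<rho>) a"
    unfolding groupoid_trace_def using bij by (simp add: bij_betw_def)
  finally show ?thesis .
qed

section \<open>Construction of the separability tensors\<close>

lemma mult_eq_zero:
  assumes "x \<in> carrier CP" "y \<in> carrier CP"
    and "\<And>\<sigma> \<tau>. \<lbrakk>\<sigma> \<in> supp x; \<tau> \<in> supp y\<rbrakk> \<Longrightarrow> sr \<sigma> \<noteq> tg \<tau>"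
  shows "x \<star> y = \<zero>\<^bsub>CP\<^esub>"
proof (rule CP_eqI)
  fix \<rho> assume \<rho>: "\<rho> \<in> ar"
  have "\<rho> \<notin> supp (x \<star> y)"
    using supp_mult[of x y] assms(3) by blast
  then show "(x \<star> y) \<rho> = \<zero>\<^bsub>CP\<^esub> \<rho>"
    using \<rho> not_supp by (simp add: zero_coeff)
qed (use assms in auto)

lemma monomial_eq_Obj_mult:
  assumes "\<tau> \<in> ar" "c \<in> carrier (At \<tau>)"
  shows "monomial \<tau> c = monomial (tg \<tau>) c \<star> basis \<tau>"
proof -
  interpret Ae: ring "At \<tau>" using assms by simp
  show ?thesis
    using assms O1[of "tg \<tau>" "\<one>\<^bsub>At \<tau>\<^esub>"] O2[of \<tau>]
    unfolding basis_def by (subst monomial_mult_monomial) auto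
qed

lemma monomial_central_commute:
  assumes "\<rho> \<in> ar" "b \<in> carrier (At \<rho>)" "c \<in> ring_center (A (sr \<rho>))"
  shows "monomial \<rho> b \<star> monomial (sr \<rho>) c = monomial (tg \<rho>) (\<alpha> \<rho> c) \<star> monomial \<rho> b"
proof -
  interpret Ae: ring "At \<rho>" using assms by simp
  have c: "c \<in> carrier (A (sr \<rho>))" using assms ring_center_closed by blast
  have \<alpha>c: "\<alpha> \<rho> c \<in> carrier (At \<rho>)" using assms c by simp
  have comm: "b \<otimes>\<^bsub>At \<rho>\<^esub> \<alpha> \<rho> c = \<alpha> \<rho> c \<otimes>\<^bsub>At \<rho>\<^esub> b"
    using \<alpha>_center[OF assms(1,3)] assms(2) by (simp add: ring_center_def)
  have "monomial \<rho> b \<star> monomial (sr \<rho>) c = monomial \<rho> (b \<otimes>\<^bsub>At \<rho>\<^esub> \<alpha> \<rho> c)"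
    using assms c \<alpha>c O2[of \<rho>] by (subst monomial_mult_monomial) auto
  moreover have "monomial (tg \<rho>) (\<alpha> \<rho> c) \<star> monomial \<rho> b = monomial \<rho> (\<alpha> \<rho> c \<otimes>\<^bsub>At \<rho>\<^esub> b)"
    using assms \<alpha>c O1[of "tg \<rho>" b] O2[of \<rho>] by (subst monomial_mult_monomial) auto
  ultimately show ?thesis using comm by simp
qed

definition sep_term :: "'a \<Rightarrow> 'g \<Rightarrow> (('g \<Rightarrow> 'a) \<times> ('g \<Rightarrow> 'a)) \<Rightarrow>\<^sub>0 int" where
  "sep_term a \<tau> = frag_of (monomial \<tau> (\<alpha> \<tau> a), basis_inv \<tau>)"

lemma sep_term_FA: "a \<in> carrier (A (sr \<tau>)) \<Longrightarrow> \<tau> \<in> ar \<Longrightarrow> sep_term a \<tau> \<in> ext.FA"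
  unfolding sep_term_def by (rule ext.FA_of) auto

text \<open>
  Moving \<open>s = v\<^sub>\<upsilon> r u\<^sub>\<tau>\<close>, which lies in the subring, across the tensor sign
  turns \<open>r u\<^sub>\<tau> \<otimes> v\<^sub>\<tau> = u\<^sub>\<upsilon> s \<otimes> v\<^sub>\<tau>\<close> into \<open>u\<^sub>\<upsilon> \<otimes> v\<^sub>\<upsilon> r\<close>.
\<close>

lemma sep_term_commute:
  assumes a: "a \<in> CI f" and \<tau>: "\<tau> \<in> ar" "sr \<tau> = f"
    and r: "\<rho> \<in> ar" "b \<in> carrier (At \<rho>)" "sr \<rho> = tg \<tau>"
  shows "ext.left_mul (monomial \<rho> b) (sep_term a \<tau>) \<approx>\<^sub>T ext.right_mul (monomial \<rho> b) (sep_term a (representative (\<rho> \<bullet> \<tau>)))"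
proof -
  let ?r = "monomial \<rho> b" let ?\<upsilon> = "representative (\<rho> \<bullet> \<tau>)"
  let ?c = "\<alpha> \<tau> a" let ?c' = "\<alpha> ?\<upsilon> a"
  note assoc = ext.m_assoc
  have rt: "\<rho> \<bullet> \<tau> \<in> ar" using \<tau> r by simp
  have \<upsilon>: "?\<upsilon> \<in> ar" "sr ?\<upsilon> = f" "tg ?\<upsilon> = tg \<rho>"
    using representative_ar[OF rt] src_representative[OF rt] trg_representative[OF rt] \<tau> r by auto
  have a': "a \<in> carrier (A f)" using a CI_closed by blast
  have c: "?c \<in> ring_center (At \<tau>)" "?c \<in> carrier (At \<tau>)"
    using \<alpha>_center[OF \<tau>(1)] CI_center[OF a] \<tau> ring_center_closed by auto
  have c': "?c' \<in> carrier (At \<rho>)"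
    using \<alpha>_closed[OF \<upsilon>(1)] a' \<upsilon> by simp
  have cc': "?c' = \<alpha> \<rho> ?c"
    using a r \<tau> by (intro \<alpha>_representative_translate) auto
  define s where "s = basis_inv ?\<upsilon> \<star> (?r \<star> basis \<tau>)"
  have CP: "?r \<in> carrier CP" "basis \<tau> \<in> carrier CP" "basis_inv \<tau> \<in> carrier CP" "basis ?\<upsilon> \<in> carrier CP"
    "basis_inv ?\<upsilon> \<in> carrier CP" "monomial (tg \<tau>) ?c \<in> carrier CP" "monomial (tg \<rho>) ?c' \<in> carrier CP"
    using r \<tau> \<upsilon> c c' by auto
  have "supp s \<subseteq> {iv ?\<upsilon> \<bullet> (\<rho> \<bullet> \<tau>)}"
  proof
    fix \<sigma> assume "\<sigma> \<in> supp s"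
    then obtain \<sigma>1 \<sigma>2 where s1: "\<sigma> = \<sigma>1 \<bullet> \<sigma>2" "\<sigma>1 \<in> supp (basis_inv ?\<upsilon>)" "\<sigma>2 \<in> supp (?r \<star> basis \<tau>)"
      unfolding s_def using supp_mult by blast
    from s1(3) obtain \<sigma>3 \<sigma>4 where "\<sigma>2 = \<sigma>3 \<bullet> \<sigma>4" "\<sigma>3 \<in> supp ?r" "\<sigma>4 \<in> supp (basis \<tau>)"
      using supp_mult by blast
    then show "\<sigma> \<in> {iv ?\<upsilon> \<bullet> (\<rho> \<bullet> \<tau>)}"
      using s1 supp_monomial unfolding basis_inv_def basis_def by blast
  qed
  \<comment> \<open>The representative lies in the coset of \<rho> \<tau>, so the only arrow that
    can support \<open>s\<close> belongs to \<open>D\<close>.\<close>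
  moreover have "iv ?\<upsilon> \<bullet> (\<rho> \<bullet> \<tau>) \<in> D"
    using left_coset_eq[OF rt representative_left_coset[OF rt]] left_coset_self[OF rt]
        by (auto simp: left_coset_def)
  ultimately have sS: "s \<in> SD"
    using CP by (auto simp: SD_iff s_def)
  have "?r \<star> monomial \<tau> ?c = ?r \<star> monomial (tg \<tau>) ?c \<star> basis \<tau>"
    using CP monomial_eq_Obj_mult[OF \<tau>(1) c(2)] by (simp add: assoc)
  also have "?r \<star> monomial (tg \<tau>) ?c = monomial (tg \<rho>) ?c' \<star> ?r"
    using monomial_central_commute[OF r(1,2), of ?c] c r cc' by simp
  \<comment> \<open>The local unit at the target of \<rho> is written as
    \<open>basis ?\<upsilon> \<star> basis_inv ?\<upsilon>\<close> in order to make \<open>s\<close>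
    appear.\<close>
  also have "\<dots> = monomial (tg \<rho>) ?c' \<star> (basis ?\<upsilon> \<star> basis_inv ?\<upsilon> \<star> ?r)"
    using basis_basis_inv[OF \<upsilon>(1)] \<upsilon>(3) monomial_cmp_trg(1)[OF r(1,2)] by simp
  also have "\<dots> \<star> basis \<tau> = (monomial (tg \<rho>) ?c' \<star> basis ?\<upsilon>) \<star> s"
    using CP by (simp add: assoc s_def)
  also have "monomial (tg \<rho>) ?c' \<star> basis ?\<upsilon> = monomial ?\<upsilon> ?c'"
    using monomial_eq_Obj_mult[of ?\<upsilon> ?c'] \<upsilon> c' by simp
  finally have rW: "?r \<star> monomial \<tau> ?c = monomial ?\<upsilon> ?c' \<star> s" .
  have "s \<star> basis_inv \<tau> = basis_inv ?\<upsilon> \<star> (?r \<star> (basis \<tau> \<star> basis_inv \<tau>))"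
    using CP by (simp add: assoc s_def)
  also have "\<dots> = basis_inv ?\<upsilon> \<star> ?r"
    using basis_basis_inv[OF \<tau>(1)] monomial_cmp_trg(2)[OF r(1,2)] r(3) by simp
  finally have sv: "s \<star> basis_inv \<tau> = basis_inv ?\<upsilon> \<star> ?r" .
  have "frag_of (monomial ?\<upsilon> ?c' \<star> s, basis_inv \<tau>) \<approx>\<^sub>T frag_of (monomial ?\<upsilon> ?c', s \<star> basis_inv \<tau>)"
    using sS CP c' \<upsilon> by (intro ext.tensor_eq_bal) auto
  then show ?thesis
    unfolding sep_term_def ext.left_mul_of ext.right_mul_of rW sv .
qed

lemma mu_sep_term:
  assumes "a \<in> CI f" "\<tau> \<in> TT f e"
  shows "ext.mu (sep_term a \<tau>) = monomial e (\<alpha> \<tau> a)"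
proof -
  have \<tau>: "\<tau> \<in> ar" "sr \<tau> = f" "tg \<tau> = e" using assms T_ar by (auto simp: TT_iff)
  have c: "\<alpha> \<tau> a \<in> carrier (At \<tau>)" using TT_\<alpha>_closed[OF assms] \<tau> by simp
  have e: "e \<in> Obj G" "tg e = e" using \<tau> trg_Obj[of \<tau>] by auto
  have m: "monomial e (\<alpha> \<tau> a) \<in> carrier CP" using e c \<tau> by simp
  have "ext.mu (sep_term a \<tau>) = monomial \<tau> (\<alpha> \<tau> a) \<star> basis_inv \<tau>"
    unfolding sep_term_def using \<tau> c by (subst ext.twisted_mult_of[OF ext.right_linear_id]) auto
  also have "\<dots> = monomial e (\<alpha> \<tau> a) \<star> (basis \<tau> \<star> basis_inv \<tau>)"
    using monomial_eq_Obj_mult[OF \<tau>(1) c] \<tau> m by (simp add: ext.m_assoc)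
  also have "\<dots> = monomial e (\<alpha> \<tau> a)"
    using basis_basis_inv[OF \<tau>(1)] monomial_cmp_trg(2)[of e "\<alpha> \<tau> a"] e \<tau> c by simp
  finally show ?thesis .
qed

lemma mu_sum_coeff:
  assumes "\<And>i. i \<in> I \<Longrightarrow> z i \<in> ext.FA" "\<rho> \<in> ar"
  shows "ext.mu (\<Sum>i\<in>I. z i) \<rho> = (\<Oplus>\<^bsub>At \<rho>\<^esub>i\<in>I. ext.mu (z i) \<rho>)"
proof -
  interpret Ae: ring "At \<rho>" using assms by simp
  have mc: "ext.mu w \<rho> \<in> carrier (At \<rho>)" if "w \<in> ext.FA" for w
    using ext.twisted_mult_closed[OF ext.right_linear_id that] assms(2) by simp
  have m0: "ext.mu 0 \<rho> = \<zero>\<^bsub>At \<rho>\<^esub>"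
    using assms(2) ext.twisted_mult_0[OF ext.right_linear_id] by (simp add: zero_coeff)
  show ?thesis
    using assms(1)
  proof (induction I rule: infinite_finite_induct)
    case (insert i I)
    have "ext.mu (sum z (insert i I)) = ext.mu (z i) \<boxplus> ext.mu (sum z I)"
      unfolding sum.insert[OF insert.hyps] using insert.prems
      by (intro ext.twisted_mult_add ext.right_linear_id ext.FA_sum) auto
    then have "ext.mu (sum z (insert i I)) \<rho> = ext.mu (z i) \<rho> \<oplus>\<^bsub>At \<rho>\<^esub> ext.mu (sum z I) \<rho>"
      using assms(2) by (simp add: add_coeff)
    also have "ext.mu (sum z I) \<rho> = (\<Oplus>\<^bsub>At \<rho>\<^esub>i\<in>I. ext.mu (z i) \<rho>)"
      using insert.prems by (intro insert.IH) auto
    finally have "ext.mu (sum z (insert i I)) \<rho> = ext.mu (z i) \<rho> \<oplus>\<^bsub>At \<rho>\<^esub> (\<Oplus>\<^bsub>At \<rho>\<^esub>i\<in>I. ext.mu (z i) \<rho>)" .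
    also have "\<dots> = (\<Oplus>\<^bsub>At \<rho>\<^esub>i\<in>insert i I. ext.mu (z i) \<rho>)"
      using insert.hyps insert.prems mc by (intro Ae.finsum_insert[symmetric] Pi_I) blast+
    finally show ?case .
  qed (simp_all add: m0)
qed

text \<open>The tensor at \<open>e\<close> is the sum of all \<open>sep_term (a f) \<tau>\<close>
  with \<tau> in \<open>T\<close> from \<open>f\<close> to \<open>e\<close>. The same elements
  \<open>a f\<close> are used at every object; this is what lets an arrow intertwine the tensors at
  its two ends.\<close>

lemma family_imp_separable:
  assumes F: "F \<subseteq> Obj G" and a: "\<And>f. f \<in> F \<Longrightarrow> a f \<in> CI f"
    and one: "\<And>e. e \<in> Obj G \<Longrightarrow> (\<Oplus>\<^bsub>A e\<^esub>f\<in>F. tr f e (a f)) = \<one>\<^bsub>A e\<^esub>"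
  shows "separable_extension CP SD"
proof -
  define \<xi> where "\<xi> e = (\<Sum>f\<in>F. \<Sum>\<tau>\<in>TT f e. sep_term (a f) \<tau>)" for e
  have TTar: "\<tau> \<in> ar" "sr \<tau> = f" "tg \<tau> = e" if "\<tau> \<in> TT f e" for \<tau> f e
    using that T_ar by (auto simp: TT_iff)
  have term_FA: "sep_term (a f) \<tau> \<in> ext.FA" if "f \<in> F" "\<tau> \<in> TT f e" for f \<tau> e
    using TTar[OF that(2)] a[OF that(1)] CI_closed by (intro sep_term_FA) auto
  have \<xi>FA: "\<xi> e \<in> ext.FA" for e
    unfolding \<xi>_def by (intro ext.FA_sum term_FA)
  have comm: "ext.left_mul (monomial \<rho> b) (\<xi> (sr \<rho>)) \<approx>\<^sub>T ext.right_mul (monomial \<rho> b) (\<xi> (tg \<rho>))"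
    if \<rho>: "\<rho> \<in> ar" "b \<in> carrier (At \<rho>)" for \<rho> b
  proof -
    have "(\<Sum>f\<in>F. \<Sum>\<tau>\<in>TT f (sr \<rho>). ext.left_mul (monomial \<rho> b) (sep_term (a f) \<tau>))
        \<approx>\<^sub>T (\<Sum>f\<in>F. \<Sum>\<tau>\<in>TT f (sr \<rho>). ext.right_mul (monomial \<rho> b) (sep_term (a f) (representative (\<rho> \<bullet> \<tau>))))"
      using \<rho> a TTar by (intro ext.tensor_eq_sum sep_term_commute) auto
    \<comment> \<open>Translation by \<rho> matches the slice of \<open>T\<close> over the source
      with the one over the target, so the sum becomes the tensor at the target.\<close>
    moreover have "(\<Sum>f\<in>F. \<Sum>\<tau>\<in>TT f (sr \<rho>). ext.right_mul (monomial \<rho> b) (sep_term (a f) (representative (\<rho> \<bullet> \<tau>)))) =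
        (\<Sum>f\<in>F. \<Sum>\<tau>\<in>TT f (tg \<rho>). ext.right_mul (monomial \<rho> b) (sep_term (a f) \<tau>))"
      using \<rho> by (intro sum.cong refl sum.reindex_bij_betw bij_translate)
    ultimately show ?thesis
      unfolding \<xi>_def ext.left_mul_sum ext.right_mul_sum by (simp only:)
  qed
  have zeroL: "ext.left_mul x (\<xi> e) \<approx>\<^sub>T 0" if x: "x \<in> carrier CP" "e \<notin> sr ` supp x" for x e
  proof -
    have "ext.left_mul x (sep_term (a f) \<tau>) \<approx>\<^sub>T 0" if t: "f \<in> F" "\<tau> \<in> TT f e" for f \<tau>
    proof -
      let ?m = "monomial \<tau> (\<alpha> \<tau> (a f))"
      have c: "\<alpha> \<tau> (a f) \<in> carrier (At \<tau>)" using TTar[OF t(2)] TT_\<alpha>_closed[OF a[OF t(1)] t(2)] by simp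
      have "x \<star> ?m = \<zero>\<^bsub>CP\<^esub>"
      proof (rule mult_eq_zero)
        show "sr \<sigma> \<noteq> tg \<tau>'" if "\<sigma> \<in> supp x" "\<tau>' \<in> supp ?m" for \<sigma> \<tau>'
        proof -
          have "\<tau>' = \<tau>" using that(2) supp_monomial by blast
          then show ?thesis using that(1) x(2) TTar(3)[OF t(2)] by (metis image_eqI)
        qed
      qed (use x(1) c TTar(1)[OF t(2)] in auto)
      then show ?thesis
        using TTar[OF t(2)] by (simp add: sep_term_def ext.tensor_eq_zero_left)
    qed
    then have "(\<Sum>f\<in>F. \<Sum>\<tau>\<in>TT f e. ext.left_mul x (sep_term (a f) \<tau>)) \<approx>\<^sub>T (\<Sum>f\<in>F. \<Sum>\<tau>\<in>TT f e. 0)"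
      by (intro ext.tensor_eq_sum)
    then show ?thesis by (simp add: \<xi>_def ext.left_mul_sum)
  qed
  have zeroR: "ext.right_mul x (\<xi> e) \<approx>\<^sub>T 0" if x: "x \<in> carrier CP" "e \<notin> tg ` supp x" for x e
  proof -
    have "ext.right_mul x (sep_term (a f) \<tau>) \<approx>\<^sub>T 0" if t: "f \<in> F" "\<tau> \<in> TT f e" for f \<tau>
    proof -
      let ?m = "monomial \<tau> (\<alpha> \<tau> (a f))"
      have c: "\<alpha> \<tau> (a f) \<in> carrier (At \<tau>)" using TTar[OF t(2)] TT_\<alpha>_closed[OF a[OF t(1)] t(2)] by simp
      have "basis_inv \<tau> \<star> x = \<zero>\<^bsub>CP\<^esub>"
      proof (rule mult_eq_zero)
        show "sr \<sigma> \<noteq> tg \<tau>'" if "\<sigma> \<in> supp (basis_inv \<tau>)" "\<tau>' \<in> supp x" for \<sigma> \<tau>'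
        proof -
          have "\<sigma> = iv \<tau>" using that(1) supp_monomial unfolding basis_inv_def by blast
          then have "sr \<sigma> = e" using TTar[OF t(2)] by simp
          then show ?thesis using that(2) x(2) by (metis image_eqI)
        qed
      qed (use x(1) TTar(1)[OF t(2)] in auto)
      then show ?thesis
        using TTar[OF t(2)] c by (simp add: sep_term_def ext.tensor_eq_zero_right)
    qed
    then have "(\<Sum>f\<in>F. \<Sum>\<tau>\<in>TT f e. ext.right_mul x (sep_term (a f) \<tau>)) \<approx>\<^sub>T (\<Sum>f\<in>F. \<Sum>\<tau>\<in>TT f e. 0)"
      by (intro ext.tensor_eq_sum)
    then show ?thesis by (simp add: \<xi>_def ext.right_mul_sum)
  qed
  \<comment> \<open>For a monomial over \<rho> only the summand at the source survives on the left,
    and only the one at the target on the right; \<open>comm\<close> identifies the two, so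
    \<open>E\<close> contains both ends.\<close>
  have central: "ext.left_mul x (\<Sum>e\<in>E. \<xi> e) \<approx>\<^sub>T ext.right_mul x (\<Sum>e\<in>E. \<xi> e)"
    if E: "finite E" and x: "x \<in> carrier CP" "supp x \<subseteq> {\<sigma>. sr \<sigma> \<in> E \<and> tg \<sigma> \<in> E}" for x E
    using x
  proof (induction rule: CP_induct)
    case zero
    have "sum \<xi> E \<in> ext.FA" by (intro ext.FA_sum \<xi>FA)
    then show ?case
      using ext.tensor_eq_trans[OF ext.left_mul_zero ext.tensor_eq_sym[OF ext.right_mul_zero]] by blast
  next
    case (add x y)
    have FA: "sum \<xi> E \<in> ext.FA" by (intro ext.FA_sum \<xi>FA)
    have "ext.left_mul (x \<boxplus> y) (sum \<xi> E) \<approx>\<^sub>T ext.left_mul x (sum \<xi> E) + ext.left_mul y (sum \<xi> E)"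
      by (intro ext.left_mul_plus add FA)
    moreover have "ext.left_mul x (sum \<xi> E) + ext.left_mul y (sum \<xi> E) \<approx>\<^sub>T ext.right_mul x (sum \<xi> E) + ext.right_mul y (sum \<xi> E)"
      by (intro ext.tensor_eq_add add)
    moreover have "ext.right_mul x (sum \<xi> E) + ext.right_mul y (sum \<xi> E) \<approx>\<^sub>T ext.right_mul (x \<boxplus> y) (sum \<xi> E)"
      by (intro ext.tensor_eq_sym[OF ext.right_mul_plus] add FA)
    ultimately show ?case
      by (rule ext.tensor_eq_trans[OF ext.tensor_eq_trans])
  next
    case (mono \<rho> b)
    let ?r = "monomial \<rho> b"
    have r: "?r \<in> carrier CP" "supp ?r \<subseteq> {\<rho>}" using mono supp_monomial by auto
    have "(\<Sum>e\<in>E. ext.left_mul ?r (\<xi> e)) \<approx>\<^sub>T (\<Sum>e\<in>E. if e = sr \<rho> then ext.left_mul ?r (\<xi> (sr \<rho>)) else 0)"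
    proof (rule ext.tensor_eq_sum)
      fix e
      show "ext.left_mul ?r (\<xi> e) \<approx>\<^sub>T (if e = sr \<rho> then ext.left_mul ?r (\<xi> (sr \<rho>)) else 0)"
        using zeroL[OF r(1), of e] r(2) ext.tensor_eq_refl by (cases "e = sr \<rho>") auto
    qed
    moreover have "(\<Sum>e\<in>E. if e = sr \<rho> then ext.left_mul ?r (\<xi> (sr \<rho>)) else 0) = ext.left_mul ?r (\<xi> (sr \<rho>))"
      using E mono by simp
    ultimately have left: "ext.left_mul ?r (sum \<xi> E) \<approx>\<^sub>T ext.left_mul ?r (\<xi> (sr \<rho>))"
      unfolding ext.left_mul_sum by (simp only:)
    have "(\<Sum>e\<in>E. ext.right_mul ?r (\<xi> e)) \<approx>\<^sub>T (\<Sum>e\<in>E. if e = tg \<rho> then ext.right_mul ?r (\<xi> (tg \<rho>)) else 0)"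
    proof (rule ext.tensor_eq_sum)
      fix e
      show "ext.right_mul ?r (\<xi> e) \<approx>\<^sub>T (if e = tg \<rho> then ext.right_mul ?r (\<xi> (tg \<rho>)) else 0)"
        using zeroR[OF r(1), of e] r(2) ext.tensor_eq_refl by (cases "e = tg \<rho>") auto
    qed
    moreover have "(\<Sum>e\<in>E. if e = tg \<rho> then ext.right_mul ?r (\<xi> (tg \<rho>)) else 0)
        = ext.right_mul ?r (\<xi> (tg \<rho>))"
      using E mono by simp
    ultimately have right: "ext.right_mul ?r (sum \<xi> E) \<approx>\<^sub>T ext.right_mul ?r (\<xi> (tg \<rho>))"
      unfolding ext.right_mul_sum by (simp only:)
    show ?case
      by (rule ext.tensor_eq_trans[OF left ext.tensor_eq_trans[OF comm[OF mono(2,3)] ext.tensor_eq_sym[OF right]]])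
  qed
  \<comment> \<open>Each term multiplies out to \<open>\<alpha> \<tau> (a f)\<close> at the identity
    \<open>e\<close>, so the coefficient there is the sum of the traces.\<close>
  have mu\<xi>: "ext.mu (\<xi> e) = basis e" if e: "e \<in> Obj G" for e
  proof (rule CP_eqI)
    show "ext.mu (\<xi> e) \<in> carrier CP"
      by (intro ext.twisted_mult_closed ext.right_linear_id \<xi>FA)
    show "basis e \<in> carrier CP" using e by simp
    fix \<rho> assume \<rho>: "\<rho> \<in> ar"
    interpret Ae: ring "At \<rho>" using \<rho> by simp
    have mu_term: "ext.mu (sep_term (a f) \<tau>) \<rho> = (if \<rho> = e then \<alpha> \<tau> (a f) else \<zero>\<^bsub>At \<rho>\<^esub>)"
      if "f \<in> F" "\<tau> \<in> TT f e" for f \<tau>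
      using mu_sep_term[OF a[OF that(1)] that(2)] \<rho> by (simp add: monomial_coeff)
    have "ext.mu (\<xi> e) \<rho> = (\<Oplus>\<^bsub>At \<rho>\<^esub>f\<in>F. \<Oplus>\<^bsub>At \<rho>\<^esub>\<tau>\<in>TT f e. ext.mu (sep_term (a f) \<tau>) \<rho>)"
      unfolding \<xi>_def
    proof (subst mu_sum_coeff)
      show "(\<Oplus>\<^bsub>At \<rho>\<^esub>f\<in>F. ext.mu (\<Sum>\<tau>\<in>TT f e. sep_term (a f) \<tau>) \<rho>) =
          (\<Oplus>\<^bsub>At \<rho>\<^esub>f\<in>F. \<Oplus>\<^bsub>At \<rho>\<^esub>\<tau>\<in>TT f e. ext.mu (sep_term (a f) \<tau>) \<rho>)"
      proof (rule Ae.finsum_cong'[OF refl])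
        show "ext.mu (\<Sum>\<tau>\<in>TT f e. sep_term (a f) \<tau>) \<rho> = (\<Oplus>\<^bsub>At \<rho>\<^esub>\<tau>\<in>TT f e. ext.mu (sep_term (a f) \<tau>) \<rho>)"
            if "f \<in> F" for f
          using term_FA that \<rho> by (intro mu_sum_coeff)
        show "(\<lambda>f. \<Oplus>\<^bsub>At \<rho>\<^esub>\<tau>\<in>TT f e. ext.mu (sep_term (a f) \<tau>) \<rho>) \<in> F \<rightarrow> carrier (At \<rho>)"
        proof (intro Pi_I Ae.finsum_closed)
          fix f \<tau> assume "f \<in> F" "\<tau> \<in> TT f e"
          then show "ext.mu (sep_term (a f) \<tau>) \<rho> \<in> carrier (At \<rho>)"
            using coeff_closed[OF ext.twisted_mult_closed[OF ext.right_linear_id term_FA]] \<rho> by blast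
        qed
      qed
    qed (use term_FA \<rho> in \<open>auto intro!: ext.FA_sum[unfolded mem_Collect_eq]\<close>)
    also have "\<dots> = basis e \<rho>"
    proof (cases "\<rho> = e")
      case True
      have Aeq: "A e = At \<rho>" using True e by simp
      have "(\<Oplus>\<^bsub>At \<rho>\<^esub>\<tau>\<in>TT f e. ext.mu (sep_term (a f) \<tau>) \<rho>) = tr f e (a f)" if "f \<in> F" for f
        unfolding groupoid_trace_def Aeq
        using mu_term[OF that] True TT_\<alpha>_closed[OF a[OF that], of _ e] Aeq by (intro Ae.finsum_cong') auto
      then have "(\<Oplus>\<^bsub>At \<rho>\<^esub>f\<in>F. \<Oplus>\<^bsub>At \<rho>\<^esub>\<tau>\<in>TT f e. ext.mu (sep_term (a f) \<tau>) \<rho>) = (\<Oplus>\<^bsub>At \<rho>\<^esub>f\<in>F. tr f e (a f))"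
        using tr_closed[OF a e] Aeq by (intro Ae.finsum_cong') auto
      then show ?thesis
        using True one[OF e] e by (simp add: basis_def monomial_coeff)
    next
      case False
      have "(\<Oplus>\<^bsub>At \<rho>\<^esub>\<tau>\<in>TT f e. ext.mu (sep_term (a f) \<tau>) \<rho>) = \<zero>\<^bsub>At \<rho>\<^esub>" if "f \<in> F" for f
        using mu_term[OF that] False by (intro Ae.add.finprod_one_eqI) simp
      then have "(\<Oplus>\<^bsub>At \<rho>\<^esub>f\<in>F. \<Oplus>\<^bsub>At \<rho>\<^esub>\<tau>\<in>TT f e. ext.mu (sep_term (a f) \<tau>) \<rho>) = \<zero>\<^bsub>At \<rho>\<^esub>"
        by (rule Ae.add.finprod_one_eqI)
      then show ?thesis
        using False \<rho> by (simp add: basis_def monomial_coeff)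
    qed
    finally show "ext.mu (\<xi> e) \<rho> = basis e \<rho>" .
  qed
  \<comment> \<open>A partial sum multiplies out to a sum of local units, which keeps from
    \<open>x\<close> the arrows starting in \<open>E\<close>.\<close>
  have unit: "x \<star> ext.mu (\<Sum>e\<in>E. \<xi> e) = restriction {\<sigma>. sr \<sigma> \<in> E} x"
    if "finite E" "E \<subseteq> Obj G" "x \<in> carrier CP" for E x
    using that(1,2)
  proof (induction E)
    case empty
    have "ext.mu 0 = \<zero>\<^bsub>CP\<^esub>" using ext.twisted_mult_0[OF ext.right_linear_id] .
    then show ?case unfolding sum.empty using that(3) by (simp only: mult_zero) (simp add: restriction_none)
  next
    case (insert e E)
    have "ext.mu (\<Sum>e\<in>insert e E. \<xi> e) = ext.mu (\<xi> e) \<boxplus> ext.mu (\<Sum>e\<in>E. \<xi> e)"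
      unfolding sum.insert[OF insert.hyps]
          by (intro ext.twisted_mult_add ext.right_linear_id ext.FA_sum \<xi>FA)
    moreover have "ext.mu (\<xi> e) = basis e" using insert.prems by (intro mu\<xi>) auto
    moreover have "ext.mu (\<Sum>e\<in>E. \<xi> e) \<in> carrier CP"
      by (intro ext.twisted_mult_closed ext.right_linear_id ext.FA_sum \<xi>FA)
    moreover have "basis e \<in> carrier CP" "x \<star> basis e = restriction {\<sigma>. sr \<sigma> = e} x"
      using insert.prems that(3) by (auto simp: mult_basis_Obj)
    moreover have "x \<star> ext.mu (\<Sum>e\<in>E. \<xi> e) = restriction {\<sigma>. sr \<sigma> \<in> E} x"
      using insert.prems by (intro insert.IH) auto
    ultimately have "x \<star> ext.mu (\<Sum>e\<in>insert e E. \<xi> e) =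
        restriction {\<sigma>. sr \<sigma> = e} x \<boxplus> restriction {\<sigma>. sr \<sigma> \<in> E} x"
      using that(3) by (simp only: mult_r_distr)
    also have "\<dots> = restriction ({\<sigma>. sr \<sigma> = e} \<union> {\<sigma>. sr \<sigma> \<in> E}) x"
      using insert.hyps that(3) by (intro restriction_split[symmetric]) auto
    also have "{\<sigma>. sr \<sigma> = e} \<union> {\<sigma>. sr \<sigma> \<in> E} = {\<sigma>. sr \<sigma> \<in> insert e E}" by auto
    finally show ?case .
  qed
  show ?thesis
  \<comment> \<open>Sources serve the unit property, sources and targets together serve
    centrality.\<close>
  proof (rule ext.separable_local[where Ob = "Obj G" and \<xi> = \<xi> and E = "\<lambda>x. sr ` supp x \<union> tg ` supp x"])
    show "\<xi> e \<in> ext.FA" for e by (rule \<xi>FA)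
    show "finite (sr ` supp x \<union> tg ` supp x) \<and> sr ` supp x \<union> tg ` supp x \<subseteq> Obj G" if "x \<in> carrier CP" for x
      using that supp_ar[of x] by auto
    show "ext.left_mul x (\<xi> e) \<approx>\<^sub>T 0" if "x \<in> carrier CP" "e \<in> Obj G - (sr ` supp x \<union> tg ` supp x)" for x e
      using that by (intro zeroL) auto
    show "ext.left_mul x (\<Sum>e\<in>E'. \<xi> e) \<approx>\<^sub>T ext.right_mul x (\<Sum>e\<in>E'. \<xi> e)"
      if "x \<in> carrier CP" "finite E'" "sr ` supp x \<union> tg ` supp x \<subseteq> E'" for x E'
      using that by (intro central) auto
    show "x \<star> ext.mu (\<Sum>e\<in>sr ` supp x \<union> tg ` supp x. \<xi> e) = x" if "x \<in> carrier CP" for x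
      using that supp_ar[of x] by (subst unit) (auto intro!: restriction_all)
  qed
qed

end

section \<open>Indices, normal subgroupoids and twisted groupoid rings\<close>

locale connected_crossed_system = transversal_crossed_system G A \<alpha> \<beta> D T
  for G :: "'g groupoid_struct" and A :: "'g \<Rightarrow> 'a ring" and \<alpha> \<beta> D T +
  assumes connected: "connected_groupoid G"
begin

section \<open>Isotropy indices counted on the transversal\<close>

lemma obtain_arrow:
  assumes "e \<in> Obj G" "f \<in> Obj G"
  obtains \<rho> where "\<rho> \<in> ar" "sr \<rho> = e" "tg \<rho> = f"
  using connected assms unfolding connected_groupoid_def hom_in_def by blast

lemma representative_of_T: "\<tau> \<in> T \<Longrightarrow> representative \<tau> = \<tau>"
  using T_ar left_coset_self by (intro representative_unique) auto

lemma left_coset_T_eq: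
  assumes "\<tau> \<in> T" "\<tau>' \<in> T" "\<tau> \<in> left_coset \<tau>'" "sr \<tau> = sr \<tau>'"
  shows "\<tau> = \<tau>'"
  using representative_unique[OF T_ar[OF assms(2)] assms(1,3,4)] representative_of_T[OF assms(2)] by simp

lemma isotropy_coset_eq:
  assumes "g \<in> hom_in G ar f f"
  shows "hom_in G D f f #>\<^bsub>isotropy_group G f\<^esub> g = {k \<in> hom_in G ar f f. k \<bullet> iv g \<in> D}"
proof (intro equalityI subsetI)
  fix k assume "k \<in> hom_in G D f f #>\<^bsub>isotropy_group G f\<^esub> g"
  then obtain h where h: "h \<in> D" "sr h = f" "tg h = f" "k = h \<bullet> g"
    by (auto simp: r_coset_def isotropy_group_def hom_in_def)
  have g: "g \<in> ar" "sr g = f" "tg g = f" using assms by (auto simp: hom_in_def)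
  have "k \<bullet> iv g = h"
    using h g D_ar[OF h(1)] cmp_assoc[of h g "iv g"] cmp_src[of h] by simp
  then show "k \<in> {k \<in> hom_in G ar f f. k \<bullet> iv g \<in> D}"
    using h g D_ar[OF h(1)] by (simp add: hom_in_def)
next
  fix k assume k: "k \<in> {k \<in> hom_in G ar f f. k \<bullet> iv g \<in> D}"
  then have "k \<bullet> iv g \<in> hom_in G D f f" "k = (k \<bullet> iv g) \<bullet> g"
    using assms by (auto simp: hom_in_def)
  then show "k \<in> hom_in G D f f #>\<^bsub>isotropy_group G f\<^esub> g"
    unfolding r_coset_def isotropy_group_def by auto
qed

text \<open>Isotropy cosets are right cosets, whereas \<open>T\<close> represents left ones, so the
  correspondence inverts: \<tau> goes to the right coset of \<tau>^-1 \<sigma>. The set in the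
  statement is that coset, tested by multiplication with \<sigma>^-1 \<tau>.\<close>

lemma bij_isotropy_cosets:
  assumes \<sigma>: "\<sigma> \<in> ar" "sr \<sigma> = f" "tg \<sigma> = e"
  shows "bij_betw (\<lambda>\<tau>. {k \<in> hom_in G ar f f. k \<bullet> (iv \<sigma> \<bullet> \<tau>) \<in> D}) (TT f e) (isotropy_cosets G D f)"
proof -
  let ?C = "\<lambda>\<tau>. {k \<in> hom_in G ar f f. k \<bullet> (iv \<sigma> \<bullet> \<tau>) \<in> D}"
  have tt: "\<tau> \<in> ar" "sr \<tau> = f" "tg \<tau> = e" "\<tau> \<in> T" if "\<tau> \<in> TT f e" for \<tau>
    using that T_ar by (auto simp: TT_iff)
  have inj: "inj_on ?C (TT f e)"
  proof (rule inj_onI)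
    fix \<tau> \<tau>' assume t: "\<tau> \<in> TT f e" "\<tau>' \<in> TT f e" and eq: "?C \<tau> = ?C \<tau>'"
    note t1 = tt[OF t(1)] and t2 = tt[OF t(2)]
    \<comment> \<open>This element lies in the coset of \<tau>', and tested against \<tau> it yields
      \<tau>'^-1 \<tau>, the arrow that decides whether both lie in one left coset.\<close>
    let ?k = "iv \<tau>' \<bullet> \<sigma>"
    have "?k \<bullet> (iv \<sigma> \<bullet> \<tau>'') = iv \<tau>' \<bullet> \<tau>''" if "\<tau>'' \<in> ar" "tg \<tau>'' = e" for \<tau>''
      using that \<sigma> t2 cmp_assoc[of "iv \<tau>'" \<sigma> "iv \<sigma> \<bullet> \<tau>''"] by simp
    note k = this[OF t1(1,3)] this[OF t2(1,3)]
    have "iv \<tau>' \<bullet> \<tau>' \<in> D" using t2 Obj_D[of "sr \<tau>'"] src_Obj[of \<tau>'] by simp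
    then have "?k \<in> ?C \<tau>'"
      using \<sigma> t2 k(2) by (simp add: hom_in_def)
    then have "?k \<in> ?C \<tau>"
      unfolding eq .
    then have "iv \<tau>' \<bullet> \<tau> \<in> D"
      unfolding k(1)[symmetric] by blast
    then have "\<tau> \<in> left_coset \<tau>'"
      using t1 t2 by (simp add: left_coset_def)
    then show "\<tau> = \<tau>'"
      using left_coset_T_eq[OF t1(4) t2(4)] t1(2) t2(2) by simp
  qed
  have coset: "hom_in G D f f #>\<^bsub>isotropy_group G f\<^esub> (iv \<tau> \<bullet> \<sigma>) = ?C \<tau>"
      if "\<tau> \<in> ar" "sr \<tau> = f" "tg \<tau> = e" for \<tau>
    using that \<sigma> by (subst isotropy_coset_eq) (auto simp: hom_in_def)
  have cosets: "isotropy_cosets G D f = (\<lambda>g. hom_in G D f f #>\<^bsub>isotropy_group G f\<^esub> g) ` hom_in G ar f f"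
    by (auto simp: RCOSETS_def isotropy_group_def)
  have "?C ` TT f e = isotropy_cosets G D f"
    unfolding cosets
  proof (intro equalityI subsetI)
    fix c assume "c \<in> ?C ` TT f e"
    then obtain \<tau> where \<tau>: "\<tau> \<in> TT f e" "c = ?C \<tau>" by blast
    then have "c = hom_in G D f f #>\<^bsub>isotropy_group G f\<^esub> (iv \<tau> \<bullet> \<sigma>)"
      using coset tt by simp
    moreover have "iv \<tau> \<bullet> \<sigma> \<in> hom_in G ar f f"
      using tt[OF \<tau>(1)] \<sigma> by (simp add: hom_in_def)
    ultimately show "c \<in> (\<lambda>g. hom_in G D f f #>\<^bsub>isotropy_group G f\<^esub> g) ` hom_in G ar f f"
      by blast
  next
    fix c assume "c \<in> (\<lambda>g. hom_in G D f f #>\<^bsub>isotropy_group G f\<^esub> g) ` hom_in G ar f f"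
    then obtain g where g0: "g \<in> hom_in G ar f f" "c = hom_in G D f f #>\<^bsub>isotropy_group G f\<^esub> g" by blast
    then have g: "g \<in> ar" "sr g = f" "tg g = f" by (auto simp: hom_in_def)
    \<comment> \<open>Solving \<tau>^-1 \<sigma> = g for \<tau> gives this arrow; its representative
      in \<open>T\<close> is the preimage.\<close>
    let ?\<mu> = "\<sigma> \<bullet> iv g" let ?\<tau> = "representative ?\<mu>"
    have \<mu>: "?\<mu> \<in> ar" "sr ?\<mu> = f" "tg ?\<mu> = e" using g \<sigma> by auto
    have \<tau>: "?\<tau> \<in> ar" "sr ?\<tau> = f" "tg ?\<tau> = e" "?\<tau> \<in> TT f e"
      using \<mu> representative[OF \<mu>(1)] by (auto simp: TT_iff)
    let ?\<delta> = "g \<bullet> (iv \<sigma> \<bullet> ?\<tau>)"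
    have "?\<delta> = iv ?\<mu> \<bullet> ?\<tau>"
      using g \<sigma> \<tau> cmp_assoc[of g "iv \<sigma>" ?\<tau>] by simp
    then have \<delta>: "?\<delta> \<in> D"
      using representative_left_coset[OF \<mu>(1)] by (simp add: left_coset_def)
    have "k \<bullet> (iv \<sigma> \<bullet> ?\<tau>) \<in> D \<longleftrightarrow> k \<bullet> iv g \<in> D" if "k \<in> hom_in G ar f f" for k
    proof -
      have k: "k \<in> ar" "sr k = f" "tg k = f" using that by (auto simp: hom_in_def)
      have "(k \<bullet> iv g) \<bullet> ?\<delta> = k \<bullet> (iv \<sigma> \<bullet> ?\<tau>)"
        using k g \<sigma> \<tau> cmp_assoc[of k "iv g" ?\<delta>] by simp
      then show ?thesis
        using D_cmp_right_iff[OF \<delta>, of "k \<bullet> iv g"] k g \<sigma> \<tau> by simp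
    qed
    then have "?C ?\<tau> = c"
      using isotropy_coset_eq[OF g0(1)] g0(2) by auto
    then show "c \<in> ?C ` TT f e" using \<tau>(4) by blast
  qed
  then show ?thesis using inj by (simp add: bij_betw_def)
qed

text \<open>Connectedness supplies the auxiliary arrow from \<open>f\<close> to \<open>e\<close>.
  The size of the slice is thus the same for every target \<open>e\<close>.\<close>

lemma finite_index_TT:
  assumes "f \<in> Obj G" "e \<in> Obj G"
  shows "finite_index G D f \<longleftrightarrow> finite (TT f e)" and "index G D f = card (TT f e)"
proof -
  obtain \<sigma> where "\<sigma> \<in> ar" "sr \<sigma> = f" "tg \<sigma> = e" using obtain_arrow assms by blast
  note bij = bij_isotropy_cosets[OF this]
  show "finite_index G D f \<longleftrightarrow> finite (TT f e)"
    unfolding finite_index_def using bij_betw_finite[OF bij] by simp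
  show "index G D f = card (TT f e)"
    unfolding index_def using bij_betw_same_card[OF bij] by simp
qed

text \<open>An arrow from \<open>e\<close> to \<open>e'\<close> maps each trace at \<open>e\<close>
  to the trace of the same element at \<open>e'\<close>, and it preserves one.\<close>

lemma trace_one_translate:
  assumes a: "\<And>f. f \<in> F \<Longrightarrow> a f \<in> CI f" and e: "e \<in> Obj G" "e' \<in> Obj G"
    and one: "(\<Oplus>\<^bsub>A e\<^esub>f\<in>F. tr f e (a f)) = \<one>\<^bsub>A e\<^esub>"
  shows "(\<Oplus>\<^bsub>A e'\<^esub>f\<in>F. tr f e' (a f)) = \<one>\<^bsub>A e'\<^esub>"
proof -
  obtain \<rho> where \<rho>: "\<rho> \<in> ar" "sr \<rho> = e" "tg \<rho> = e'" using obtain_arrow e by blast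
  interpret Ae: ring "A e'" using e ring_A by simp
  have "(\<Oplus>\<^bsub>A e'\<^esub>f\<in>F. tr f e' (a f)) = (\<Oplus>\<^bsub>A e'\<^esub>f\<in>F. \<alpha> \<rho> (tr f e (a f)))"
  proof (rule Ae.finsum_cong'[OF refl])
    show "tr f e' (a f) = \<alpha> \<rho> (tr f e (a f))" if "f \<in> F" for f
      using tr_translate[OF a[OF that] \<rho>(1)] \<rho> by simp
    then show "(\<lambda>f. \<alpha> \<rho> (tr f e (a f))) \<in> F \<rightarrow> carrier (A e')"
      using tr_closed[OF a e(2)] by auto
  qed
  also have "\<dots> = \<alpha> \<rho> (\<Oplus>\<^bsub>A e\<^esub>f\<in>F. tr f e (a f))"
    using \<alpha>_finsum[OF \<rho>(1), of F "\<lambda>f. tr f e (a f)"] \<rho> tr_closed[OF a e(1)] by simp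
  also have "\<dots> = \<one>\<^bsub>A e'\<^esub>" using one \<alpha>_one[OF \<rho>(1)] \<rho> by simp
  finally show ?thesis .
qed

lemma separable_if_trace_one:
  assumes "F \<subseteq> Obj G" "\<And>f. f \<in> F \<Longrightarrow> a f \<in> CI f" "e \<in> Obj G"
    "(\<Oplus>\<^bsub>A e\<^esub>f\<in>F. tr f e (a f)) = \<one>\<^bsub>A e\<^esub>"
  shows "separable_extension CP SD"
  using assms trace_one_translate[OF assms(2,3) _ assms(4)] by (intro family_imp_separable) auto

text \<open>Every trace condition is then vacuous and no object can be chosen to start from, so the
  equivalences treat this case separately.\<close>

lemma separable_if_no_objects: "Obj G = {} \<Longrightarrow> separable_extension CP SD"
  by (rule family_imp_separable[of "{}"]) auto

section \<open>Connected components of \<open>D\<close> and the passage to traces\<close>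

definition linked :: "'g \<Rightarrow> 'g set" where
  "linked f = {g. \<exists>\<delta>\<in>D. sr \<delta> = f \<and> tg \<delta> = g}"

lemma linked_self: "f \<in> Obj G \<Longrightarrow> f \<in> linked f"
  unfolding linked_def using Obj_D by (intro CollectI bexI[of _ f]) auto

lemma linked_eq:
  assumes "g \<in> linked f" shows "linked g = linked f"
proof -
  obtain \<delta> where \<delta>: "\<delta> \<in> D" "sr \<delta> = f" "tg \<delta> = g" using assms by (auto simp: linked_def)
  have d: "\<delta> \<in> ar" "iv \<delta> \<in> D" using \<delta> D_ar D_ginv by auto
  have "\<exists>\<epsilon>\<in>D. sr \<epsilon> = f \<and> tg \<epsilon> = h" if "\<epsilon> \<in> D" "sr \<epsilon> = g" "tg \<epsilon> = h" for \<epsilon> h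
    using that \<delta> d D_ar[OF that(1)] by (intro bexI[of _ "\<epsilon> \<bullet> \<delta>"]) (auto intro!: D_cmp)
  moreover have "\<exists>\<epsilon>\<in>D. sr \<epsilon> = g \<and> tg \<epsilon> = h" if "\<epsilon> \<in> D" "sr \<epsilon> = f" "tg \<epsilon> = h" for \<epsilon> h
    using that \<delta> d D_ar[OF that(1)] by (intro bexI[of _ "\<epsilon> \<bullet> iv \<delta>"]) (auto intro!: D_cmp)
  ultimately show ?thesis unfolding linked_def by blast
qed

text \<open>
  A separability family is constant on cosets of \<open>D\<close>, so it is determined by its values at one
  object in each connected component of \<open>D\<close>.
\<close>

lemma separable_imp_trace:
  assumes sep: "separable_extension CP SD" and e: "e \<in> Obj G"
  shows "\<exists>F a. finite F \<and> F \<subseteq> Obj_fin G D \<and> (\<forall>f\<in>F. a f \<in> CI f) \<and>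
    (\<Oplus>\<^bsub>A e\<^esub>f\<in>F. tr f e (a f)) = \<one>\<^bsub>A e\<^esub>"
proof -
  interpret Ae: ring "A e" using e ring_A by simp
  from separable_imp_family[OF sep] obtain c where
    c_center: "\<And>\<sigma>. \<sigma> \<in> ar \<Longrightarrow> c \<sigma> \<in> ring_center (At \<sigma>)"
    and c_equi: "\<And>\<sigma> \<tau>. \<lbrakk>\<sigma> \<in> ar; \<tau> \<in> ar; sr \<tau> = tg \<sigma>\<rbrakk> \<Longrightarrow> c (\<tau> \<bullet> \<sigma>) = \<alpha> \<tau> (c \<sigma>)"
    and c_left_coset: "\<And>\<sigma> \<rho>. \<lbrakk>\<sigma> \<in> ar; \<rho> \<in> left_coset \<sigma>\<rbrakk> \<Longrightarrow> c \<rho> = c \<sigma>"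
    and c_sum: "\<And>e. e \<in> Obj G \<Longrightarrow> \<exists>Y. finite Y \<and> Y \<subseteq> {\<sigma> \<in> ar. tg \<sigma> = e} \<and> inj_on left_coset Y \<and>
       (\<forall>\<sigma>\<in>ar. tg \<sigma> = e \<longrightarrow> c \<sigma> \<noteq> \<zero>\<^bsub>A e\<^esub> \<longrightarrow> (\<exists>\<tau>\<in>Y. \<sigma> \<in> left_coset \<tau>)) \<and>
       (\<Oplus>\<^bsub>A e\<^esub>\<sigma>\<in>Y. c \<sigma>) = \<one>\<^bsub>A e\<^esub>" by blast
  obtain Y where Y: "finite Y" "Y \<subseteq> {\<sigma> \<in> ar. tg \<sigma> = e}" "inj_on left_coset Y"
    and cover: "\<And>\<sigma>. \<lbrakk>\<sigma> \<in> ar; tg \<sigma> = e; c \<sigma> \<noteq> \<zero>\<^bsub>A e\<^esub>\<rbrakk> \<Longrightarrow> \<exists>\<tau>\<in>Y. \<sigma> \<in> left_coset \<tau>"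
    and sum: "(\<Oplus>\<^bsub>A e\<^esub>\<sigma>\<in>Y. c \<sigma>) = \<one>\<^bsub>A e\<^esub>"
    using c_sum[OF e] by blast
  have c_closed: "c \<sigma> \<in> carrier (A (tg \<sigma>))" if "\<sigma> \<in> ar" for \<sigma>
    using c_center[OF that] ring_center_closed by blast
  \<comment> \<open>So the whole family is determined by its values at the identities.\<close>
  have c_arrow: "c \<tau> = \<alpha> \<tau> (c (sr \<tau>))" if "\<tau> \<in> ar" for \<tau>
    using c_equi[of "sr \<tau>" \<tau>] that by simp
  have c_CI: "c f \<in> CI f" if f: "f \<in> Obj G" for f
    unfolding invariants_def
  proof (intro CollectI conjI ballI)
    show "c f \<in> ring_center (A f)" using c_center[of f] f by simp
    fix \<delta> assume "\<delta> \<in> hom_in G D f f"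
    then have \<delta>: "\<delta> \<in> D" "sr \<delta> = f" "tg \<delta> = f" "\<delta> \<in> ar" using D_ar by (auto simp: hom_in_def)
    then have "\<delta> \<in> left_coset f" using f cmp_trg[of \<delta>] by (simp add: left_coset_def)
    \<comment> \<open>The isotropy element \<delta> lies in the coset of the identity
      \<open>f\<close>, so \<open>c\<close> agrees at both; equivariance computes the value at
      \<delta>.\<close>
    then show "\<alpha> \<delta> (c f) = c f" using c_arrow[of \<delta>] c_left_coset[of f \<delta>] f \<delta> by simp
  qed
  define Y0 where "Y0 = {y \<in> Y. c y \<noteq> \<zero>\<^bsub>A e\<^esub>}"
  have Y0: "finite Y0" "y \<in> Y0 \<Longrightarrow> y \<in> ar \<and> tg y = e \<and> y \<in> Y \<and> c y \<noteq> \<zero>\<^bsub>A e\<^esub>" for y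
    using Y by (auto simp: Y0_def)
  \<comment> \<open>Chosen from the component as a set, hence the same object for all its members:
    one object per component of \<open>D\<close>.\<close>
  define crep where "crep f = (SOME g. g \<in> linked f)" for f
  have crep: "crep f \<in> linked f" "linked (crep f) = linked f" if "f \<in> Obj G" for f
  proof -
    show "crep f \<in> linked f" unfolding crep_def using linked_self[OF that] by (rule someI)
    then show "linked (crep f) = linked f" by (rule linked_eq)
  qed
  \<comment> \<open>Only components that carry a nonzero coefficient enter, which makes
    \<open>F\<close> finite.\<close>
  define F where "F = (\<lambda>y. crep (sr y)) ` Y0"
  have F_Obj: "F \<subseteq> Obj G"
  proof
    fix f assume "f \<in> F"
    then obtain y where y: "y \<in> Y0" "f = crep (sr y)" by (auto simp: F_def)
    then have "f \<in> linked (sr y)" using crep(1)[of "sr y"] Y0(2)[of y] by simp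
    then show "f \<in> Obj G" using D_ar trg_Obj by (auto simp: linked_def)
  qed
  have F_crep: "crep f = f" if "f \<in> F" for f
  proof -
    from that obtain y where y: "y \<in> Y0" "f = crep (sr y)" unfolding F_def by blast
    then have "linked f = linked (sr y)" using crep(2)[of "sr y"] Y0(2) by auto
    then show ?thesis using y by (simp add: crep_def)
  qed
  \<comment> \<open>Moving the source of \<open>y\<close> along \<open>D\<close> to the chosen
    object stays inside the coset of \<open>y\<close>.\<close>
  have arrow: "\<exists>\<tau>\<in>TT (crep (sr y)) e. \<tau> \<in> left_coset y" if "y \<in> Y0" for y
  proof -
    have y: "y \<in> ar" "tg y = e" using Y0(2)[OF that] by auto
    obtain \<delta> where \<delta>: "\<delta> \<in> D" "sr \<delta> = sr y" "tg \<delta> = crep (sr y)"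
      using crep(1)[of "sr y"] y by (auto simp: linked_def)
    have d: "\<delta> \<in> ar" "iv \<delta> \<in> D" using \<delta> D_ar D_ginv by auto
    let ?\<mu> = "y \<bullet> iv \<delta>"
    have \<mu>: "?\<mu> \<in> ar" "sr ?\<mu> = crep (sr y)" "tg ?\<mu> = e" "?\<mu> \<in> left_coset y"
      using y \<delta> d by (auto simp: left_coset_def)
    then show ?thesis
      using representative[OF \<mu>(1)] left_coset_eq[OF y(1) \<mu>(4)]
          by (intro bexI[of _ "representative ?\<mu>"]) (auto simp: TT_iff)
  qed
  have tt: "\<tau> \<in> ar" "sr \<tau> = f" "tg \<tau> = e" "\<tau> \<in> T" if "\<tau> \<in> TT f e" for \<tau> f
    using that T_ar by (auto simp: TT_iff)
  \<comment> \<open>Since \<open>\<alpha> \<tau>\<close> is injective, a zero value at one arrow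
    from \<open>f\<close> forces \<open>c f\<close> to be zero. Then \<open>c\<close> vanishes at
    every arrow from \<open>f\<close>, in particular on the coset of the \<open>y\<close> that put
    \<open>f\<close> into \<open>F\<close>.\<close>
  have nonzero: "c \<tau> \<noteq> \<zero>\<^bsub>A e\<^esub>" if "f \<in> F" "\<tau> \<in> TT f e" for f \<tau>
  proof
    assume c0: "c \<tau> = \<zero>\<^bsub>A e\<^esub>"
    have f: "f \<in> Obj G" using F_Obj that by blast
    have "\<alpha> \<tau> (c f) = \<alpha> \<tau> \<zero>\<^bsub>A f\<^esub>"
      using c0 c_arrow[of \<tau>] tt[OF that(2)] \<alpha>_zero[of \<tau>] by simp
    then have cf: "c f = \<zero>\<^bsub>A f\<^esub>"
      using \<alpha>_bij[of \<tau>] tt[OF that(2)] c_closed[of f] At_simps(1)[of f] f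
      by (auto simp: bij_betw_def dest: inj_onD)
    from that(1) obtain y where y: "y \<in> Y0" "f = crep (sr y)" unfolding F_def by blast
    obtain \<tau>' where \<tau>': "\<tau>' \<in> TT f e" "\<tau>' \<in> left_coset y" using arrow[OF y(1)] y(2) by auto
    have "c y = c \<tau>'" using c_left_coset[of y \<tau>'] \<tau>' Y0(2)[OF y(1)] by simp
    also have "\<dots> = \<zero>\<^bsub>A e\<^esub>"
      using c_arrow[of \<tau>'] tt[OF \<tau>'(1)] cf \<alpha>_zero[of \<tau>'] by simp
    finally show False using Y0(2)[OF y(1)] by simp
  qed
  \<comment> \<open>Sends \<tau> to an element of \<open>Y\<close> in the same coset; it will be a
    bijection from the relevant part of \<open>T\<close> onto \<open>Y0\<close>.\<close>
  define \<kappa> where "\<kappa> \<tau> = (SOME y. y \<in> Y \<and> \<tau> \<in> left_coset y)" for \<tau>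
  have \<kappa>: "\<kappa> \<tau> \<in> Y0" "\<tau> \<in> left_coset (\<kappa> \<tau>)" "c (\<kappa> \<tau>) = c \<tau>" "left_coset (\<kappa> \<tau>) = left_coset \<tau>"
    if "f \<in> F" "\<tau> \<in> TT f e" for f \<tau>
  proof -
    have "\<exists>y. y \<in> Y \<and> \<tau> \<in> left_coset y"
      using cover[of \<tau>] tt[OF that(2)] nonzero[OF that] by blast
    then have k: "\<kappa> \<tau> \<in> Y \<and> \<tau> \<in> left_coset (\<kappa> \<tau>)" unfolding \<kappa>_def by (rule someI_ex)
    then have k': "\<kappa> \<tau> \<in> ar" using Y(2) by auto
    show "\<tau> \<in> left_coset (\<kappa> \<tau>)" using k ..
    show ck: "c (\<kappa> \<tau>) = c \<tau>" using c_left_coset[OF k'] k by simp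
    show "left_coset (\<kappa> \<tau>) = left_coset \<tau>" using left_coset_eq[OF k'] k by simp
    show "\<kappa> \<tau> \<in> Y0" using k ck nonzero[OF that] by (simp add: Y0_def)
  qed
  define U where "U = (\<Union>f\<in>F. TT f e)"
  have U: "\<exists>f. f \<in> F \<and> \<tau> \<in> TT f e" if "\<tau> \<in> U" for \<tau> using that by (auto simp: U_def)
  \<comment> \<open>Two arrows in one coset have sources in one component of \<open>D\<close>. With
    one object per component the sources agree, and \<open>T\<close> contains a single arrow of the
    class.\<close>
  have inj: "inj_on \<kappa> U"
  proof (rule inj_onI)
    fix \<tau> \<tau>' assume "\<tau> \<in> U" "\<tau>' \<in> U" and eq: "\<kappa> \<tau> = \<kappa> \<tau>'"
    then obtain f f' where f: "f \<in> F" "\<tau> \<in> TT f e" and f': "f' \<in> F" "\<tau>' \<in> TT f' e" using U by blast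
    note t = tt[OF f(2)] and t' = tt[OF f'(2)]
    have "left_coset \<tau> = left_coset \<tau>'" using \<kappa>(4)[OF f] \<kappa>(4)[OF f'] eq by simp
    then have mem: "\<tau> \<in> left_coset \<tau>'" using left_coset_self[OF t(1)] by simp
    then have "iv \<tau>' \<bullet> \<tau> \<in> D" by (simp add: left_coset_def)
    then have "f' \<in> linked f"
      unfolding linked_def using t t' by (intro CollectI bexI[of _ "iv \<tau>' \<bullet> \<tau>"]) auto
    then have "crep f' = crep f" using linked_eq[of f' f] by (simp add: crep_def)
    then have "f' = f" using F_crep f f' by simp
    then show "\<tau> = \<tau>'" using left_coset_T_eq[OF t(4) t'(4) mem] t(2) t'(2) by simp
  qed
  have surj: "\<kappa> ` U = Y0"
  proof (intro equalityI subsetI)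
    show "y \<in> Y0" if "y \<in> \<kappa> ` U" for y using that U \<kappa>(1) by blast
    fix y assume y: "y \<in> Y0"
    then obtain \<tau> where \<tau>: "\<tau> \<in> TT (crep (sr y)) e" "\<tau> \<in> left_coset y" using arrow by blast
    have f: "crep (sr y) \<in> F" using y by (simp add: F_def)
    have "left_coset (\<kappa> \<tau>) = left_coset y"
      using \<kappa>(4)[OF f \<tau>(1)] left_coset_eq[of y \<tau>] \<tau>(2) Y0(2)[OF y] by simp
    then have "\<kappa> \<tau> = y"
      using Y(3) \<kappa>(1)[OF f \<tau>(1)] y by (auto simp: Y0_def dest: inj_onD)
    moreover have "\<tau> \<in> U" using f \<tau> by (auto simp: U_def)
    ultimately show "y \<in> \<kappa> ` U" by blast
  qed
  \<comment> \<open>The origin of finite index: infinitely many classes from \<open>f\<close> would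
    give infinitely many cosets with nonzero coefficient.\<close>
  have finU: "finite U" using inj surj Y0(1) finite_imageD by metis
  have finF: "finite F" using Y0 by (simp add: F_def)
  have finTT: "finite (TT f e)" if "f \<in> F" for f
    using finU that by (auto simp: U_def intro: finite_subset)
  have Fin: "F \<subseteq> Obj_fin G D"
    unfolding Obj_fin_def using F_Obj finTT finite_index_TT(1)[OF _ e] by auto
  have cU: "c \<tau> \<in> carrier (A e)" if "\<tau> \<in> U" for \<tau>
  proof -
    from U[OF that] obtain f where "\<tau> \<in> TT f e" by blast
    from tt[OF this] show ?thesis using c_closed[of \<tau>] by simp
  qed
  have cY: "c y \<in> carrier (A e)" if "y \<in> Y" for y
    using Y(2) that c_closed[of y] by auto
  have "(\<Oplus>\<^bsub>A e\<^esub>f\<in>F. tr f e (c f)) = (\<Oplus>\<^bsub>A e\<^esub>f\<in>F. \<Oplus>\<^bsub>A e\<^esub>\<tau>\<in>TT f e. c \<tau>)"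
  proof (rule Ae.finsum_cong'[OF refl])
    have cT: "c \<tau> \<in> carrier (A e)" "\<alpha> \<tau> (c f) = c \<tau>" if "\<tau> \<in> TT f e" for f \<tau>
      using c_closed[of \<tau>] c_arrow[of \<tau>] tt[OF that] by auto
    show "tr f e (c f) = (\<Oplus>\<^bsub>A e\<^esub>\<tau>\<in>TT f e. c \<tau>)" if "f \<in> F" for f
      unfolding groupoid_trace_def by (intro Ae.finsum_cong'[OF refl] Pi_I cT)
    show "(\<lambda>f. \<Oplus>\<^bsub>A e\<^esub>\<tau>\<in>TT f e. c \<tau>) \<in> F \<rightarrow> carrier (A e)"
      by (intro Pi_I Ae.finsum_closed cT)
  qed
  also have "\<dots> = (\<Oplus>\<^bsub>A e\<^esub>\<tau>\<in>U. c \<tau>)"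
    unfolding U_def
  proof (rule Ae.add.finprod_UN_disjoint[symmetric])
    show "pairwise (\<lambda>i j. disjnt (TT i e) (TT j e)) F"
      by (auto simp: pairwise_def disjnt_def TT_iff)
  qed (use finF finTT cU in \<open>auto simp: U_def\<close>)
  also have "\<dots> = (\<Oplus>\<^bsub>A e\<^esub>\<tau>\<in>U. c (\<kappa> \<tau>))"
  proof (rule Ae.finsum_cong'[OF refl])
    show eq: "c \<tau> = c (\<kappa> \<tau>)" if "\<tau> \<in> U" for \<tau> using U[OF that] \<kappa>(3) by metis
    show "(\<lambda>\<tau>. c (\<kappa> \<tau>)) \<in> U \<rightarrow> carrier (A e)" using eq cU by auto
  qed
  also have "\<dots> = (\<Oplus>\<^bsub>A e\<^esub>y\<in>\<kappa> ` U. c y)"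
    using inj cY surj by (intro Ae.finsum_reindex[symmetric]) (auto simp: Y0_def)
  also have "\<dots> = (\<Oplus>\<^bsub>A e\<^esub>y\<in>Y. c y)"
    unfolding surj using Y(1) cY
    by (intro Ae.add.finprod_mono_neutral_cong_left) (auto simp: Y0_def)
  finally have "(\<Oplus>\<^bsub>A e\<^esub>f\<in>F. tr f e (c f)) = \<one>\<^bsub>A e\<^esub>" using sum by simp
  then show ?thesis
    using finF Fin c_CI F_Obj by (intro exI[of _ F] exI[of _ c]) auto
qed

lemma separable_iff_trace:
  "separable_extension CP SD \<longleftrightarrow>
     (\<forall>e\<in>Obj G. \<exists>F a. finite F \<and> F \<subseteq> Obj_fin G D \<and> (\<forall>f\<in>F. a f \<in> CI f) \<and>
        (\<Oplus>\<^bsub>A e\<^esub>f\<in>F. tr f e (a f)) = \<one>\<^bsub>A e\<^esub>)" (is "_ \<longleftrightarrow> ?r")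
proof
  assume "separable_extension CP SD"
  then show ?r using separable_imp_trace by blast
next
  assume r: ?r
  show "separable_extension CP SD"
  proof (cases "Obj G = {}")
    case False
    \<comment> \<open>The data may vary with the object, but the construction wants a single family;
      one object is fixed and its data are transported to the others.\<close>
    then obtain e where e: "e \<in> Obj G" by blast
    obtain F a where "F \<subseteq> Obj_fin G D" "\<forall>f\<in>F. a f \<in> CI f"
        "(\<Oplus>\<^bsub>A e\<^esub>f\<in>F. tr f e (a f)) = \<one>\<^bsub>A e\<^esub>"
      using r[rule_format, OF e] by blast
    then show ?thesis using e by (intro separable_if_trace_one[of F a e]) (auto simp: Obj_fin_def)
  qed (rule separable_if_no_objects)
qed

lemma separable_if_single_trace:
  assumes f: "f \<in> Obj G" and a: "a \<in> CI f" and one: "tr f f a = \<one>\<^bsub>A f\<^esub>"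
  shows "separable_extension CP SD"
proof (rule separable_if_trace_one[of "{f}" "\<lambda>_. a" f])
  interpret Ae: ring "A f" using f ring_A by simp
  show "(\<Oplus>\<^bsub>A f\<^esub>g\<in>{f}. tr g f a) = \<one>\<^bsub>A f\<^esub>"
    using tr_closed[OF a f] one by simp
qed (use f a in auto)

section \<open>Normal subgroupoids\<close>

lemma D_conj:
  assumes "normal_subgroupoid D G" "\<sigma> \<in> ar" "\<delta> \<in> D" "sr \<delta> = sr \<sigma>" "tg \<delta> = sr \<sigma>"
  shows "\<sigma> \<bullet> \<delta> \<bullet> iv \<sigma> \<in> D"
proof -
  have "\<sigma> \<in> hom_in G ar (sr \<sigma>) (tg \<sigma>)" "\<delta> \<in> hom_in G D (sr \<sigma>) (sr \<sigma>)"
    using assms by (auto simp: hom_in_def)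
  then have "\<sigma> \<bullet> \<delta> \<bullet> iv \<sigma> \<in> hom_in G D (tg \<sigma>) (tg \<sigma>)"
    using assms(1,2) unfolding normal_subgroupoid_def by (meson src_Obj trg_Obj)
  then show ?thesis by (simp add: hom_in_def)
qed

text \<open>Right translation respects isotropy classes when \<open>D\<close> is normal: an isotropy
  element of \<open>D\<close> relating two arrows is conjugated by \<sigma> into another such
  element.\<close>

lemma normal_representative_inverse:
  assumes n: "normal_subgroupoid D G" and \<sigma>: "\<sigma> \<in> ar" and \<tau>: "\<tau> \<in> T" "sr \<tau> = sr \<sigma>"
  shows "representative (representative (\<tau> \<bullet> iv \<sigma>) \<bullet> \<sigma>) = \<tau>"
proof -
  have t: "\<tau> \<in> ar" using \<tau> T_ar by blast
  let ?\<nu> = "\<tau> \<bullet> iv \<sigma>" let ?\<mu> = "representative ?\<nu>"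
  have \<nu>: "?\<nu> \<in> ar" "sr ?\<nu> = tg \<sigma>" "tg ?\<nu> = tg \<tau>" using \<sigma> \<tau> t by auto
  have \<mu>: "?\<mu> \<in> ar" "sr ?\<mu> = tg \<sigma>" "tg ?\<mu> = tg \<tau>" using representative[OF \<nu>(1)] \<nu> by auto
  have "?\<nu> \<in> left_coset ?\<mu>"
      using left_coset_eq[OF \<nu>(1) representative_left_coset[OF \<nu>(1)]] left_coset_self[OF \<nu>(1)] by simp
  then have d: "iv ?\<mu> \<bullet> ?\<nu> \<in> D" by (simp add: left_coset_def)
  have "iv \<sigma> \<bullet> (iv ?\<mu> \<bullet> ?\<nu>) \<bullet> iv (iv \<sigma>) \<in> D"
    using \<sigma> \<nu> \<mu> d by (intro D_conj[OF n]) auto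
  moreover have "iv \<sigma> \<bullet> (iv ?\<mu> \<bullet> ?\<nu>) \<bullet> iv (iv \<sigma>) = iv (?\<mu> \<bullet> \<sigma>) \<bullet> \<tau>"
    using \<sigma> \<tau> t \<mu> cmp_assoc[of "iv \<sigma>" "iv ?\<mu>" ?\<nu>] cmp_assoc[of "iv (?\<mu> \<bullet> \<sigma>)" ?\<nu> \<sigma>] by simp
  ultimately have "\<tau> \<in> left_coset (?\<mu> \<bullet> \<sigma>)"
    using \<sigma> t \<mu> by (simp add: left_coset_def)
  then show ?thesis using \<sigma> \<tau> \<mu> by (intro representative_unique) auto
qed

text \<open>Right translation changes the source of the classes, whereas
  \<open>bij_translate\<close> changes the target; through it finite index passes from one object to
  another.\<close>

lemma bij_normal:
  assumes n: "normal_subgroupoid D G" and \<sigma>: "\<sigma> \<in> ar"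
  shows "bij_betw (\<lambda>\<tau>. representative (\<tau> \<bullet> iv \<sigma>)) (TT (sr \<sigma>) e) (TT (tg \<sigma>) e)"
proof (rule bij_betw_byWitness[where f' = "\<lambda>\<tau>. representative (\<tau> \<bullet> \<sigma>)"])
  have *: "representative (\<tau> \<bullet> iv \<sigma>) \<in> TT (tg \<sigma>) e" if "\<sigma> \<in> ar" "\<tau> \<in> TT (sr \<sigma>) e" for \<sigma> \<tau>
    using that representative[of "\<tau> \<bullet> iv \<sigma>"] T_ar[of \<tau>] by (simp add: TT_iff)
  show "(\<lambda>\<tau>. representative (\<tau> \<bullet> iv \<sigma>)) ` TT (sr \<sigma>) e \<subseteq> TT (tg \<sigma>) e" using *[OF \<sigma>] by blast
  show "(\<lambda>\<tau>. representative (\<tau> \<bullet> \<sigma>)) ` TT (tg \<sigma>) e \<subseteq> TT (sr \<sigma>) e" using *[of "iv \<sigma>"] \<sigma> by auto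
  show "\<forall>\<tau>\<in>TT (sr \<sigma>) e. representative (representative (\<tau> \<bullet> iv \<sigma>) \<bullet> \<sigma>) = \<tau>"
    using normal_representative_inverse[OF n \<sigma>] by (auto simp: TT_iff)
  show "\<forall>\<tau>\<in>TT (tg \<sigma>) e. representative (representative (\<tau> \<bullet> \<sigma>) \<bullet> iv \<sigma>) = \<tau>"
    using normal_representative_inverse[OF n, of "iv \<sigma>"] \<sigma> by (auto simp: TT_iff)
qed

text \<open>For an isotropy element \<delta> of \<open>D\<close> at the target, \<delta> \<sigma> =
  \<sigma> \<epsilon> with \<epsilon> = \<sigma>^-1 \<delta> \<sigma> in \<open>D\<close> by
  normality, and \<epsilon> fixes \<open>a\<close>.\<close>

lemma normal_\<alpha>_CI:
  assumes n: "normal_subgroupoid D G" and \<sigma>: "\<sigma> \<in> ar" and a: "a \<in> CI (sr \<sigma>)"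
  shows "\<alpha> \<sigma> a \<in> CI (tg \<sigma>)"
  unfolding invariants_def
proof (intro CollectI conjI ballI)
  have ac: "a \<in> ring_center (A (sr \<sigma>))" using a CI_center by blast
  show "\<alpha> \<sigma> a \<in> ring_center (A (tg \<sigma>))" using \<alpha>_center[OF \<sigma> ac] .
  fix \<delta> assume "\<delta> \<in> hom_in G D (tg \<sigma>) (tg \<sigma>)"
  then have \<delta>: "\<delta> \<in> D" "sr \<delta> = tg \<sigma>" "tg \<delta> = tg \<sigma>" "\<delta> \<in> ar" using D_ar by (auto simp: hom_in_def)
  let ?\<epsilon> = "iv \<sigma> \<bullet> \<delta> \<bullet> iv (iv \<sigma>)"
  have "?\<epsilon> \<in> D" using \<delta> \<sigma> by (intro D_conj[OF n]) auto
  moreover have "iv \<sigma> \<bullet> (\<delta> \<bullet> \<sigma>) = ?\<epsilon>"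
    using \<delta> \<sigma> cmp_assoc[of "iv \<sigma>" \<delta> \<sigma>] by simp
  ultimately have "\<delta> \<bullet> \<sigma> \<in> left_coset \<sigma>" using \<delta> \<sigma> by (simp add: left_coset_def)
  then have "\<alpha> (\<delta> \<bullet> \<sigma>) a = \<alpha> \<sigma> a"
    using a \<sigma> \<delta> by (intro \<alpha>_left_coset) auto
  then show "\<alpha> \<delta> (\<alpha> \<sigma> a) = \<alpha> \<sigma> a"
    using \<alpha>_cmp_center[of \<delta> \<sigma> a] \<delta> \<sigma> ac by simp
qed

text \<open>Replacing \<tau> by \<tau> \<sigma>^-1 and \<open>a\<close> by its image under \<sigma>
  leaves every term unchanged, since \<alpha> is an action on centres. All traces can thus be moved
  to one object.\<close>

lemma normal_tr:
  assumes n: "normal_subgroupoid D G" and \<sigma>: "\<sigma> \<in> ar" and a: "a \<in> CI (sr \<sigma>)" and e: "e \<in> Obj G"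
  shows "tr (sr \<sigma>) e a = tr (tg \<sigma>) e (\<alpha> \<sigma> a)"
proof -
  interpret Ae: ring "A e" using e ring_A by simp
  let ?h = "\<lambda>\<tau>. representative (\<tau> \<bullet> iv \<sigma>)" let ?b = "\<alpha> \<sigma> a"
  note bij = bij_normal[OF n \<sigma>, of e]
  have b: "?b \<in> CI (tg \<sigma>)" using normal_\<alpha>_CI[OF n \<sigma> a] .
  have ac: "a \<in> ring_center (A (sr \<sigma>))" using a CI_center by blast
  have "tr (tg \<sigma>) e ?b = (\<Oplus>\<^bsub>A e\<^esub>\<tau>\<in>?h ` TT (sr \<sigma>) e. \<alpha> \<tau> ?b)"
    unfolding groupoid_trace_def using bij by (simp add: bij_betw_def)
  also have "\<dots> = (\<Oplus>\<^bsub>A e\<^esub>\<tau>\<in>TT (sr \<sigma>) e. \<alpha> (?h \<tau>) ?b)"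
    using bij TT_\<alpha>_closed[OF b] by (intro Ae.finsum_reindex) (auto simp: bij_betw_def)
  also have "\<dots> = tr (sr \<sigma>) e a"
    unfolding groupoid_trace_def
  proof (rule Ae.finsum_cong'[OF refl])
    show "(\<lambda>\<tau>. \<alpha> \<tau> a) \<in> TT (sr \<sigma>) e \<rightarrow> carrier (A e)" using TT_\<alpha>_closed[OF a] by auto
    fix \<tau> assume t0: "\<tau> \<in> TT (sr \<sigma>) e"
    then have t: "\<tau> \<in> ar" "sr \<tau> = sr \<sigma>" using T_ar by (auto simp: TT_iff)
    have "\<alpha> (?h \<tau>) ?b = \<alpha> (\<tau> \<bullet> iv \<sigma>) ?b"
      using t \<sigma> b representative[of "\<tau> \<bullet> iv \<sigma>"] by (intro \<alpha>_left_coset) auto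
    also have "\<dots> = \<alpha> (\<tau> \<bullet> iv \<sigma> \<bullet> \<sigma>) a" using t \<sigma> ac by (intro \<alpha>_cmp_center) auto
    finally show "\<alpha> (?h \<tau>) ?b = \<alpha> \<tau> a" using t \<sigma> by simp
  qed
  finally show ?thesis by simp
qed

lemma CI_zero: "e \<in> Obj G \<Longrightarrow> \<zero>\<^bsub>A e\<^esub> \<in> CI e"
proof -
  assume e: "e \<in> Obj G"
  interpret Ae: ring "A e" using e ring_A by simp
  have "\<alpha> \<delta> \<zero>\<^bsub>A e\<^esub> = \<zero>\<^bsub>A e\<^esub>" if "\<delta> \<in> hom_in G D e e" for \<delta>
    using that \<alpha>_zero[of \<delta>] D_ar[of \<delta>] by (auto simp: hom_in_def)
  then show ?thesis by (auto simp: invariants_def ring_center_def)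
qed

lemma CI_add:
  assumes e: "e \<in> Obj G" and x: "x \<in> CI e" and y: "y \<in> CI e"
  shows "x \<oplus>\<^bsub>A e\<^esub> y \<in> CI e"
proof -
  interpret Ae: ring "A e" using e ring_A by simp
  have c: "x \<in> carrier (A e)" "y \<in> carrier (A e)" using x y CI_closed by auto
  have "\<alpha> \<delta> (x \<oplus>\<^bsub>A e\<^esub> y) = x \<oplus>\<^bsub>A e\<^esub> y" if "\<delta> \<in> hom_in G D e e" for \<delta>
    using that \<alpha>_add[of \<delta> x y] D_ar[of \<delta>] c x y by (auto simp: hom_in_def invariants_def)
  moreover have "x \<oplus>\<^bsub>A e\<^esub> y \<in> ring_center (A e)"
    using x y c by (auto simp: invariants_def ring_center_def Ae.l_distr Ae.r_distr)
  ultimately show ?thesis by (simp add: invariants_def)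
qed

text \<open>Additivity of the trace, stated existentially; the witness is the sum of the
  \<open>b f\<close>, kept inside the central invariants along the induction.\<close>

lemma tr_sum_exists:
  assumes "finite F" "\<And>f. f \<in> F \<Longrightarrow> b f \<in> CI e" and e: "e \<in> Obj G"
  shows "\<exists>x\<in>CI e. tr e e x = (\<Oplus>\<^bsub>A e\<^esub>f\<in>F. tr e e (b f))"
proof -
  interpret Ae: ring "A e" using e ring_A by simp
  have tt: "\<tau> \<in> ar" "sr \<tau> = e" "tg \<tau> = e" if "\<tau> \<in> TT e e" for \<tau>
    using that T_ar by (auto simp: TT_iff)
  show ?thesis
    using assms(1,2)
  proof (induction F)
    case empty
    have "\<alpha> \<tau> \<zero>\<^bsub>A e\<^esub> = \<zero>\<^bsub>A e\<^esub>" if "\<tau> \<in> TT e e" for \<tau>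
      using \<alpha>_zero[of \<tau>] tt[OF that] by simp
    then have "tr e e \<zero>\<^bsub>A e\<^esub> = \<zero>\<^bsub>A e\<^esub>"
      unfolding groupoid_trace_def by (rule Ae.add.finprod_one_eqI)
    then show ?case using CI_zero[OF e] by (intro bexI[of _ "\<zero>\<^bsub>A e\<^esub>"]) auto
  next
    case (insert f F)
    then obtain x where x: "x \<in> CI e" "tr e e x = (\<Oplus>\<^bsub>A e\<^esub>f\<in>F. tr e e (b f))" by blast
    have b: "b f \<in> CI e" using insert.prems by simp
    have c: "b f \<in> carrier (A e)" "x \<in> carrier (A e)" using b x CI_closed by auto
    have "tr e e (b f \<oplus>\<^bsub>A e\<^esub> x) = (\<Oplus>\<^bsub>A e\<^esub>\<tau>\<in>TT e e. \<alpha> \<tau> (b f) \<oplus>\<^bsub>A e\<^esub> \<alpha> \<tau> x)"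
      unfolding groupoid_trace_def
    proof (rule Ae.finsum_cong'[OF refl])
      show "\<alpha> \<tau> (b f \<oplus>\<^bsub>A e\<^esub> x) = \<alpha> \<tau> (b f) \<oplus>\<^bsub>A e\<^esub> \<alpha> \<tau> x" if "\<tau> \<in> TT e e" for \<tau>
        using \<alpha>_add[of \<tau> "b f" x] tt[OF that] c by simp
      show "(\<lambda>\<tau>. \<alpha> \<tau> (b f) \<oplus>\<^bsub>A e\<^esub> \<alpha> \<tau> x) \<in> TT e e \<rightarrow> carrier (A e)"
        using TT_\<alpha>_closed[OF b] TT_\<alpha>_closed[OF x(1)] by auto
    qed
    also have "\<dots> = tr e e (b f) \<oplus>\<^bsub>A e\<^esub> tr e e x"
      unfolding groupoid_trace_def using TT_\<alpha>_closed[OF b] TT_\<alpha>_closed[OF x(1)]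
      by (intro Ae.finsum_addf) auto
    also have "\<dots> = (\<Oplus>\<^bsub>A e\<^esub>f\<in>insert f F. tr e e (b f))"
      unfolding x(2) using insert.hyps insert.prems tr_closed[OF _ e]
      by (intro Ae.finsum_insert[symmetric] Pi_I) auto
    finally show ?case using CI_add[OF e b x(1)] by blast
  qed
qed

lemma separable_iff_normal:
  assumes n: "normal_subgroupoid D G"
  shows "separable_extension CP SD \<longleftrightarrow>
    (\<forall>e\<in>Obj G. finite_index G D e \<and> (\<exists>a\<in>CI e. tr e e a = \<one>\<^bsub>A e\<^esub>))" (is "_ \<longleftrightarrow> ?r")
proof
  assume sep: "separable_extension CP SD"
  show ?r
  proof (intro ballI)
    fix e assume e: "e \<in> Obj G"
    interpret Ae: ring "A e" using e ring_A by simp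
    obtain F a where F: "finite F" "F \<subseteq> Obj_fin G D" "\<forall>f\<in>F. a f \<in> CI f"
        and one: "(\<Oplus>\<^bsub>A e\<^esub>f\<in>F. tr f e (a f)) = \<one>\<^bsub>A e\<^esub>"
      using separable_imp_trace[OF sep e] by blast
    \<comment> \<open>An empty sum would be zero, which differs from one; so at least one object of
      finite index exists.\<close>
    have "F \<noteq> {}" using one one_neq_zero[OF e] by auto
    have FO: "f \<in> Obj G" "finite_index G D f" if "f \<in> F" for f
      using F(2) that by (auto simp: Obj_fin_def)
    have "\<exists>\<sigma>. \<sigma> \<in> ar \<and> sr \<sigma> = f \<and> tg \<sigma> = e" if "f \<in> F" for f
      using obtain_arrow[OF FO(1)[OF that] e] by blast
    \<comment> \<open>The arrows \<open>s f\<close> carry all the elements \<open>a f\<close> to the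
      object \<open>e\<close>, where their traces combine into the trace of one element.\<close>
    then obtain s where s: "\<And>f. f \<in> F \<Longrightarrow> s f \<in> ar \<and> sr (s f) = f \<and> tg (s f) = e" by metis
    have "finite_index G D e"
    proof -
      obtain f where f: "f \<in> F" using \<open>F \<noteq> {}\<close> by blast
      have "finite (TT f e)" using finite_index_TT(1)[OF FO(1)[OF f] e] FO(2)[OF f] by simp
      then have "finite (TT e e)"
        using bij_betw_finite[OF bij_normal[OF n, of "s f" e]] s[OF f] by simp
      then show ?thesis using finite_index_TT(1)[OF e e] by simp
    qed
    moreover have b: "\<alpha> (s f) (a f) \<in> CI e" if "f \<in> F" for f
      using normal_\<alpha>_CI[OF n, of "s f" "a f"] s[OF that] F(3) that by simp
    moreover have "(\<Oplus>\<^bsub>A e\<^esub>f\<in>F. tr e e (\<alpha> (s f) (a f))) = \<one>\<^bsub>A e\<^esub>"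
    proof -
      have "(\<Oplus>\<^bsub>A e\<^esub>f\<in>F. tr e e (\<alpha> (s f) (a f))) = (\<Oplus>\<^bsub>A e\<^esub>f\<in>F. tr f e (a f))"
      proof (rule Ae.finsum_cong'[OF refl])
        show "(\<lambda>f. tr f e (a f)) \<in> F \<rightarrow> carrier (A e)" using F(3) tr_closed[OF _ e] by auto
        show "tr e e (\<alpha> (s f) (a f)) = tr f e (a f)" if "f \<in> F" for f
          using normal_tr[OF n, of "s f" "a f" e] s[OF that] F(3) that e by simp
      qed
      then show ?thesis using one by simp
    qed
    ultimately show "finite_index G D e \<and> (\<exists>a\<in>CI e. tr e e a = \<one>\<^bsub>A e\<^esub>)"
      using tr_sum_exists[of F "\<lambda>f. \<alpha> (s f) (a f)" e] F(1) e by auto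
  qed
next
  assume r: ?r
  show "separable_extension CP SD"
  proof (cases "Obj G = {}")
    case False
    then obtain e where e: "e \<in> Obj G" by blast
    with r obtain a where "a \<in> CI e" "tr e e a = \<one>\<^bsub>A e\<^esub>" by blast
    then show ?thesis by (rule separable_if_single_trace[OF e])
  qed (rule separable_if_no_objects)
qed

section \<open>Object twisted groupoid rings\<close>

context
  fixes B assumes tw: "object_twisted G A \<alpha> B"
begin

lemma twisted_A: "e \<in> Obj G \<Longrightarrow> A e = B"
  using tw by (simp add: object_twisted_def)

lemma twisted_\<alpha>: "\<sigma> \<in> ar \<Longrightarrow> b \<in> carrier B \<Longrightarrow> \<alpha> \<sigma> b = b"
  using tw by (simp add: object_twisted_def)

lemma twisted_CI: "f \<in> Obj G \<Longrightarrow> CI f = ring_center B"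
  using twisted_A[of f] twisted_\<alpha> D_ar by (auto simp: invariants_def hom_in_def ring_center_def)

text \<open>Every term of the trace is \<open>b\<close>, and the number of terms is the index. For
  infinite index both sides are zero.\<close>

lemma twisted_tr:
  assumes f: "f \<in> Obj G" and e: "e \<in> Obj G" and b: "b \<in> ring_center B"
  shows "tr f e b = [index G D f] \<cdot>\<^bsub>B\<^esub> b"
proof -
  interpret B: ring B using ring_A[OF e] twisted_A[OF e] by simp
  have bc: "b \<in> carrier B" using b by (simp add: ring_center_def)
  have "tr f e b = (\<Oplus>\<^bsub>B\<^esub>\<tau>\<in>TT f e. b)"
    unfolding groupoid_trace_def twisted_A[OF e] using twisted_\<alpha> bc T_ar
    by (intro B.finsum_cong') (auto simp: TT_iff)
  also have "\<dots> = [card (TT f e)] \<cdot>\<^bsub>B\<^esub> b"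
    using bc by (rule B.add.finprod_const)
  finally show ?thesis using finite_index_TT(2)[OF f e] by simp
qed

text \<open>Multiplication by n times one, from either side, is the n-fold sum. So a solution
  \<open>b\<close> is a two-sided inverse; conversely n times one is central, and the inverse of a
  central unit is central.\<close>

lemma index_invertible_iff:
  assumes e: "e \<in> Obj G"
  shows "(\<exists>b\<in>ring_center B. [(n::nat)] \<cdot>\<^bsub>B\<^esub> b = \<one>\<^bsub>B\<^esub>) \<longleftrightarrow> [n] \<cdot>\<^bsub>B\<^esub> \<one>\<^bsub>B\<^esub> \<in> Units B"
proof -
  interpret B: ring B using ring_A[OF e] twisted_A[OF e] by simp
  let ?u = "[n] \<cdot>\<^bsub>B\<^esub> \<one>\<^bsub>B\<^esub>"
  have u: "?u \<in> carrier B" by simp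
  have l: "?u \<otimes>\<^bsub>B\<^esub> x = [n] \<cdot>\<^bsub>B\<^esub> x" and r: "x \<otimes>\<^bsub>B\<^esub> ?u = [n] \<cdot>\<^bsub>B\<^esub> x" if "x \<in> carrier B" for x
    using that B.add_pow_ldistr[of "\<one>\<^bsub>B\<^esub>" x n] B.add_pow_rdistr[of x "\<one>\<^bsub>B\<^esub>" n] by simp_all
  show ?thesis
  proof
    assume "\<exists>b\<in>ring_center B. [n] \<cdot>\<^bsub>B\<^esub> b = \<one>\<^bsub>B\<^esub>"
    then obtain b where "b \<in> carrier B" "[n] \<cdot>\<^bsub>B\<^esub> b = \<one>\<^bsub>B\<^esub>" by (auto simp: ring_center_def)
    then show "?u \<in> Units B" using u l r by (auto simp: Units_def)
  next
    assume U: "?u \<in> Units B"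
    let ?b = "inv\<^bsub>B\<^esub> ?u"
    have b: "?b \<in> carrier B" "?u \<otimes>\<^bsub>B\<^esub> ?b = \<one>\<^bsub>B\<^esub>" "?b \<otimes>\<^bsub>B\<^esub> ?u = \<one>\<^bsub>B\<^esub>" using U by auto
    have "x \<otimes>\<^bsub>B\<^esub> ?b = ?b \<otimes>\<^bsub>B\<^esub> x" if x: "x \<in> carrier B" for x
    proof -
      have "x \<otimes>\<^bsub>B\<^esub> ?b = (?b \<otimes>\<^bsub>B\<^esub> ?u) \<otimes>\<^bsub>B\<^esub> (x \<otimes>\<^bsub>B\<^esub> ?b)"
        unfolding b(3) using x b(1) by simp
      also have "\<dots> = ?b \<otimes>\<^bsub>B\<^esub> ((?u \<otimes>\<^bsub>B\<^esub> x) \<otimes>\<^bsub>B\<^esub> ?b)"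
        using x b(1) u by (simp only: B.m_assoc B.m_closed)
      also have "?u \<otimes>\<^bsub>B\<^esub> x = x \<otimes>\<^bsub>B\<^esub> ?u" using l[OF x] r[OF x] by simp
      also have "?b \<otimes>\<^bsub>B\<^esub> ((x \<otimes>\<^bsub>B\<^esub> ?u) \<otimes>\<^bsub>B\<^esub> ?b) = ?b \<otimes>\<^bsub>B\<^esub> (x \<otimes>\<^bsub>B\<^esub> (?u \<otimes>\<^bsub>B\<^esub> ?b))"
        using x b(1) u by (simp only: B.m_assoc B.m_closed)
      also have "\<dots> = ?b \<otimes>\<^bsub>B\<^esub> x" unfolding b(2) using x by simp
      finally show ?thesis .
    qed
    then have "?b \<in> ring_center B" using b(1) by (simp add: ring_center_def)
    moreover have "[n] \<cdot>\<^bsub>B\<^esub> ?b = \<one>\<^bsub>B\<^esub>" using l[OF b(1)] b(2) by simp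
    ultimately show "\<exists>b\<in>ring_center B. [n] \<cdot>\<^bsub>B\<^esub> b = \<one>\<^bsub>B\<^esub>" by blast
  qed
qed

text \<open>With trivial maps \<alpha> the invariants are the whole centre and the trace is
  multiplication by the index, so trace one amounts to inverting the index.\<close>

lemma twisted_tr_one_iff:
  assumes e: "e \<in> Obj G"
  shows "(\<exists>a\<in>CI e. tr e e a = \<one>\<^bsub>A e\<^esub>) \<longleftrightarrow> [index G D e] \<cdot>\<^bsub>B\<^esub> \<one>\<^bsub>B\<^esub> \<in> Units B"
  unfolding index_invertible_iff[OF e, symmetric] twisted_CI[OF e]
  using twisted_tr[OF e e] twisted_A[OF e] by simp

lemma separable_iff_twisted:
  "separable_extension CP SD \<longleftrightarrow>
     (\<forall>e\<in>Obj G. \<exists>F b. finite F \<and> F \<subseteq> Obj_fin G D \<and> (\<forall>f\<in>F. b f \<in> ring_center B) \<and>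
        (\<Oplus>\<^bsub>B\<^esub>f\<in>F. [index G D f] \<cdot>\<^bsub>B\<^esub> b f) = \<one>\<^bsub>B\<^esub>)"
  unfolding separable_iff_trace
proof (intro ball_cong ex_cong1 conj_cong refl)
  fix F and b :: "'g \<Rightarrow> 'a"
  assume "F \<subseteq> Obj_fin G D"
  then have F: "f \<in> Obj G" if "f \<in> F" for f using that by (auto simp: Obj_fin_def)
  show "b f \<in> CI f \<longleftrightarrow> b f \<in> ring_center B" if "f \<in> F" for f
    using twisted_CI[OF F[OF that]] by simp
  fix e assume e: "e \<in> Obj G" and b: "\<forall>f\<in>F. b f \<in> ring_center B"
  interpret B: ring B using ring_A[OF e] twisted_A[OF e] by simp
  have "(\<Oplus>\<^bsub>B\<^esub>f\<in>F. tr f e (b f)) = (\<Oplus>\<^bsub>B\<^esub>f\<in>F. [index G D f] \<cdot>\<^bsub>B\<^esub> b f)"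
    using b twisted_tr[OF F e] by (intro B.finsum_cong') (auto simp: ring_center_def)
  then show "(\<Oplus>\<^bsub>A e\<^esub>f\<in>F. tr f e (b f)) = \<one>\<^bsub>A e\<^esub> \<longleftrightarrow>
      (\<Oplus>\<^bsub>B\<^esub>f\<in>F. [index G D f] \<cdot>\<^bsub>B\<^esub> b f) = \<one>\<^bsub>B\<^esub>"
    unfolding twisted_A[OF e] by simp
qed

lemma separable_iff_normal_twisted:
  assumes "normal_subgroupoid D G"
  shows "separable_extension CP SD \<longleftrightarrow>
    (\<forall>e\<in>Obj G. finite_index G D e \<and> [index G D e] \<cdot>\<^bsub>B\<^esub> \<one>\<^bsub>B\<^esub> \<in> Units B)"
  unfolding separable_iff_normal[OF assms]
  by (intro ball_cong conj_cong refl twisted_tr_one_iff)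

lemma separable_if_twisted:
  assumes "f \<in> Obj G" "[index G D f] \<cdot>\<^bsub>B\<^esub> \<one>\<^bsub>B\<^esub> \<in> Units B"
  shows "separable_extension CP SD"
  using twisted_tr_one_iff[OF assms(1)] assms separable_if_single_trace by blast

end

end

theorem theorem44:
  fixes G :: "'g groupoid_struct"
    and A :: "'g \<Rightarrow> 'a ring"
    and \<alpha> :: "'g \<Rightarrow> 'a \<Rightarrow> 'a"
    and \<beta> :: "'g \<Rightarrow> 'g \<Rightarrow> 'a"
    and D T :: "'g set"
    and R :: "('g \<Rightarrow> 'a) ring"
    and R\<^sub>D :: "('g \<Rightarrow> 'a) set"
  assumes system: "object_crossed_system G A \<alpha> \<beta>"
    and connected: "connected_groupoid G"
    and wide: "wide_subgroupoid D G"
    and transversal: "isotropy_transversal G D T"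
    and R: "R = crossed_product G A \<alpha> \<beta>"
    and R\<^sub>D: "R\<^sub>D = crossed_subring G A \<alpha> \<beta> D"
  shows
    "(separable_extension R R\<^sub>D \<longleftrightarrow>
       (\<forall>e\<in>Obj G. \<exists>F a. finite F \<and> F \<subseteq> Obj_fin G D \<and>
          (\<forall>f\<in>F. a f \<in> central_invariants G A \<alpha> D f) \<and>
          (\<Oplus>\<^bsub>A e\<^esub>f\<in>F. groupoid_trace G A \<alpha> T f e (a f)) = \<one>\<^bsub>A e\<^esub>))
   \<and> ((\<exists>f\<in>Obj G. \<exists>a\<in>central_invariants G A \<alpha> D f.
          finite_index G D f \<and> groupoid_trace G A \<alpha> T f f a = \<one>\<^bsub>A f\<^esub>)
       \<longrightarrow> separable_extension R R\<^sub>D)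
   \<and> (normal_subgroupoid D G \<longrightarrow>
       (separable_extension R R\<^sub>D \<longleftrightarrow>
         (\<forall>e\<in>Obj G. finite_index G D e \<and>
            (\<exists>a\<in>central_invariants G A \<alpha> D e. groupoid_trace G A \<alpha> T e e a = \<one>\<^bsub>A e\<^esub>))))
   \<and> (\<forall>B. object_twisted G A \<alpha> B \<longrightarrow>
       (separable_extension R R\<^sub>D \<longleftrightarrow>
         (\<forall>e\<in>Obj G. \<exists>F b. finite F \<and> F \<subseteq> Obj_fin G D \<and>
            (\<forall>f\<in>F. b f \<in> ring_center B) \<and>
            (\<Oplus>\<^bsub>B\<^esub>f\<in>F. [index G D f] \<cdot>\<^bsub>B\<^esub> b f) = \<one>\<^bsub>B\<^esub>)))
   \<and> (\<forall>B. normal_subgroupoid D G \<and> object_twisted G A \<alpha> B \<longrightarrow>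
       (separable_extension R R\<^sub>D \<longleftrightarrow>
         (\<forall>e\<in>Obj G. finite_index G D e \<and> [index G D e] \<cdot>\<^bsub>B\<^esub> \<one>\<^bsub>B\<^esub> \<in> Units B)))
   \<and> (\<forall>B. object_twisted G A \<alpha> B \<and>
         (\<exists>f\<in>Obj G. finite_index G D f \<and> [index G D f] \<cdot>\<^bsub>B\<^esub> \<one>\<^bsub>B\<^esub> \<in> Units B)
       \<longrightarrow> separable_extension R R\<^sub>D)"
proof -
  interpret connected_crossed_system G A \<alpha> \<beta> D T
    using system connected wide transversal
    by (simp add: connected_crossed_system_def connected_crossed_system_axioms_def
        transversal_crossed_system_def transversal_crossed_system_axioms_def
        wide_crossed_system_def wide_crossed_system_axioms_def)
  show ?thesis
    unfolding R R\<^sub>D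
  proof (intro conjI allI impI; (elim conjE bexE)?)
    fix B assume "normal_subgroupoid D G" "object_twisted G A \<alpha> B"
    then show "separable_extension CP SD \<longleftrightarrow>
        (\<forall>e\<in>Obj G. finite_index G D e \<and> [index G D e] \<cdot>\<^bsub>B\<^esub> \<one>\<^bsub>B\<^esub> \<in> Units B)"
      by (intro separable_iff_normal_twisted)
  qed (fact separable_iff_trace, erule (2) separable_if_single_trace, erule separable_iff_normal,
      erule separable_iff_twisted, erule (2) separable_if_twisted)
qed

end
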